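(* Let $n\ge2$, $q\ge2$, $p=q/(q-1)$, $\alpha\in(0,1)$, and let $\Omega\subset\mathbb{R}^n$ be a bounded connected open set with Lipschitz boundary. Let $f\in L^p(\Omega)\cap B^\alpha_{p,\infty,loc}(\Omega)$ with $\int_\Omega f\,dx=0$, and let $\sigma_0\in L^p(\Omega,\mathbb{R}^n)$ be the solution of the problem $$\inf_{\sigma\in L^p(\Omega,\mathbb{R}^n)}\left\{\int_\Omega\left(\tfrac1p|\sigma|^p+|\sigma|\right)dx:\ -\mathrm{div}\,\sigma=f \text{ in }\Omega,\ \langle\sigma,\nu\rangle=0\text{ on }\partial\Omega\right\}.$$ Then $\sigma_0\in L^r_{loc}(\Omega)$ for all $r\in\left[1,\frac{np}{n-\alpha-1}\right)$.
   Context: $\nu$ is the outer normal on $\partial\Omega$. The constraint in the minimization problem is meant in the weak sense: $\int_\Omega\langle\sigma,\nabla\varphi\rangle\,dx=\int_\Omega f\varphi\,dx$ for all $\varphi\in W^{1,q}(\Omega)$. The infimum is assumed finite, so that the problem has exactly one solution. Besov spaces: for $0<\beta<1$, $1\le m<\infty$, $v\in B^\beta_{m,\infty}(\mathbb{R}^n)$ means $v\in L^m(\mathbb{R}^n)$ and $\sup_{h\in\mathbb{R}^n\setminus\{0\}}\left(\int_{\mathbb{R}^n}\frac{|v(x+h)-v(x)|^m}{|h|^{\beta m}}dx\right)^{1/m}<\infty$. $v\in B^\beta_{m,\infty,loc}(\Omega)$ means $\varphi v\in B^\beta_{m,\infty}(\mathbb{R}^n)$ for every $\varphi\in C_c^\infty(\Omega)$.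 *)

theory Defs
  imports "HOL-Analysis.Analysis"
begin

definition Lp_space :: "real \<Rightarrow> 'a::euclidean_space set \<Rightarrow> ('a \<Rightarrow> 'b::euclidean_space) set" where
  "Lp_space p S = {u \<in> borel_measurable (lebesgue_on S).
                     integrable (lebesgue_on S) (\<lambda>x. norm (u x) powr p)}"

definition Lp_loc :: "real \<Rightarrow> 'a::euclidean_space set \<Rightarrow> ('a \<Rightarrow> 'b::euclidean_space) set" where
  "Lp_loc p \<Omega> = {u. \<forall>K. compact K \<and> K \<subseteq> \<Omega> \<longrightarrow> u \<in> Lp_space p K}"

abbreviation partial_deriv :: "'a::euclidean_space \<Rightarrow> ('a \<Rightarrow> real) \<Rightarrow> 'a \<Rightarrow> real" where
  "partial_deriv i u \<equiv> (\<lambda>x. frechet_derivative u (at x) i)"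

primrec C_k :: "nat \<Rightarrow> ('a::euclidean_space \<Rightarrow> real) \<Rightarrow> bool" where
  "C_k 0 u \<longleftrightarrow> continuous_on UNIV u"
| "C_k (Suc k) u \<longleftrightarrow>
     (\<forall>x. u differentiable (at x)) \<and> (\<forall>i\<in>Basis. C_k k (partial_deriv i u))"

text \<open>The space \<open>C_c\<^sup>\<infinity>(\<Omega>)\<close>; test functions are total and vanish outside \<open>\<Omega>\<close>.\<close>

definition test_functions :: "'a::euclidean_space set \<Rightarrow> ('a \<Rightarrow> real) set" where
  "test_functions \<Omega> = {\<psi>. (\<forall>k. C_k k \<psi>) \<and>
     compact (closure {x. \<psi> x \<noteq> 0}) \<and> closure {x. \<psi> x \<noteq> 0} \<subseteq> \<Omega>}"

definition has_weak_gradient ::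
  "'a::euclidean_space set \<Rightarrow> ('a \<Rightarrow> real) \<Rightarrow> ('a \<Rightarrow> 'a) \<Rightarrow> bool" where
  "has_weak_gradient \<Omega> u G \<longleftrightarrow> u \<in> Lp_loc 1 \<Omega> \<and> G \<in> Lp_loc 1 \<Omega> \<and>
     (\<forall>\<psi>\<in>test_functions \<Omega>. \<forall>i\<in>Basis.
        (LINT x|lebesgue_on \<Omega>. u x * partial_deriv i \<psi> x) =
        - (LINT x|lebesgue_on \<Omega>. (G x \<bullet> i) * \<psi> x))"

text \<open>The Sobolev space \<open>W\<^sup>1\<^sup>,\<^sup>q(\<Omega>)\<close>.\<close>

definition W1_space :: "real \<Rightarrow> 'a::euclidean_space set \<Rightarrow> ('a \<Rightarrow> real) set" where
  "W1_space q \<Omega> = {u \<in> Lp_space q \<Omega>. \<exists>G\<in>Lp_space q \<Omega>. has_weak_gradient \<Omega> u G}"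

text \<open>The Besov space \<open>B\<^sup>\<beta>\<close> with indices \<open>m, \<infinity>\<close> on the whole space. For \<open>v\<close> in \<open>L\<^sup>m\<close> every
  integral below is finite, so the Bochner integral never takes its default value \<open>0\<close>.\<close>

definition Besov_infty :: "real \<Rightarrow> real \<Rightarrow> ('a::euclidean_space \<Rightarrow> real) set" where
  "Besov_infty \<beta> m = {v \<in> Lp_space m UNIV.
     bdd_above ((\<lambda>h. (LINT x|lebesgue. \<bar>v (x + h) - v x\<bar> powr m / norm h powr (\<beta> * m)) powr (1 / m))
                ` (UNIV - {0}))}"

definition Besov_infty_loc ::
  "real \<Rightarrow> real \<Rightarrow> 'a::euclidean_space set \<Rightarrow> ('a \<Rightarrow> real) set" where
  "Besov_infty_loc \<beta> m \<Omega> = {v. \<forall>\<phi>\<in>test_functions \<Omega>. (\<lambda>x. \<phi> x * v x) \<in> Besov_infty \<beta> m}"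

text \<open>Near each boundary point, \<open>\<Omega>\<close> is the part above the graph of a Lipschitz function defined
  on the hyperplane orthogonal to some unit vector \<open>e\<close> (the vertical axis of the rotated frame).\<close>

definition Lipschitz_boundary :: "'a::euclidean_space set \<Rightarrow> bool" where
  "Lipschitz_boundary \<Omega> \<longleftrightarrow>
     (\<forall>x\<in>frontier \<Omega>. \<exists>r>0. \<exists>e L g. norm e = 1 \<and> L-lipschitz_on {z. z \<bullet> e = 0} g \<and>
        \<Omega> \<inter> ball x r = {y \<in> ball x r. y \<bullet> e > g (y - (y \<bullet> e) *\<^sub>R e)})"

text \<open>Fields \<open>\<sigma>\<close> in \<open>L\<^sup>p\<close> with \<open>- div \<sigma> = f\<close> in \<open>\<Omega>\<close> and vanishing normal component on the boundary,
  both encoded by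
  testing against all of \<open>W\<^sup>1\<^sup>,\<^sup>q(\<Omega>)\<close> (no zero trace required). The weak gradient \<open>G\<close>
  is unique almost everywhere.\<close>

definition admissible ::
  "real \<Rightarrow> real \<Rightarrow> 'a::euclidean_space set \<Rightarrow> ('a \<Rightarrow> real) \<Rightarrow> ('a \<Rightarrow> 'a) \<Rightarrow> bool" where
  "admissible p q \<Omega> f \<sigma> \<longleftrightarrow> \<sigma> \<in> Lp_space p \<Omega> \<and>
     (\<forall>\<phi>\<in>W1_space q \<Omega>. \<forall>G. has_weak_gradient \<Omega> \<phi> G \<longrightarrow>
        (LINT x|lebesgue_on \<Omega>. \<sigma> x \<bullet> G x) = (LINT x|lebesgue_on \<Omega>. f x * \<phi> x))"

definition congestion_cost :: "real \<Rightarrow> 'a::euclidean_space set \<Rightarrow> ('a \<Rightarrow> 'a) \<Rightarrow> real" where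
  "congestion_cost p \<Omega> \<sigma> = (LINT x|lebesgue_on \<Omega>. 1 / p * norm (\<sigma> x) powr p + norm (\<sigma> x))"

end

theory Submission
  imports Defs
begin

text \<open>
  Write \<open>H s = |s|^p / p + |s|\<close> for the integrand and \<open>H* g = (|g| - 1)_+^q / q\<close> for its convex
  conjugate. The Fenchel gap \<open>H s + H* g - s . g\<close> is nonnegative, vanishes when \<open>s\<close> is the gradient of
  \<open>H*\<close> at \<open>g\<close>, and, decisively, dominates \<open>|J s - V g|^2 / (2 q)\<close> where
  \<open>J s = |s|^(p/2) s/|s|\<close> and \<open>V g = (|g| - 1)_+^(q/2) g/|g|\<close> (\<open>fenchel_gap_ge\<close>). Both the
  duality argument and the estimate of increments rest on this inequality.

  Formally, the minimiser \<open>\<sigma>\<close> is the gradient of \<open>H*\<close> at \<open>\<nabla>u\<close> for a dual potential \<open>u\<close>. Instead of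
  \<open>u\<close> itself the proof works with almost optimal potentials: among the weak gradients of functions in
  \<open>W\<^sup>1\<^sup>,\<^sup>q(\<Omega>)\<close> there are \<open>g\<close> whose total gap with \<open>\<sigma>\<close> is as small as desired
  (\<open>dual_gap_vanishes\<close>, \<open>minimiser_gap_vanishes\<close>). Indeed, along a minimising sequence the functions
  \<open>V g\<close> form a Cauchy sequence in \<open>L\<^sup>2\<close> by the gap inequality, and their limit determines an
  admissible field which cannot beat \<open>\<sigma>\<close>.

  Let \<open>h\<close> be a small vector and choose such a \<open>g = \<nabla>u\<close> with gap at most \<open>|h|^2\<close>. The constraint is
  tested with \<open>\<zeta>^2 (u(x + h) - u(x))\<close> and its translate by \<open>h\<close>; the increment of \<open>u\<close> is represented as
  the average of \<open>g . h\<close> over the segment from \<open>x\<close> to \<open>x + h\<close>, which makes its weak gradient and its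
  size \<open>O(|h|)\<close> in \<open>L\<^sup>q\<close> consequences of Fubini's theorem and Jensen's inequality. The increment of \<open>f\<close> contributes
  \<open>|h|^\<alpha>\<close>, and the product of the increments of \<open>\<sigma>\<close> and \<open>g\<close> is a signed sum of four gaps, hence, up to small gaps, bounded
  below by the squared increment of \<open>J \<sigma>\<close>. The result is that the square integral of
  \<open>\<zeta> (J \<sigma>(x + h) - J \<sigma>(x))\<close> is \<open>O(|h|^(1 + \<alpha>))\<close> (\<open>difference_estimate\<close>, \<open>local_difference_bound\<close>).

  Such a bound on increments implies integrability with every exponent below
  \<open>2 n / (n - 1 - \<alpha>)\<close> (\<open>difference_quotient_embedding\<close>). Since \<open>|\<sigma>|^p = |J \<sigma>|^2\<close>, this is
  integrability of \<open>|\<sigma>|^r\<close> for \<open>r < n p / (n - 1 - \<alpha>)\<close>.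
\<close>

section \<open>The integrand, its conjugate and the pointwise duality gap\<close>

text \<open>
  The maps \<open>J\<close> and \<open>V\<close> of the introduction are \<open>radial_powr (p / 2)\<close> and \<open>excess_powr (q / 2)\<close>; the
  gradient of the conjugate is \<open>excess_powr (q - 1)\<close>, and \<open>radial_powr (2 / p)\<close> inverts \<open>J\<close>.
\<close>

definition radial_powr :: "real \<Rightarrow> 'b::real_inner \<Rightarrow> 'b" where
  "radial_powr a v = (norm v powr a) *\<^sub>R sgn v"

definition excess_powr :: "real \<Rightarrow> 'b::real_inner \<Rightarrow> 'b" where
  "excess_powr a g = (max 0 (norm g - 1) powr a) *\<^sub>R sgn g"

definition field_cost :: "real \<Rightarrow> 'b::real_inner \<Rightarrow> real" where
  "field_cost p s = 1 / p * norm s powr p + norm s"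

definition conjugate_cost :: "real \<Rightarrow> 'b::real_inner \<Rightarrow> real" where
  "conjugate_cost q g = max 0 (norm g - 1) powr q / q"

definition fenchel_gap :: "real \<Rightarrow> real \<Rightarrow> 'b::real_inner \<Rightarrow> 'b \<Rightarrow> real" where
  "fenchel_gap p q s g = field_cost p s + conjugate_cost q g - s \<bullet> g"

lemma norm_radial_powr [simp]: "norm (radial_powr a v) = norm v powr a"
  by (simp add: radial_powr_def norm_sgn)

lemma norm_excess_powr: "norm (excess_powr a g) = max 0 (norm g - 1) powr a"
  by (auto simp: excess_powr_def norm_sgn)

lemma radial_powr_zero [simp]: "radial_powr a 0 = 0"
  by (simp add: radial_powr_def)

lemma sgn_sgn_vec [simp]: "sgn (sgn v) = sgn (v :: 'b::real_inner)"
  by (cases "v = 0") (simp_all add: sgn_div_norm)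

lemma sgn_radial_powr [simp]: "sgn (radial_powr a v) = sgn v"
  by (cases "v = 0") (simp_all add: radial_powr_def sgn_scaleR)

lemma radial_powr_radial_powr: "radial_powr a (radial_powr b v) = radial_powr (b * a) v"
  by (simp add: radial_powr_def[of a] radial_powr_def[of "b * a"] powr_powr)

lemma radial_powr_one [simp]: "radial_powr 1 v = v"
  by (cases "v = 0") (simp_all add: radial_powr_def sgn_div_norm)

lemma radial_powr_excess_powr: "radial_powr a (excess_powr b g) = excess_powr (b * a) g"
proof (cases "norm g > 1")
  case True
  then have "sgn (excess_powr b g) = sgn g"
    by (simp add: excess_powr_def sgn_scaleR)
  then show ?thesis
    by (simp add: norm_excess_powr radial_powr_def[of a] excess_powr_def[of "b * a"] powr_powr)
next
  case False
  then show ?thesis by (simp add: excess_powr_def max_def)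
qed

lemma radial_powr_conv_scaleR: "radial_powr (1 + c) v = (norm v powr c) *\<^sub>R v"
  by (cases "v = 0") (simp_all add: radial_powr_def sgn_div_norm powr_add)

text \<open>
  With \<open>|y| \<le> |x|\<close>, write the difference as \<open>|x|^c (x - y) + (|x|^c - |y|^c) y\<close>. For
  \<open>r = |y| / |x|\<close> the second term is controlled by \<open>(1 - r^c) r \<le> 1 - r\<close>, which holds because
  \<open>r \<le> r^c\<close>.
\<close>

lemma norm_diff_radial_powr_le:
  fixes x y :: "'b::real_inner"
  assumes c: "0 \<le> c" "c \<le> 1"
  shows "norm (radial_powr (1 + c) x - radial_powr (1 + c) y)
       \<le> 2 * (norm x + norm y) powr c * norm (x - y)"
proof -
  have main: "norm (radial_powr (1 + c) x - radial_powr (1 + c) y)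
      \<le> 2 * (norm x + norm y) powr c * norm (x - y)" if le: "norm y \<le> norm x" for x y :: 'b
  proof (cases "y = 0")
    case True
    then show ?thesis
      by (simp add: radial_powr_conv_scaleR mult_nonneg_nonneg)
  next
    case False
    then have y: "norm y > 0" and x: "norm x > 0" using le by auto
    define r where "r = norm y / norm x"
    have r: "0 < r" "r \<le> 1" using x y le by (auto simp: r_def)
    have rc: "r \<le> r powr c" using powr_mono'[of c 1 r] r c by simp
    have rc1: "r powr c \<le> 1" using r c powr_le1[of c r] by simp
    have yr: "norm y = r * norm x" using x by (simp add: r_def)
    have "(1 - r powr c) * r \<le> 1 * (1 - r)"
    proof -
      have "(1 - r powr c) * r \<le> (1 - r) * 1" by (rule mult_mono) (use r rc rc1 in auto)
      then show ?thesis by simp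
    qed
    then have "norm x powr c * norm x * ((1 - r powr c) * r) \<le> norm x powr c * norm x * (1 - r)"
      by (intro mult_left_mono) auto
    then have *: "(norm x powr c - norm y powr c) * norm y \<le> norm x powr c * (norm x - norm y)"
      using r x unfolding yr by (simp add: powr_mult algebra_simps)
    have eq: "radial_powr (1 + c) x - radial_powr (1 + c) y =
       (norm x powr c) *\<^sub>R (x - y) + (norm x powr c - norm y powr c) *\<^sub>R y"
      by (simp add: radial_powr_conv_scaleR algebra_simps)
    have mono: "norm y powr c \<le> norm x powr c" using le c by (intro powr_mono2) auto
    have "norm (radial_powr (1 + c) x - radial_powr (1 + c) y)
       \<le> norm x powr c * norm (x - y) + (norm x powr c - norm y powr c) * norm y"
      unfolding eq using mono by (intro order.trans[OF norm_triangle_ineq]) simp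
    also have "\<dots> \<le> norm x powr c * norm (x - y) + norm x powr c * norm (x - y)"
      using * mult_left_mono[OF norm_triangle_ineq2[of x y], of "norm x powr c"]
      by (simp add: mult.commute)
    also have "\<dots> \<le> 2 * ((norm x + norm y) powr c * norm (x - y))"
      using mult_right_mono[OF powr_mono2[of c "norm x" "norm x + norm y"], of "norm (x - y)"] c
      by (simp add: mult.commute)
    finally show ?thesis by simp
  qed
  show ?thesis
  proof (cases "norm y \<le> norm x")
    case True then show ?thesis by (rule main)
  next
    case False
    then have "norm x \<le> norm y" by simp
    from main[OF this] show ?thesis by (simp add: norm_minus_commute add.commute)
  qed
qed

lemma norm_diff_square_le:
  fixes x y z :: "'b::real_inner"
  shows "(norm (x - z))\<^sup>2 \<le> 2 * (norm (x - y))\<^sup>2 + 2 * (norm (y - z))\<^sup>2"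
proof -
  have "(norm (x - z))\<^sup>2 \<le> (norm (x - y) + norm (y - z))\<^sup>2"
    using norm_triangle_ineq[of "x - y" "y - z"] by (intro power_mono) auto
  also have "\<dots> \<le> 2 * (norm (x - y))\<^sup>2 + 2 * (norm (y - z))\<^sup>2"
    using sum_squares_bound[of "norm (x - y)" "norm (y - z)"] by (simp add: power2_sum)
  finally show ?thesis .
qed

locale dual_exponents =
  fixes p q :: real
  assumes q2: "2 \<le> q" and p_def: "p = q / (q - 1)"
begin

lemma p_gt1: "1 < p" and p_le2: "p \<le> 2" and q_gt1: "1 < q"
  using q2 by (auto simp: p_def field_simps)

lemma pq: "1 / p + 1 / q = 1" "(q - 1) * p = q" "(p - 1) * q = p" "1 / p = 1 - 1 / q"
  using q2 by (auto simp: p_def field_simps)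

text \<open>
  Put \<open>a = |s|\<close>, \<open>b = (|g| - 1)_+\<close>, \<open>A = a^(p/2)\<close>, \<open>B = b^(q/2)\<close> and let \<open>e\<close> be the cosine of the angle
  between \<open>s\<close> and \<open>g\<close>. Since \<open>|g| \<le> 1 + b\<close>, the gap is at least \<open>A^2 / p + B^2 / q - a b e\<close> if
  \<open>e \<ge> 0\<close>. Here \<open>a b = (A^2)^(1 - 2/q) (A B)^(2/q)\<close>, so that the weighted arithmetic-geometric
  inequality leaves at least the square \<open>(A^2 + B^2 - 2 A B e) / q\<close>. If \<open>e < 0\<close> the mixed term has the
  good sign.
\<close>

lemma fenchel_gap_ge:
  fixes s g :: "'b::real_inner"
  shows "(norm (radial_powr (p / 2) s - excess_powr (q / 2) g))\<^sup>2 / (2 * q) \<le> fenchel_gap p q s g"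
proof -
  define a b e where "a = norm s" and "b = max 0 (norm g - 1)" and "e = sgn s \<bullet> sgn g"
  define A B where "A = a powr (p / 2)" and "B = b powr (q / 2)"
  have pos: "0 \<le> a" "0 \<le> b" "0 \<le> A" "0 \<le> B" "p > 0" "q > 0"
    using p_gt1 q_gt1 by (auto simp: a_def b_def A_def B_def)
  have AB2: "a powr p = A\<^sup>2" "b powr q = B\<^sup>2"
    by (simp_all add: A_def B_def power2_eq_square flip: powr_add)
  have e: "\<bar>e\<bar> \<le> 1"
    unfolding e_def using Cauchy_Schwarz_ineq2[of "sgn s" "sgn g"]
    by (auto simp: norm_sgn split: if_splits)
  have sg: "s \<bullet> g = a * norm g * e"
    by (cases "s = 0 \<or> g = 0") (auto simp: a_def e_def sgn_div_norm field_simps)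
  have gb: "norm g \<le> 1 + b" by (simp add: b_def)
  have nsq: "(norm (radial_powr (p / 2) s - excess_powr (q / 2) g))\<^sup>2 = A\<^sup>2 + B\<^sup>2 - 2 * A * B * e"
  proof -
    have "(norm (x - y))\<^sup>2 = (norm x)\<^sup>2 + (norm y)\<^sup>2 - 2 * (x \<bullet> y)" for x y :: 'b
      by (simp add: power2_norm_eq_inner inner_diff inner_commute algebra_simps)
    then have "(norm (radial_powr (p / 2) s - excess_powr (q / 2) g))\<^sup>2 =
       (norm (radial_powr (p / 2) s))\<^sup>2 + (norm (excess_powr (q / 2) g))\<^sup>2
        - 2 * (radial_powr (p / 2) s \<bullet> excess_powr (q / 2) g)" .
    moreover have "radial_powr (p / 2) s \<bullet> excess_powr (q / 2) g = A * B * e"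
      by (simp add: radial_powr_def excess_powr_def A_def B_def a_def b_def e_def)
    ultimately show ?thesis by (simp add: norm_excess_powr A_def B_def a_def b_def)
  qed
  have gap: "fenchel_gap p q s g = A\<^sup>2 / p + a + B\<^sup>2 / q - a * norm g * e"
    unfolding fenchel_gap_def field_cost_def conjugate_cost_def sg
    using AB2 by (simp add: a_def b_def)
  show ?thesis
  proof (cases "e \<ge> 0")
    case True
    have ab: "a * b \<le> (1 - 2 / q) * A\<^sup>2 + (2 / q) * (A * B)"
    proof (cases "a = 0 \<or> b = 0")
      case True
      then show ?thesis using pos q2 by auto
    next
      case False
      then have gt: "a > 0" "b > 0" "A > 0" "B > 0" using pos by (auto simp: A_def B_def)
      have "(A\<^sup>2) powr (1 - 2 / q) * (A * B) powr (2 / q) \<le> (1 - 2 / q) * A\<^sup>2 + (2 / q) * (A * B)"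
        using q2 gt by (intro Youngs_inequality_0) auto
      moreover have "(A\<^sup>2) powr (1 - 2 / q) * (A * B) powr (2 / q)
            = A powr (2 * (1 - 2 / q) + 2 / q) * B powr (2 / q)"
      proof -
        have A2: "A\<^sup>2 = A powr 2" using gt by simp
        show ?thesis using gt unfolding A2 powr_powr powr_mult powr_add by (simp add: mult_ac)
      qed
      moreover have "2 * (1 - 2 / q) + 2 / q = 2 / p"
        using pq(4) by (simp add: divide_inverse)
      moreover have "A powr (2 / p) = a" "B powr (2 / q) = b"
        using gt pos by (auto simp: A_def B_def powr_powr)
      ultimately show ?thesis by simp
    qed
    have "a * norm g * e \<le> a * (1 + b) * e"
      using gb pos True by (intro mult_right_mono mult_left_mono) auto
    also have "\<dots> = a * e + (a * b) * e" by (simp add: algebra_simps)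
    also have "\<dots> \<le> a * 1 + ((1 - 2 / q) * A\<^sup>2 + (2 / q) * (A * B)) * e"
      using ab pos True e by (intro add_mono mult_right_mono mult_left_mono) auto
    finally have 1: "a * norm g * e \<le> a + (1 - 2 / q) * A\<^sup>2 * e + (2 / q) * (A * B) * e"
      by (simp add: algebra_simps)
    have "(1 - 2 / q) * A\<^sup>2 * e \<le> (1 - 2 / q) * A\<^sup>2 * 1"
      using e q2 by (intro mult_left_mono) auto
    then have 2: "(1 - 2 / q) * A\<^sup>2 * e \<le> A\<^sup>2 / p - A\<^sup>2 / q"
    proof -
      have "A\<^sup>2 / p - A\<^sup>2 / q = A\<^sup>2 * (1 / p) - A\<^sup>2 / q" by simp
      also have "\<dots> = (1 - 2 / q) * A\<^sup>2" unfolding pq(4) by (simp add: algebra_simps)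
      finally show ?thesis using \<open>(1 - 2 / q) * A\<^sup>2 * e \<le> (1 - 2 / q) * A\<^sup>2 * 1\<close> by simp
    qed
    have "(A\<^sup>2 + B\<^sup>2 - 2 * A * B * e) / q \<le> fenchel_gap p q s g"
      unfolding gap using 1 2
      by (simp add: add_divide_distrib diff_divide_distrib algebra_simps)
    moreover have "(A\<^sup>2 + B\<^sup>2 - 2 * A * B * e) / (2 * q) \<le> (A\<^sup>2 + B\<^sup>2 - 2 * A * B * e) / q"
      using pos nsq zero_le_power2 by (intro divide_left_mono) (auto simp: nsq[symmetric])
    ultimately show ?thesis unfolding nsq by linarith
  next
    case False
    have "a * norm g * e \<le> 0" using pos False by (simp add: mult_nonneg_nonpos)
    then have 1: "A\<^sup>2 / p + B\<^sup>2 / q \<le> fenchel_gap p q s g" unfolding gap using pos by simp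
    have "1 / q \<le> 1 / p" using p_le2 p_gt1 q2 by (intro divide_left_mono) auto
    then have "A\<^sup>2 * (1 / q) \<le> A\<^sup>2 * (1 / p)" by (intro mult_left_mono) auto
    then have 2: "A\<^sup>2 / q + B\<^sup>2 / q \<le> fenchel_gap p q s g" using 1 by simp
    have "A * B * (-e) \<le> A * B * 1" using e pos by (intro mult_left_mono) auto
    moreover have "2 * (A * B) \<le> A\<^sup>2 + B\<^sup>2" using sum_squares_bound[of A B] by simp
    ultimately have "A\<^sup>2 + B\<^sup>2 - 2 * A * B * e \<le> 2 * (A\<^sup>2 + B\<^sup>2)" by simp
    then have "(A\<^sup>2 + B\<^sup>2 - 2 * A * B * e) / (2 * q) \<le> 2 * (A\<^sup>2 + B\<^sup>2) / (2 * q)"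
      using pos by (intro divide_right_mono) auto
    then show ?thesis unfolding nsq using 2 by (simp add: add_divide_distrib)
  qed
qed

lemma fenchel_gap_nonneg: "0 \<le> fenchel_gap p q s g"
  by (rule order.trans[OF _ fenchel_gap_ge]) (use q2 in auto)

lemma fenchel_gap_excess [simp]: "fenchel_gap p q (excess_powr (q - 1) g) g = 0"
proof (cases "norm g > 1")
  case True
  define b where "b = norm g - 1"
  have b: "b > 0" "norm g = 1 + b" using True by (auto simp: b_def)
  have "excess_powr (q - 1) g \<bullet> g = b powr (q - 1) * norm g"
  proof -
    have "sgn g \<bullet> g = norm g"
      by (cases "g = 0") (simp_all add: sgn_div_norm dot_square_norm power2_eq_square)
    then show ?thesis using True by (simp add: excess_powr_def b_def)
  qed
  also have "\<dots> = b powr (q - 1) + b powr q"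
    using b powr_mult_base[of b "q - 1"] by (simp add: algebra_simps)
  finally have 1: "excess_powr (q - 1) g \<bullet> g = b powr (q - 1) + b powr q" .
  have 2: "field_cost p (excess_powr (q - 1) g) = b powr q / p + b powr (q - 1)"
    unfolding field_cost_def using b pq(2) by (simp add: norm_excess_powr powr_powr)
  have "b powr q / p + b powr q / q = b powr q * (1 / p + 1 / q)" by (simp add: algebra_simps)
  also have "\<dots> = b powr q" unfolding pq(1) by simp
  finally show ?thesis unfolding fenchel_gap_def 1 2 conjugate_cost_def using b by simp
next
  case False
  then show ?thesis by (simp add: excess_powr_def fenchel_gap_def field_cost_def conjugate_cost_def)
qed

lemma conjugate_cost_eq: "conjugate_cost q g = excess_powr (q - 1) g \<bullet> g - field_cost p (excess_powr (q - 1) g)"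
  using fenchel_gap_excess[of g] by (simp add: fenchel_gap_def)

lemma radial_powr_excess_dual [simp]:
  "radial_powr (p / 2) (excess_powr (q - 1) g) = excess_powr (q / 2) g"
  "radial_powr (2 / p) (excess_powr (q / 2) g) = excess_powr (q - 1) g"
proof -
  have "(q - 1) * (p / 2) = q / 2" "q / 2 * (2 / p) = q - 1"
    using pq p_gt1 by (auto simp: field_simps)
  then show "radial_powr (p / 2) (excess_powr (q - 1) g) = excess_powr (q / 2) g"
    "radial_powr (2 / p) (excess_powr (q / 2) g) = excess_powr (q - 1) g"
    by (auto simp: radial_powr_excess_powr)
qed

lemma radial_powr_inverse [simp]: 
  "radial_powr (2 / p) (radial_powr (p / 2) s) = s"
  "radial_powr (p / 2) (radial_powr (2 / p) s) = s"
  using p_gt1 by (auto simp: radial_powr_radial_powr)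

text \<open>
  The exponents balance: with \<open>c = 2/p - 1\<close> one has \<open>c/2 + 1/q = 1/2\<close>, hence
  \<open>(|x| + |y|)^c m\<close> is at most the square root of \<open>(|x| + |y|)^2 + m^q\<close>. Products of three
  factors thus reduce to products of two square roots of integrable functions.
\<close>

lemma radial_powr_mult_le:
  fixes x y :: "'b::real_inner"
  assumes m: "0 \<le> m"
  shows "norm (radial_powr (2 / p) x - radial_powr (2 / p) y) * m
      \<le> 2 * sqrt ((norm x + norm y)\<^sup>2 + m powr q) * norm (x - y)"
proof -
  define X Z where "X = norm x + norm y" and "Z = X\<^sup>2 + m powr q"
  define c where "c = 2 / p - 1"
  have c2: "c = 2 * (1 / p) - 1" by (simp add: c_def)
  have c: "0 \<le> c" "c \<le> 1" using q2 unfolding c2 pq(4) by auto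
  have X: "0 \<le> X" by (simp add: X_def)
  have cq: "c / 2 + 1 / q = 1 / 2"
    unfolding c2 pq(4) by (simp add: field_simps)
  have "X powr c * m \<le> sqrt Z"
  proof (cases "X = 0 \<or> m = 0")
    case True
    then show ?thesis using m by (auto simp: Z_def)
  next
    case False
    then have gt: "X > 0" "m > 0" using X m by auto
    have Z: "Z > 0" using gt by (auto simp: Z_def add_pos_pos)
    have X2: "X\<^sup>2 = X powr 2" using gt by simp
    have "X powr c = (X\<^sup>2) powr (c / 2)" unfolding X2 powr_powr by simp
    also have "\<dots> \<le> Z powr (c / 2)" using c by (intro powr_mono2) (auto simp: Z_def)
    finally have 1: "X powr c \<le> Z powr (c / 2)" .
    have "m = (m powr q) powr (1 / q)" using gt q2 by (simp add: powr_powr)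
    also have "\<dots> \<le> Z powr (1 / q)" using q2 by (intro powr_mono2) (auto simp: Z_def)
    finally have 2: "m \<le> Z powr (1 / q)" .
    have "X powr c * m \<le> Z powr (c / 2) * Z powr (1 / q)"
      using 1 2 gt by (intro mult_mono) auto
    also have "\<dots> = sqrt Z" using Z unfolding powr_add[symmetric] cq by (simp add: powr_half_sqrt)
    finally show ?thesis .
  qed
  then have *: "(2 * norm (x - y)) * (X powr c * m) \<le> (2 * norm (x - y)) * sqrt Z"
    by (intro mult_left_mono) auto
  have "norm (radial_powr (2 / p) x - radial_powr (2 / p) y) * m
      \<le> (2 * X powr c * norm (x - y)) * m"
    using norm_diff_radial_powr_le[OF c, of x y] m
    by (intro mult_right_mono) (auto simp: c_def X_def)
  then show ?thesis using * unfolding Z_def X_def by (simp add: mult_ac)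
qed

lemma radial_powr_mult_le':
  fixes x y :: "'b::real_inner"
  assumes m: "0 \<le> m" and d: "0 < d"
  shows "norm (radial_powr (2 / p) x - radial_powr (2 / p) y) * m
      \<le> d * ((norm x + norm y)\<^sup>2 + m powr q) + (norm (x - y))\<^sup>2 / d"
proof -
  define Z where "Z = (norm x + norm y)\<^sup>2 + m powr q"
  have Z: "Z \<ge> 0" by (simp add: Z_def)
  have "0 \<le> (d * sqrt Z - norm (x - y))\<^sup>2" by simp
  then have "d * (2 * sqrt Z * norm (x - y)) \<le> d\<^sup>2 * Z + (norm (x - y))\<^sup>2"
    using Z by (simp add: power2_diff power_mult_distrib algebra_simps)
  then have "2 * sqrt Z * norm (x - y) \<le> d * Z + (norm (x - y))\<^sup>2 / d"
    using d by (simp add: field_simps power2_eq_square)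
  then show ?thesis using radial_powr_mult_le[OF m, of x y] unfolding Z_def by linarith
qed

text \<open>
  An upper bound for the gap in terms of the distance of \<open>s\<close> from the gradient of the conjugate at \<open>g\<close>,
  where the gap vanishes. It comes from the subgradient inequality for \<open>|s|^p / p\<close>, which is Young's
  inequality.
\<close>

lemma fenchel_gap_le:
  fixes s g :: "'b::real_inner"
  shows "fenchel_gap p q s g \<le> norm (s - excess_powr (q - 1) g) * (norm s powr (p - 1) + 1 + norm g)"
proof -
  define t where "t = excess_powr (q - 1) g"
  define a b where "a = norm s" and "b = norm t"
  have ab: "0 \<le> a" "0 \<le> b" "a - b \<le> norm (s - t)"
    unfolding a_def b_def using norm_triangle_ineq2 by auto
  have "a powr (p - 1) * b \<le> (a powr (p - 1)) powr q / q + b powr p / p"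
    using ab p_gt1 q_gt1 pq by (intro Youngs_inequality) auto
  also have "(a powr (p - 1)) powr q = a powr p" by (simp add: powr_powr pq)
  finally have y: "a powr (p - 1) * b \<le> a powr p / q + b powr p / p" .
  have "a powr p / p + a powr p / q = a powr p * (1 / p + 1 / q)" by (simp add: algebra_simps)
  then have e: "a powr p / p + a powr p / q = a powr p" by (simp add: pq(1))
  have e2: "a powr p = a powr (p - 1) * a"
    using ab powr_mult_base[of a "p - 1"] by (simp add: mult.commute)
  have "a powr p / p - b powr p / p \<le> a powr (p - 1) * (a - b)"
    using y e unfolding e2 by (simp add: algebra_simps)
  also have "\<dots> \<le> a powr (p - 1) * norm (s - t)"
    using ab by (intro mult_left_mono) auto
  finally have "field_cost p s - field_cost p t \<le> (a powr (p - 1) + 1) * norm (s - t)"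
    using ab by (simp add: field_cost_def a_def b_def algebra_simps)
  moreover have "(t - s) \<bullet> g \<le> norm (s - t) * norm g"
    using norm_cauchy_schwarz[of "t - s" g] by (simp add: norm_minus_commute)
  moreover have "fenchel_gap p q s g = field_cost p s - field_cost p t + (t - s) \<bullet> g"
    unfolding fenchel_gap_def conjugate_cost_eq t_def by (simp add: inner_diff_left)
  ultimately show ?thesis by (simp add: t_def a_def algebra_simps)
qed

text \<open>
  Uniform convexity of the conjugate, measured by \<open>V\<close>. Let \<open>t\<close> be the gradient of the conjugate at the
  midpoint \<open>m\<close>. The gap of \<open>t\<close> vanishes at \<open>m\<close>, and gaps with different first arguments differ by
  affine functions of the second; so the convexity defect is the average of the gaps of \<open>t\<close> at the two
  end points.
\<close>

lemma fenchel_gap_midpoint: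
  fixes s g k :: "'b::real_inner"
  shows "fenchel_gap p q s ((1/2) *\<^sub>R (g + k)) + (norm (excess_powr (q / 2) g - excess_powr (q / 2) k))\<^sup>2 / (8 * q)
     \<le> (fenchel_gap p q s g + fenchel_gap p q s k) / 2"
proof -
  define m where "m = (1/2) *\<^sub>R (g + k)"
  define t where "t = excess_powr (q - 1) m"
  have tg: "t \<bullet> m = (t \<bullet> g + t \<bullet> k) / 2" "s \<bullet> m = (s \<bullet> g + s \<bullet> k) / 2"
    by (simp_all add: m_def inner_add_right)
  have "(fenchel_gap p q s g + fenchel_gap p q s k) / 2 - fenchel_gap p q s m
     = (fenchel_gap p q t g + fenchel_gap p q t k) / 2 - fenchel_gap p q t m"
    unfolding fenchel_gap_def tg by (simp add: field_simps)
  also have "\<dots> = (fenchel_gap p q t g + fenchel_gap p q t k) / 2" unfolding t_def by simp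
  finally have 1: "(fenchel_gap p q s g + fenchel_gap p q s k) / 2 - fenchel_gap p q s m
     = (fenchel_gap p q t g + fenchel_gap p q t k) / 2" .
  define x y z where "x = excess_powr (q / 2) g" and "y = excess_powr (q / 2) m" and "z = excess_powr (q / 2) k"
  have "(norm (y - x))\<^sup>2 / (2 * q) \<le> fenchel_gap p q t g" "(norm (y - z))\<^sup>2 / (2 * q) \<le> fenchel_gap p q t k"
    using fenchel_gap_ge[of t g] fenchel_gap_ge[of t k] by (simp_all add: t_def x_def y_def z_def)
  moreover have "(norm (x - z))\<^sup>2 \<le> 2 * (norm (y - x))\<^sup>2 + 2 * (norm (y - z))\<^sup>2"
    using norm_diff_square_le[of x z y] by (simp add: norm_minus_commute)
  then have "(norm (x - z))\<^sup>2 / (8 * q) \<le> (2 * (norm (y - x))\<^sup>2 + 2 * (norm (y - z))\<^sup>2) / (8 * q)"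
    using q2 by (intro divide_right_mono) auto
  moreover have "(2 * (norm (y - x))\<^sup>2 + 2 * (norm (y - z))\<^sup>2) / (8 * q) =
     ((norm (y - x))\<^sup>2 / (2 * q) + (norm (y - z))\<^sup>2 / (2 * q)) / 2"
    using q2 by (simp add: field_simps)
  ultimately have "(norm (x - z))\<^sup>2 / (8 * q) \<le> (fenchel_gap p q t g + fenchel_gap p q t k) / 2"
    by (smt (verit) divide_right_mono)
  moreover have "c + a \<le> e" if "a \<le> d" "e - c = d" for a c d e :: real using that by simp
  ultimately show ?thesis using 1 unfolding m_def x_def z_def by blast
qed

text \<open>
  The first variation: convexity bounds the increment by the derivative at the end point.
\<close>

lemma fenchel_gap_add_scaleR:
  "fenchel_gap p q s (g + t *\<^sub>R k) - fenchel_gap p q s g \<le> t * ((excess_powr (q - 1) (g + t *\<^sub>R k) - s) \<bullet> k)"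
proof -
  define S where "S = excess_powr (q - 1) (g + t *\<^sub>R k)"
  have "0 \<le> fenchel_gap p q S g" by (rule fenchel_gap_nonneg)
  moreover have "conjugate_cost q (g + t *\<^sub>R k) = S \<bullet> (g + t *\<^sub>R k) - field_cost p S"
    unfolding S_def by (rule conjugate_cost_eq)
  ultimately show ?thesis unfolding S_def[symmetric]
    by (simp add: fenchel_gap_def inner_add_right inner_diff_left algebra_simps)
qed

text \<open>
  The product of two increments is the combination of the four gaps
  \<open>gap(s', g) + gap(s, g') - gap(s, g) - gap(s', g')\<close>. One mixed gap controls \<open>|J s' - V g|^2\<close>, and
  \<open>V g\<close> is close to \<open>J s\<close> when \<open>gap(s, g)\<close> is small.
\<close>

lemma monotonicity_gap:
  fixes s s' g g' :: "'b::real_inner"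
  shows "(norm (radial_powr (p / 2) s' - radial_powr (p / 2) s))\<^sup>2 / (4 * q)
     - 2 * fenchel_gap p q s g - fenchel_gap p q s' g' \<le> (s' - s) \<bullet> (g' - g)"
proof -
  have id: "(s' - s) \<bullet> (g' - g) = fenchel_gap p q s' g + fenchel_gap p q s g'
      - fenchel_gap p q s g - fenchel_gap p q s' g'"
    by (simp add: fenchel_gap_def inner_diff algebra_simps)
  define x y z where "x = radial_powr (p / 2) s'" and "y = excess_powr (q / 2) g" and "z = radial_powr (p / 2) s"
  have 1: "(norm (x - y))\<^sup>2 / (2 * q) \<le> fenchel_gap p q s' g" "(norm (z - y))\<^sup>2 / (2 * q) \<le> fenchel_gap p q s g"
    using fenchel_gap_ge[of s' g] fenchel_gap_ge[of s g] by (simp_all add: x_def y_def z_def)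
  have "(norm (x - z))\<^sup>2 / (4 * q) \<le> (2 * (norm (x - y))\<^sup>2 + 2 * (norm (y - z))\<^sup>2) / (4 * q)"
    using q2 norm_diff_square_le[of x z y] by (intro divide_right_mono) auto
  also have "\<dots> = (norm (x - y))\<^sup>2 / (2 * q) + (norm (z - y))\<^sup>2 / (2 * q)"
    using q2 by (simp add: norm_minus_commute field_simps)
  finally show ?thesis using 1 fenchel_gap_nonneg[of s g'] id unfolding x_def z_def by linarith
qed

lemma norm_radial_powr_square [simp]: "(norm (radial_powr (p / 2) s))\<^sup>2 = norm s powr p"
  by (simp add: power2_eq_square flip: powr_add)

lemma norm_powr_le_excess: "norm g powr q \<le> 2 powr q * (1 + (norm (excess_powr (q / 2) g))\<^sup>2)"
proof -
  define b where "b = max 0 (norm g - 1)"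
  have sq: "(norm (excess_powr (q / 2) g))\<^sup>2 = b powr q"
    by (simp add: b_def norm_excess_powr power2_eq_square flip: powr_add)
  have "norm g \<le> 2 * max 1 b" by (auto simp: b_def max_def)
  then have "norm g powr q \<le> (2 * max 1 b) powr q" using q2 by (intro powr_mono2) auto
  also have "\<dots> = 2 powr q * max 1 b powr q" by (simp add: powr_mult)
  also have "max 1 b powr q \<le> 1 + b powr q" by (auto simp: max_def)
  finally show ?thesis unfolding sq by simp
qed

lemma excess_square_le: "(norm (excess_powr (q / 2) g))\<^sup>2 \<le> norm g powr q"
proof -
  have "(norm (excess_powr (q / 2) g))\<^sup>2 = max 0 (norm g - 1) powr q"
    by (simp add: norm_excess_powr power2_eq_square flip: powr_add)
  also have "\<dots> \<le> norm g powr q" using q2 by (intro powr_mono2) auto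
  finally show ?thesis .
qed

lemma norm_radial_powr_dual: "norm (radial_powr (2 / p) v) powr p = (norm v)\<^sup>2"
  using p_gt1 by (cases "v = 0") (simp_all add: powr_powr)

end

section \<open>Vanishing of the duality gap\<close>

lemma measurable_radial_powr [measurable]:
  fixes f :: "'a \<Rightarrow> 'b::euclidean_space"
  assumes [measurable]: "f \<in> borel_measurable M"
  shows "(\<lambda>x. radial_powr a (f x)) \<in> borel_measurable M"
  unfolding radial_powr_def sgn_div_norm by measurable

lemma measurable_excess_powr [measurable]:
  fixes f :: "'a \<Rightarrow> 'b::euclidean_space"
  assumes [measurable]: "f \<in> borel_measurable M"
  shows "(\<lambda>x. excess_powr a (f x)) \<in> borel_measurable M"
  unfolding excess_powr_def sgn_div_norm by measurable

lemma measurable_fenchel_gap [measurable]: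
  fixes f g :: "'a \<Rightarrow> 'b::euclidean_space"
  assumes [measurable]: "f \<in> borel_measurable M" "g \<in> borel_measurable M"
  shows "(\<lambda>x. fenchel_gap p q (f x) (g x)) \<in> borel_measurable M"
    "(\<lambda>x. field_cost p (f x)) \<in> borel_measurable M"
    "(\<lambda>x. conjugate_cost q (f x)) \<in> borel_measurable M"
  unfolding fenchel_gap_def field_cost_def conjugate_cost_def by measurable

text \<open>
  The weighted sum of the squared increments, with weights \<open>4^k\<close>, has finite integral. Where its value
  \<open>F x\<close> is finite, the increments are at most \<open>2^(-k) (F x)^(1/2)\<close>; summation gives pointwise
  convergence together with the bound \<open>4 (1/4)^k F x\<close> for the squared distance to the limit.
\<close>

lemma L2_complete:
  fixes V :: "nat \<Rightarrow> 'a \<Rightarrow> 'b::{banach, second_countable_topology}"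
  assumes V [measurable]: "\<And>k. V k \<in> borel_measurable M"
    and int: "\<And>k. integrable M (\<lambda>x. (norm (V (Suc k) x - V k x))\<^sup>2)"
    and bound: "\<And>k. (LINT x|M. (norm (V (Suc k) x - V k x))\<^sup>2) \<le> C * (1/16) ^ k"
  obtains W D where "W \<in> borel_measurable M" "0 \<le> D"
    "\<And>k. integrable M (\<lambda>x. (norm (V k x - W x))\<^sup>2)"
    "\<And>k. (LINT x|M. (norm (V k x - W x))\<^sup>2) \<le> D * (1/4) ^ k"
proof -
  define F where "F x = (\<Sum>k. ennreal (4 ^ k * (norm (V (Suc k) x - V k x))\<^sup>2))" for x
  define W where "W x = lim (\<lambda>k. V k x)" for x
  have F [measurable]: "F \<in> borel_measurable M" unfolding F_def by measurable
  have W [measurable]: "W \<in> borel_measurable M" unfolding W_def by measurable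
  have "0 \<le> (LINT x|M. (norm (V (Suc 0) x - V 0 x))\<^sup>2)" by simp
  also have "\<dots> \<le> C" using bound[of 0] by simp
  finally have C: "0 \<le> C" .
  have "(\<integral>\<^sup>+x. F x \<partial>M) = (\<Sum>k. \<integral>\<^sup>+x. ennreal (4 ^ k * (norm (V (Suc k) x - V k x))\<^sup>2) \<partial>M)"
    unfolding F_def by (rule nn_integral_suminf) measurable
  also have "\<dots> \<le> (\<Sum>k. ennreal (C * (1/4) ^ k))"
  proof (intro suminf_le summableI)
    fix k
    have "(\<integral>\<^sup>+x. ennreal (4 ^ k * (norm (V (Suc k) x - V k x))\<^sup>2) \<partial>M)
       = ennreal (LINT x|M. 4 ^ k * (norm (V (Suc k) x - V k x))\<^sup>2)"
      using int by (intro nn_integral_eq_integral) auto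
    also have "\<dots> \<le> ennreal (C * (1/4) ^ k)"
    proof (rule ennreal_leI)
      have "(LINT x|M. 4 ^ k * (norm (V (Suc k) x - V k x))\<^sup>2) \<le> 4 ^ k * (C * (1/16) ^ k)"
        using bound[of k] by simp
      also have "\<dots> = C * (4 * (1/16)) ^ k" by (simp only: power_mult_distrib mult_ac)
      finally show "(LINT x|M. 4 ^ k * (norm (V (Suc k) x - V k x))\<^sup>2) \<le> C * (1/4) ^ k" by simp
    qed
    finally show "(\<integral>\<^sup>+x. ennreal (4 ^ k * (norm (V (Suc k) x - V k x))\<^sup>2) \<partial>M) \<le> ennreal (C * (1/4) ^ k)" .
  qed
  also have "\<dots> = ennreal (\<Sum>k. C * (1/4) ^ k)"
    using C by (intro suminf_ennreal2) (auto intro!: summable_mult summable_geometric)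
  finally have Ffin: "(\<integral>\<^sup>+x. F x \<partial>M) < \<infinity>" by (auto intro: order.strict_trans1)
  then have Fae: "AE x in M. F x \<noteq> \<infinity>" by (intro nn_integral_noteq_infinite) auto
  define D where "D = 4 * enn2real (\<integral>\<^sup>+x. F x \<partial>M)"
  have key: "AE x in M. \<forall>k. ennreal ((norm (V k x - W x))\<^sup>2) \<le> ennreal (4 * (1/4) ^ k) * F x"
    using Fae
  proof eventually_elim
    fix x assume fin: "F x \<noteq> \<infinity>"
    define f where "f = enn2real (F x)"
    have f: "F x = ennreal f" "0 \<le> f" using fin by (simp_all add: f_def ennreal_enn2real_if)
    have step: "norm (V (Suc k) x - V k x) \<le> sqrt f * (1/2) ^ k" for k
    proof -
      have "ennreal (4 ^ k * (norm (V (Suc k) x - V k x))\<^sup>2) \<le> F x"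
      proof -
        have "(\<Sum>k\<in>{k}. ennreal (4 ^ k * (norm (V (Suc k) x - V k x))\<^sup>2)) \<le> F x"
          unfolding F_def by (intro sum_le_suminf summableI) auto
        then show ?thesis by (simp only: sum.insert[OF finite.emptyI] sum.empty empty_iff not_False_eq_True add_0_right)
      qed
      then have "4 ^ k * (norm (V (Suc k) x - V k x))\<^sup>2 \<le> f" using f by simp
      moreover have "4 ^ k * (norm (V (Suc k) x - V k x))\<^sup>2 = (2 ^ k * norm (V (Suc k) x - V k x))\<^sup>2"
      proof -
        have "(4::real) ^ k = (2 ^ k)\<^sup>2" by (simp add: power2_eq_square flip: power_mult_distrib)
        then show ?thesis by (simp add: power_mult_distrib)
      qed
      ultimately have "2 ^ k * norm (V (Suc k) x - V k x) \<le> sqrt f"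
        using real_le_rsqrt by metis
      then show ?thesis by (simp add: field_simps)
    qed
    have sm: "summable (\<lambda>k. norm (V (Suc k) x - V k x))"
      by (rule summable_comparison_test'[where g = "\<lambda>k. sqrt f * (1/2) ^ k"])
        (use step in \<open>auto intro!: summable_mult summable_geometric\<close>)
    have conv: "(\<lambda>k. V k x) \<longlonglongrightarrow> W x"
    proof -
      have "convergent (\<lambda>k. \<Sum>i<k. V (Suc i) x - V i x)"
        using summable_norm_cancel[OF sm] by (simp add: summable_iff_convergent)
      then have "convergent (\<lambda>k. V 0 x + (V k x - V 0 x))"
        by (intro convergent_add convergent_const) (simp add: sum_lessThan_telescope[of "\<lambda>i. V i x"])
      then show ?thesis unfolding W_def by (simp add: convergent_LIMSEQ_iff)
    qed
    show "\<forall>k. ennreal ((norm (V k x - W x))\<^sup>2) \<le> ennreal (4 * (1/4) ^ k) * F x"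
    proof
      fix k
      have fin: "norm (V k x - V (k + n) x) \<le> 2 * sqrt f * (1/2) ^ k * (1 - (1/2)^n)" for n
      proof (induction n)
        case (Suc n)
        have "norm (V k x - V (k + Suc n) x) \<le> norm (V k x - V (k + n) x) + norm (V (Suc (k + n)) x - V (k + n) x)"
          using norm_triangle_ineq[of "V k x - V (k + n) x" "V (k + n) x - V (k + Suc n) x"]
          by (simp add: norm_minus_commute)
        also have "\<dots> \<le> 2 * sqrt f * (1/2) ^ k * (1 - (1/2)^n) + sqrt f * (1/2) ^ (k + n)"
          using Suc step by (intro add_mono) auto
        also have "\<dots> = 2 * sqrt f * (1/2) ^ k * (1 - (1/2)^Suc n)"
          by (simp add: power_add algebra_simps)
        finally show ?case .
      qed simp
      have "norm (V k x - V (k + n) x) \<le> 2 * sqrt f * (1/2) ^ k" for n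
      proof -
        have "2 * sqrt f * (1/2) ^ k * (1 - (1/2)^n) \<le> 2 * sqrt f * (1/2) ^ k * 1"
          using f by (intro mult_left_mono) auto
        then show ?thesis using fin[of n] by simp
      qed
      moreover have "(\<lambda>n. norm (V k x - V (k + n) x)) \<longlonglongrightarrow> norm (V k x - W x)"
        using LIMSEQ_ignore_initial_segment[OF conv, of k]
        by (intro tendsto_intros) (simp add: add.commute)
      ultimately have "norm (V k x - W x) \<le> 2 * sqrt f * (1/2) ^ k"
        by (intro LIMSEQ_le_const2) auto
      then have "(norm (V k x - W x))\<^sup>2 \<le> (2 * sqrt f * (1/2) ^ k)\<^sup>2"
        by (intro power_mono) auto
      also have "\<dots> = 4 * ((1/2)\<^sup>2) ^ k * f"
        using f by (simp only: power_mult_distrib real_sqrt_pow2 power_commutes flip: power_mult)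
          (simp add: mult.commute)
      finally have "(norm (V k x - W x))\<^sup>2 \<le> (4 * (1/4) ^ k) * f" by (simp add: power2_eq_square)
      then show "ennreal ((norm (V k x - W x))\<^sup>2) \<le> ennreal (4 * (1/4) ^ k) * F x"
        unfolding f(1) by (subst ennreal_mult[symmetric]) (use f in auto)
    qed
  qed
  have nn: "(\<integral>\<^sup>+x. ennreal ((norm (V k x - W x))\<^sup>2) \<partial>M) \<le> ennreal (D * (1/4) ^ k)" for k
  proof -
    have "(\<integral>\<^sup>+x. ennreal ((norm (V k x - W x))\<^sup>2) \<partial>M) \<le> (\<integral>\<^sup>+x. ennreal (4 * (1/4) ^ k) * F x \<partial>M)"
      using key by (intro nn_integral_mono_AE) auto
    also have "\<dots> = ennreal (4 * (1/4) ^ k) * (\<integral>\<^sup>+x. F x \<partial>M)" by (rule nn_integral_cmult) auto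
    also have "\<dots> = ennreal (4 * (1/4) ^ k) * ennreal (D / 4)"
      using Ffin by (simp add: D_def)
    also have "\<dots> = ennreal (D * (1/4) ^ k)"
      by (subst ennreal_mult[symmetric]) (auto simp: D_def)
    finally show ?thesis .
  qed
  have i: "integrable M (\<lambda>x. (norm (V k x - W x))\<^sup>2)" for k
    using nn[of k] by (intro integrableI_bounded) (auto intro: order.strict_trans1)
  have "(LINT x|M. (norm (V k x - W x))\<^sup>2) \<le> D * (1/4) ^ k" for k
  proof -
    have "ennreal (LINT x|M. (norm (V k x - W x))\<^sup>2) \<le> ennreal (D * (1/4) ^ k)"
      using nn[of k] nn_integral_eq_integral[OF i[of k]] by simp
    then show ?thesis by (subst (asm) ennreal_le_iff) (auto simp: D_def)
  qed
  moreover have "0 \<le> D" by (simp add: D_def)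
  ultimately show ?thesis using that[OF W _ i] by blast
qed

lemma powr_add_le:
  fixes a b r :: real
  assumes "0 \<le> a" "0 \<le> b" "0 \<le> r"
  shows "(a + b) powr r \<le> 2 powr r * (a powr r + b powr r)"
proof -
  have "(a + b) powr r \<le> (2 * max a b) powr r" using assms by (intro powr_mono2) auto
  also have "\<dots> = 2 powr r * max a b powr r" using assms by (simp add: powr_mult)
  also have "max a b powr r \<le> a powr r + b powr r" by (simp add: max_def)
  finally show ?thesis by simp
qed

lemma integrable_of_powr:
  fixes u :: "'a \<Rightarrow> 'b::euclidean_space"
  assumes "finite_measure M" "u \<in> borel_measurable M" "1 \<le> r" "integrable M (\<lambda>x. norm (u x) powr r)"
  shows "integrable M u"
proof -
  interpret finite_measure M by fact
  show ?thesis
  proof (rule Bochner_Integration.integrable_bound)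
    show "integrable M (\<lambda>x. 1 + norm (u x) powr r)" using assms by auto
    have "norm (u x) \<le> 1 + norm (u x) powr r" for x
    proof (cases "norm (u x) \<le> 1")
      case False
      then have "norm (u x) powr 1 \<le> norm (u x) powr r" using assms by (intro powr_mono) auto
      then show ?thesis by simp
    qed (auto intro: add_increasing2)
    then show "AE x in M. norm (u x) \<le> norm (1 + norm (u x) powr r)" by auto
  qed fact
qed

lemma integrable_powr_diff:
  fixes u v :: "'a \<Rightarrow> 'b::euclidean_space"
  assumes [measurable]: "u \<in> borel_measurable M" "v \<in> borel_measurable M"
    and i: "integrable M (\<lambda>x. norm (u x) powr r)" "integrable M (\<lambda>x. norm (v x) powr r)" and r: "0 \<le> r"
  shows "integrable M (\<lambda>x. norm (u x - v x) powr r)"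
proof (rule Bochner_Integration.integrable_bound)
  show "integrable M (\<lambda>x. 2 powr r * (norm (u x) powr r + norm (v x) powr r))" using i by auto
  have "norm (u x - v x) powr r \<le> 2 powr r * (norm (u x) powr r + norm (v x) powr r)" for x
    using r by (intro order.trans[OF powr_mono2[OF _ _ norm_triangle_ineq4] powr_add_le]) auto
  then show "AE x in M. norm (norm (u x - v x) powr r)
      \<le> norm (2 powr r * (norm (u x) powr r + norm (v x) powr r))"
    by (intro AE_I2) (auto intro: order.trans[OF _ abs_ge_self])
qed measurable

context dual_exponents
begin

lemma young_inner: "\<bar>s \<bullet> g\<bar> \<le> norm s powr p + norm g powr q" for s g :: "'b::real_inner"
proof -
  have "\<bar>s \<bullet> g\<bar> \<le> norm s * norm g" by (rule Cauchy_Schwarz_ineq2)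
  also have "\<dots> \<le> norm s powr p / p + norm g powr q / q"
    using p_gt1 q_gt1 pq by (intro Youngs_inequality) auto
  also have "\<dots> \<le> norm s powr p + norm g powr q"
    using p_gt1 q_gt1 mult_right_mono[of 1 p "norm s powr p"] mult_right_mono[of 1 q "norm g powr q"]
    by (intro add_mono) (auto simp: divide_le_eq mult.commute)
  finally show ?thesis .
qed

lemma integrable_inner:
  fixes s g :: "'a \<Rightarrow> 'b::euclidean_space"
  assumes [measurable]: "s \<in> borel_measurable M" "g \<in> borel_measurable M"
    and "integrable M (\<lambda>x. norm (s x) powr p)" "integrable M (\<lambda>x. norm (g x) powr q)"
  shows "integrable M (\<lambda>x. s x \<bullet> g x)"
proof (rule Bochner_Integration.integrable_bound)
  show "integrable M (\<lambda>x. norm (s x) powr p + norm (g x) powr q)" using assms by auto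
qed (use young_inner in auto)

lemma integrable_excess_square:
  fixes g :: "'a \<Rightarrow> 'b::euclidean_space"
  assumes [measurable]: "g \<in> borel_measurable M" and "integrable M (\<lambda>x. norm (g x) powr q)"
  shows "integrable M (\<lambda>x. (norm (excess_powr (q / 2) (g x)))\<^sup>2)"
  by (rule Bochner_Integration.integrable_bound[OF assms(2)]) (use excess_square_le in auto)

lemma integrable_norm_diff_square:
  fixes u v :: "'a \<Rightarrow> 'b::euclidean_space"
  assumes [measurable]: "u \<in> borel_measurable M" "v \<in> borel_measurable M"
    and "integrable M (\<lambda>x. (norm (u x))\<^sup>2)" "integrable M (\<lambda>x. (norm (v x))\<^sup>2)"
  shows "integrable M (\<lambda>x. (norm (u x - v x))\<^sup>2)"
proof (rule Bochner_Integration.integrable_bound)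
  show "integrable M (\<lambda>x. 2 * (norm (u x))\<^sup>2 + 2 * (norm (v x))\<^sup>2)" using assms by auto
  show "AE x in M. norm ((norm (u x - v x))\<^sup>2) \<le> norm (2 * (norm (u x))\<^sup>2 + 2 * (norm (v x))\<^sup>2)"
    using norm_diff_square_le[of "u _" "v _" 0] by auto
qed measurable

lemma integrable_gap:
  fixes s g :: "'a \<Rightarrow> 'b::euclidean_space"
  assumes "finite_measure M"
    and [measurable]: "s \<in> borel_measurable M" "g \<in> borel_measurable M"
    and s: "integrable M (\<lambda>x. norm (s x) powr p)" and g: "integrable M (\<lambda>x. norm (g x) powr q)"
  shows "integrable M (\<lambda>x. field_cost p (s x))" "integrable M (\<lambda>x. conjugate_cost q (g x))"
    "integrable M (\<lambda>x. fenchel_gap p q (s x) (g x))"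
proof -
  interpret finite_measure M by fact
  have "integrable M (\<lambda>x. norm (s x))"
    using p_gt1 by (intro integrable_norm integrable_of_powr[OF \<open>finite_measure M\<close> _ _ s]) auto
  then show 1: "integrable M (\<lambda>x. field_cost p (s x))"
    unfolding field_cost_def using s by auto
  have "conjugate_cost q (g x) = (norm (excess_powr (q / 2) (g x)))\<^sup>2 / q" for x
    by (simp add: conjugate_cost_def norm_excess_powr power2_eq_square flip: powr_add)
  then show 2: "integrable M (\<lambda>x. conjugate_cost q (g x))"
    using integrable_excess_square[OF _ g] by simp
  show "integrable M (\<lambda>x. fenchel_gap p q (s x) (g x))"
    unfolding fenchel_gap_def using 1 2 integrable_inner[OF _ _ s g] by auto
qed

text \<open>
  Weak continuity of the inverse of \<open>J\<close>: for \<open>U\<close> close to \<open>W\<close> in \<open>L\<^sup>2\<close>, the fields with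
  \<open>J\<close>-images \<open>U\<close> and \<open>W\<close> are close against weights \<open>m\<close> in \<open>L\<^sup>q\<close>.
\<close>

lemma integral_radial_powr_mult_le:
  fixes U W :: "'a \<Rightarrow> 'b::euclidean_space"
  assumes [measurable]: "U \<in> borel_measurable M" "W \<in> borel_measurable M" "m \<in> borel_measurable M"
    and U: "integrable M (\<lambda>x. (norm (U x))\<^sup>2)" and W: "integrable M (\<lambda>x. (norm (W x))\<^sup>2)"
    and m: "integrable M (\<lambda>x. m x powr q)" "\<And>x. 0 \<le> m x"
    and e: "0 < e" "(LINT x|M. (norm (U x - W x))\<^sup>2) \<le> e\<^sup>2"
  shows "integrable M (\<lambda>x. norm (radial_powr (2/p) (U x) - radial_powr (2/p) (W x)) * m x)" (is ?I)
    and "(LINT x|M. norm (radial_powr (2/p) (U x) - radial_powr (2/p) (W x)) * m x)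
       \<le> e * (6 * (LINT x|M. (norm (W x))\<^sup>2) + 4 * e\<^sup>2 + (LINT x|M. m x powr q) + 1)"
proof -
  note UW = integrable_norm_diff_square[OF _ _ U W]
  have bd: "norm (radial_powr (2/p) (U x) - radial_powr (2/p) (W x)) * m x
     \<le> e * (6 * (norm (W x))\<^sup>2 + 4 * (norm (U x - W x))\<^sup>2 + m x powr q) + (norm (U x - W x))\<^sup>2 / e" for x
  proof -
    have "(norm (U x) + norm (W x))\<^sup>2 \<le> 2 * (norm (U x))\<^sup>2 + 2 * (norm (W x))\<^sup>2"
      using sum_squares_bound[of "norm (U x)" "norm (W x)"] by (simp add: power2_sum)
    moreover have "(norm (U x))\<^sup>2 \<le> 2 * (norm (U x - W x))\<^sup>2 + 2 * (norm (W x))\<^sup>2"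
      using norm_diff_square_le[of "U x" 0 "W x"] by simp
    ultimately have "e * ((norm (U x) + norm (W x))\<^sup>2 + m x powr q)
      \<le> e * (6 * (norm (W x))\<^sup>2 + 4 * (norm (U x - W x))\<^sup>2 + m x powr q)"
      using e by (intro mult_left_mono) auto
    then show ?thesis using radial_powr_mult_le'[OF m(2) e(1), of "U x" "W x" x] by linarith
  qed
  have ib: "integrable M (\<lambda>x. e * (6 * (norm (W x))\<^sup>2 + 4 * (norm (U x - W x))\<^sup>2 + m x powr q) + (norm (U x - W x))\<^sup>2 / e)"
    using UW W m by auto
  show I: ?I
    by (rule Bochner_Integration.integrable_bound[OF ib]) (use bd m in \<open>auto intro!: AE_I2 order.trans[OF bd]\<close>)
  have "(LINT x|M. norm (radial_powr (2/p) (U x) - radial_powr (2/p) (W x)) * m x)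
     \<le> (LINT x|M. e * (6 * (norm (W x))\<^sup>2 + 4 * (norm (U x - W x))\<^sup>2 + m x powr q) + (norm (U x - W x))\<^sup>2 / e)"
    by (intro integral_mono I ib bd)
  also have "\<dots> = e * (6 * (LINT x|M. (norm (W x))\<^sup>2) + 4 * (LINT x|M. (norm (U x - W x))\<^sup>2) + (LINT x|M. m x powr q))
      + (LINT x|M. (norm (U x - W x))\<^sup>2) / e"
    using UW W m by simp
  also have "\<dots> \<le> e * (6 * (LINT x|M. (norm (W x))\<^sup>2) + 4 * e\<^sup>2 + (LINT x|M. m x powr q)) + e\<^sup>2 / e"
    using e by (intro add_mono mult_left_mono divide_right_mono) auto
  finally show "(LINT x|M. norm (radial_powr (2/p) (U x) - radial_powr (2/p) (W x)) * m x)
       \<le> e * (6 * (LINT x|M. (norm (W x))\<^sup>2) + 4 * e\<^sup>2 + (LINT x|M. m x powr q) + 1)"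
    using e by (simp add: power2_eq_square algebra_simps)
qed

text \<open>
  Duality without attainment, for a linear space \<open>X\<close> of fields in \<open>L\<^sup>q\<close>. Take \<open>g\<^sub>k\<close> in \<open>X\<close> whose
  total gap exceeds the infimum \<open>d\<close> by at most \<open>16^(-k)\<close>. By midpoint convexity \<open>V g\<^sub>k\<close> converges in
  \<open>L\<^sup>2\<close> to some \<open>W\<close>; let \<open>t\<close> be the field with \<open>J t = W\<close>. Perturbing \<open>g\<^sub>k\<close> in a direction \<open>h\<close> by the step
  \<open>4^(-k)\<close>, much larger than the defect \<open>16^(-k)\<close> but still tending to zero, shows that \<open>t - s\<close> is orthogonal to \<open>X\<close>.
  Therefore \<open>t\<close> is a competitor, so passing from \<open>s\<close> to \<open>t\<close> does not decrease the cost, nor the total gap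
  with \<open>g\<^sub>k\<close>; and the total gap of \<open>t\<close> with \<open>g\<^sub>k\<close> tends to zero because the gradient of the
  conjugate at \<open>g\<^sub>k\<close> tends to \<open>t\<close>.
\<close>

theorem dual_gap_vanishes:
  fixes M :: "'a measure" and X :: "('a \<Rightarrow> 'b::euclidean_space) set" and s :: "'a \<Rightarrow> 'b"
  assumes "finite_measure M"
    and X_meas: "\<And>g. g \<in> X \<Longrightarrow> g \<in> borel_measurable M"
    and X_int: "\<And>g. g \<in> X \<Longrightarrow> integrable M (\<lambda>x. norm (g x) powr q)"
    and X_ne: "X \<noteq> {}"
    and X_lin: "\<And>g k a b. g \<in> X \<Longrightarrow> k \<in> X \<Longrightarrow> (\<lambda>x. a *\<^sub>R g x + b *\<^sub>R k x) \<in> X"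
    and s_meas: "s \<in> borel_measurable M" and s_int: "integrable M (\<lambda>x. norm (s x) powr p)"
    and minimal: "\<And>t. t \<in> borel_measurable M \<Longrightarrow> integrable M (\<lambda>x. norm (t x) powr p) \<Longrightarrow>
       (\<And>g. g \<in> X \<Longrightarrow> (LINT x|M. t x \<bullet> g x) = (LINT x|M. s x \<bullet> g x)) \<Longrightarrow>
       (LINT x|M. field_cost p (s x)) \<le> (LINT x|M. field_cost p (t x))"
    and e: "0 < e"
  shows "\<exists>g\<in>X. (LINT x|M. fenchel_gap p q (s x) (g x)) \<le> e"
proof -
  interpret finite_measure M by fact
  note [measurable] = s_meas X_meas
  define Gap where "Gap g = (LINT x|M. fenchel_gap p q (s x) (g x))" for g
  define d where "d = (INF g\<in>X. Gap g)"
  have gap_int: "integrable M (\<lambda>x. fenchel_gap p q (s x) (g x))" if "g \<in> X" for g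
    using integrable_gap(3)[OF \<open>finite_measure M\<close> s_meas X_meas s_int X_int] that by blast
  have Gap0: "0 \<le> Gap g" for g unfolding Gap_def by (simp add: fenchel_gap_nonneg)
  have bdd: "bdd_below (Gap ` X)" using Gap0 by (auto intro!: bdd_belowI[of _ 0])
  have d_le: "d \<le> Gap g" if "g \<in> X" for g unfolding d_def using bdd that by (rule cINF_lower)
  have d0: "0 \<le> d" unfolding d_def using X_ne Gap0 by (intro cINF_greatest) auto
  have V_int: "integrable M (\<lambda>x. (norm (excess_powr (q / 2) (g x)))\<^sup>2)" if "g \<in> X" for g
    using integrable_excess_square[OF X_meas X_int] that by blast
  have V_diff_int: "integrable M (\<lambda>x. (norm (excess_powr (q / 2) (g x) - excess_powr (q / 2) (k x)))\<^sup>2)"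
    if "g \<in> X" "k \<in> X" for g k
    using that V_int by (intro integrable_norm_diff_square) auto
  have cauchy: "(LINT x|M. (norm (excess_powr (q / 2) (g x) - excess_powr (q / 2) (k x)))\<^sup>2)
      \<le> 8 * q * ((Gap g + Gap k) / 2 - d)" (is "?I \<le> _") if X: "g \<in> X" "k \<in> X" for g k
  proof -
    define m where "m x = (1/2) *\<^sub>R (g x + k x)" for x
    have m: "m \<in> X" using X_lin[OF X, of "1/2" "1/2"] by (simp add: m_def[abs_def] scaleR_add_right)
    have "Gap m + ?I / (8 * q) = (LINT x|M. fenchel_gap p q (s x) (m x)
        + (norm (excess_powr (q / 2) (g x) - excess_powr (q / 2) (k x)))\<^sup>2 / (8 * q))"
      unfolding Gap_def using gap_int[OF m] V_diff_int[OF X] by simp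
    also have "\<dots> \<le> (LINT x|M. (fenchel_gap p q (s x) (g x) + fenchel_gap p q (s x) (k x)) / 2)"
      unfolding m_def using gap_int[OF m] gap_int[OF X(1)] gap_int[OF X(2)] V_diff_int[OF X]
      by (intro integral_mono fenchel_gap_midpoint) (auto simp: m_def)
    also have "\<dots> = (Gap g + Gap k) / 2"
      unfolding Gap_def using gap_int[OF X(1)] gap_int[OF X(2)] by simp
    finally have "?I / (8 * q) \<le> (Gap g + Gap k) / 2 - d" using d_le[OF m] by linarith
    then show ?thesis using q2 by (simp add: pos_divide_le_eq mult_ac)
  qed
  have "\<exists>g\<in>X. Gap g \<le> d + (1/16) ^ k" for k :: nat
  proof -
    have "d < d + (1/16) ^ k" by simp
    then show ?thesis unfolding d_def using cINF_less_iff[OF X_ne bdd] by (meson less_imp_le)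
  qed
  then obtain g where gX: "\<And>k. g k \<in> X" and gd: "\<And>k. Gap (g k) \<le> d + (1/16) ^ k" by metis
  have [measurable]: "g k \<in> borel_measurable M" for k using gX by auto
  define V where "V k x = excess_powr (q / 2) (g k x)" for k x
  have V_meas [measurable]: "V k \<in> borel_measurable M" for k unfolding V_def by measurable
  have pow16: "(1/16) ^ Suc k \<le> ((1/16) ^ k :: real)" for k by simp
  obtain W D where W_meas [measurable]: "W \<in> borel_measurable M" and D: "0 \<le> D"
    and VW_int: "\<And>k. integrable M (\<lambda>x. (norm (V k x - W x))\<^sup>2)"
    and VW: "\<And>k. (LINT x|M. (norm (V k x - W x))\<^sup>2) \<le> D * (1/4) ^ k"
  proof (rule L2_complete[of V M "8 * q"])
    show "integrable M (\<lambda>x. (norm (V (Suc k) x - V k x))\<^sup>2)" for k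
      unfolding V_def using V_diff_int gX by auto
    show "(LINT x|M. (norm (V (Suc k) x - V k x))\<^sup>2) \<le> 8 * q * (1/16) ^ k" for k
    proof -
      have "(LINT x|M. (norm (V (Suc k) x - V k x))\<^sup>2) \<le> 8 * q * ((Gap (g (Suc k)) + Gap (g k)) / 2 - d)"
        unfolding V_def using cauchy gX by auto
      also have "\<dots> \<le> 8 * q * (1/16) ^ k"
      proof (intro mult_left_mono)
        show "(Gap (g (Suc k)) + Gap (g k)) / 2 - d \<le> (1/16) ^ k"
          using gd[of k] gd[of "Suc k"] pow16[of k] by argo
      qed (use q2 in auto)
      finally show ?thesis .
    qed
  qed auto
  define N where "N = (LINT x|M. (norm (W x))\<^sup>2)"
  have W_int: "integrable M (\<lambda>x. (norm (W x))\<^sup>2)"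
  proof (rule Bochner_Integration.integrable_bound)
    show "integrable M (\<lambda>x. 2 * (norm (V 0 x - W x))\<^sup>2 + 2 * (norm (V 0 x))\<^sup>2)"
      using VW_int[of 0] V_int[OF gX[of 0]] unfolding V_def by (intro Bochner_Integration.integrable_add integrable_mult_right)
    have "(norm (W x))\<^sup>2 \<le> 2 * (norm (V 0 x - W x))\<^sup>2 + 2 * (norm (V 0 x))\<^sup>2" for x
      using norm_diff_square_le[of "W x" 0 "V 0 x"] by (simp add: norm_minus_commute)
    then show "AE x in M. norm ((norm (W x))\<^sup>2) \<le> norm (2 * (norm (V 0 x - W x))\<^sup>2 + 2 * (norm (V 0 x))\<^sup>2)"
      by auto
  qed measurable
  have N0: "0 \<le> N" by (simp add: N_def)
  define t where "t x = radial_powr (2 / p) (W x)" for x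
  have t_meas [measurable]: "t \<in> borel_measurable M" unfolding t_def by measurable
  have t_pow: "norm (t x) powr p = (norm (W x))\<^sup>2" for x
    unfolding t_def by (rule norm_radial_powr_dual)
  have t_int: "integrable M (\<lambda>x. norm (t x) powr p)" using W_int by (simp add: t_pow)
  define Vol where "Vol = measure M (space M)"
  define B where "B = 2 powr q * (Vol + (2 * D + 2 * N))"
  have gB: "(LINT x|M. norm (g k x) powr q) \<le> B" for k
  proof -
    have "(LINT x|M. norm (g k x) powr q) \<le> (LINT x|M. 2 powr q * (1 + (2 * (norm (V k x - W x))\<^sup>2 + 2 * (norm (W x))\<^sup>2)))"
    proof (rule integral_mono)
      show "norm (g k x) powr q \<le> 2 powr q * (1 + (2 * (norm (V k x - W x))\<^sup>2 + 2 * (norm (W x))\<^sup>2))" for x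
        using norm_diff_square_le[of "V k x" 0 "W x"]
        by (intro order.trans[OF norm_powr_le_excess] mult_left_mono add_left_mono) (auto simp: V_def)
    qed (use X_int gX VW_int W_int in auto)
    also have "\<dots> = 2 powr q * (Vol + (2 * (LINT x|M. (norm (V k x - W x))\<^sup>2) + 2 * N))"
      using VW_int[of k] W_int by (simp add: N_def Vol_def)
    also have "\<dots> \<le> B"
      unfolding B_def
    proof (intro mult_left_mono add_left_mono add_right_mono)
      have "D * (1/4) ^ k \<le> D * 1" using D by (intro mult_left_mono power_le_one) auto
      then show "(LINT x|M. (norm (V k x - W x))\<^sup>2) \<le> D" using VW[of k] by simp
    qed auto
    finally show ?thesis .
  qed
  \<comment> \<open>One inequality is enough: applied to \<open>h\<close> and \<open>- h\<close> it gives orthogonality.\<close>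
  have pos: "0 \<le> (LINT x|M. (t x - s x) \<bullet> h x)" if hX: "h \<in> X" for h
  proof -
    have [measurable]: "h \<in> borel_measurable M" using hX by auto
    define G where "G k x = g k x + (1/4) ^ k *\<^sub>R h x" for k x
    have GX: "G k \<in> X" for k using X_lin[OF gX hX, of 1 k "(1/4)^k"] by (simp add: G_def[abs_def])
    have [measurable]: "G k \<in> borel_measurable M" for k using GX by auto
    define S where "S k x = excess_powr (q - 1) (G k x)" for k x
    have [measurable]: "S k \<in> borel_measurable M" for k unfolding S_def by measurable
    define U where "U k x = excess_powr (q / 2) (G k x)" for k x
    have [measurable]: "U k \<in> borel_measurable M" for k unfolding U_def by measurable
    have SU: "S k x = radial_powr (2 / p) (U k x)" for k x by (simp add: S_def U_def)
    have S_pow: "norm (S k x) powr p = (norm (U k x))\<^sup>2" for k x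
      unfolding SU by (rule norm_radial_powr_dual)
    have U_int: "integrable M (\<lambda>x. (norm (U k x))\<^sup>2)" for k unfolding U_def using V_int GX by auto
    have S_int: "integrable M (\<lambda>x. norm (S k x) powr p)" for k unfolding S_pow by (rule U_int)
    note Sh = integrable_inner[OF _ _ S_int X_int[OF hX]]
    note sh = integrable_inner[OF _ _ s_int X_int[OF hX]]
    note th = integrable_inner[OF _ _ t_int X_int[OF hX]]
    have diff: "Gap (G k) - Gap (g k) \<le> (1/4) ^ k * (LINT x|M. (S k x - s x) \<bullet> h x)" for k
    proof -
      have "Gap (G k) - Gap (g k) = (LINT x|M. fenchel_gap p q (s x) (G k x) - fenchel_gap p q (s x) (g k x))"
        unfolding Gap_def using gap_int[OF GX[of k]] gap_int[OF gX[of k]] by simp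
      also have "\<dots> \<le> (LINT x|M. (1/4) ^ k * ((S k x - s x) \<bullet> h x))"
      proof (rule integral_mono)
        show "fenchel_gap p q (s x) (G k x) - fenchel_gap p q (s x) (g k x)
            \<le> (1/4) ^ k * ((S k x - s x) \<bullet> h x)" for x
          unfolding S_def G_def by (rule fenchel_gap_add_scaleR)
      qed (use gap_int[OF GX[of k]] gap_int[OF gX[of k]] Sh[of k] sh in
          \<open>auto simp: inner_diff_left\<close>)
      finally show ?thesis by simp
    qed
    define H where "H = (LINT x|M. norm (h x) powr q)"
    define K where "K = 2 powr q * (B + H) + (LINT x|M. norm (s x) powr p) + 2 * H"
    have upper: "(LINT x|M. (S k x - s x) \<bullet> h x) \<le> K" for k
    proof -
      have bound: "(S k x - s x) \<bullet> h x \<le> 2 powr q * (norm (g k x) powr q + norm (h x) powr q)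
          + norm (s x) powr p + 2 * norm (h x) powr q" for x
      proof -
        have "norm (G k x) \<le> norm (g k x) + norm (h x)"
          unfolding G_def using power_le_one[of "1/4::real" k]
          by (intro order.trans[OF norm_triangle_ineq] add_left_mono) (auto intro!: mult_left_le_one_le)
        then have "norm (G k x) powr q \<le> (norm (g k x) + norm (h x)) powr q"
          using q2 by (intro powr_mono2) auto
        then have "norm (S k x) powr p \<le> 2 powr q * (norm (g k x) powr q + norm (h x) powr q)"
          using excess_square_le[of "G k x"] powr_add_le[OF norm_ge_zero norm_ge_zero, of q "g k x" "h x"]
          q2 unfolding S_pow U_def by linarith
        then show ?thesis using young_inner[of "S k x" "h x"] young_inner[of "s x" "h x"]
          unfolding inner_diff_left by linarith
      qed
      have "(LINT x|M. (S k x - s x) \<bullet> h x) \<le> (LINT x|M. 2 powr q * (norm (g k x) powr q + norm (h x) powr q)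
          + norm (s x) powr p + 2 * norm (h x) powr q)"
        by (rule integral_mono)
          (use Sh[of k] sh X_int[OF gX[of k]] X_int[OF hX] s_int in
            \<open>auto simp: inner_diff_left intro: bound[unfolded inner_diff_left]\<close>)
      also have "\<dots> = 2 powr q * ((LINT x|M. norm (g k x) powr q) + H) + (LINT x|M. norm (s x) powr p) + 2 * H"
        using X_int[OF gX[of k]] X_int[OF hX] s_int by (simp add: H_def)
      also have "\<dots> \<le> K" unfolding K_def using gB[of k] by (intro add_right_mono mult_left_mono) auto
      finally show ?thesis .
    qed
    have lower: "- ((1/4) ^ k) \<le> (LINT x|M. (S k x - s x) \<bullet> h x)" for k
    proof -
      have "- ((1/16) ^ k) \<le> Gap (G k) - Gap (g k)" using d_le[OF GX[of k]] gd[of k] by linarith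
      also note diff[of k]
      also have "(1/16::real) ^ k = (1/4) ^ k * (1/4) ^ k" by (simp flip: power_mult_distrib)
      finally have "(1/4) ^ k * (- ((1/4) ^ k)) \<le> (1/4) ^ k * (LINT x|M. (S k x - s x) \<bullet> h x)" by simp
      then show ?thesis by (subst (asm) mult_le_cancel_left_pos) auto
    qed
    have H0: "0 \<le> H" by (simp add: H_def)
    have "0 \<le> B" using D N0 by (simp add: B_def Vol_def)
    then have K0: "0 \<le> K" using H0 by (simp add: K_def)
    define C where "C = 16 * q * (1 + K) + 2 * D + 1"
    have C: "1 \<le> C" unfolding C_def using K0 D q2 by simp
    \<comment> \<open>The perturbed fields are again a minimising sequence, hence their \<open>V\<close>-images have the same limit.\<close>
    have UW: "(LINT x|M. (norm (U k x - W x))\<^sup>2) \<le> C * (1/4) ^ k" for k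
    proof -
      have "(1/16::real) ^ k \<le> (1/4) ^ k" by (intro power_mono) auto
      moreover have "(1/4) ^ k * (LINT x|M. (S k x - s x) \<bullet> h x) \<le> (1/4) ^ k * K"
        by (intro mult_left_mono upper) auto
      then have "Gap (G k) \<le> d + (1/16) ^ k + (1/4) ^ k * K"
        using diff[of k] gd[of k] by linarith
      moreover have "0 \<le> (1/4) ^ k * K" using K0 by simp
      ultimately have "(Gap (G k) + Gap (g k)) / 2 - d \<le> (1/4) ^ k + (1/4) ^ k * K"
        using gd[of k] by argo
      also have "\<dots> = (1 + K) * (1/4) ^ k" by (simp add: algebra_simps)
      finally have "(Gap (G k) + Gap (g k)) / 2 - d \<le> (1 + K) * (1/4) ^ k" .
      then have "8 * q * ((Gap (G k) + Gap (g k)) / 2 - d) \<le> 8 * q * ((1 + K) * (1/4) ^ k)"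
        using q2 by (intro mult_left_mono) auto
      then have UV: "(LINT x|M. (norm (U k x - V k x))\<^sup>2) \<le> 8 * q * ((1 + K) * (1/4) ^ k)"
        unfolding U_def V_def using cauchy[OF GX gX, of k k] by linarith
      have UV_int: "integrable M (\<lambda>x. (norm (U k x - V k x))\<^sup>2)"
        unfolding U_def V_def using V_diff_int GX gX by auto
      have "(LINT x|M. (norm (U k x - W x))\<^sup>2) \<le> (LINT x|M. 2 * (norm (U k x - V k x))\<^sup>2 + 2 * (norm (V k x - W x))\<^sup>2)"
        using UV_int VW_int U_int W_int
        by (intro integral_mono norm_diff_square_le integrable_norm_diff_square) auto
      also have "\<dots> = 2 * (LINT x|M. (norm (U k x - V k x))\<^sup>2) + 2 * (LINT x|M. (norm (V k x - W x))\<^sup>2)"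
        using UV_int VW_int by simp
      also have "\<dots> \<le> 2 * (8 * q * ((1 + K) * (1/4) ^ k)) + 2 * (D * (1/4) ^ k)"
        using UV VW[of k] by linarith
      also have "\<dots> \<le> C * (1/4) ^ k" unfolding C_def by (simp add: algebra_simps)
      finally show ?thesis .
    qed
    define N1 where "N1 = C * (6 * N + 4 * C\<^sup>2 + H + 1)"
    have St: "(LINT x|M. (S k x - t x) \<bullet> h x) \<le> N1 * (1/2) ^ k" for k
    proof -
      define r where "r = C * (1/2) ^ k"
      have r: "0 < r" "r \<le> C" using C by (auto simp: r_def mult_left_le power_le_one)
      have "C * (1/4) ^ k \<le> r\<^sup>2"
      proof -
        have "C * (1/4) ^ k \<le> (C * C) * (1/4) ^ k" using C by (intro mult_right_mono) auto
        also have "\<dots> = r\<^sup>2" by (simp add: r_def power2_eq_square mult_ac flip: power_mult_distrib)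
        finally show ?thesis .
      qed
      then have UWr: "(LINT x|M. (norm (U k x - W x))\<^sup>2) \<le> r\<^sup>2" using UW[of k] by linarith
      note L = integral_radial_powr_mult_le[of "U k" M W "\<lambda>x. norm (h x)" r, OF _ _ _ U_int W_int X_int[OF hX] _ r(1) UWr]
      have "integrable M (\<lambda>x. norm (S k x - t x) * norm (h x))"
        using L(1) unfolding SU t_def by auto
      moreover have "integrable M (\<lambda>x. (S k x - t x) \<bullet> h x)"
        unfolding inner_diff_left using Sh[of k] th by (intro Bochner_Integration.integrable_diff) auto
      ultimately have "(LINT x|M. (S k x - t x) \<bullet> h x) \<le> (LINT x|M. norm (S k x - t x) * norm (h x))"
        by (intro integral_mono norm_cauchy_schwarz)
      also have "\<dots> \<le> r * (6 * N + 4 * r\<^sup>2 + H + 1)"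
        using L(2) by (simp add: SU t_def N_def H_def)
      also have "\<dots> \<le> r * (6 * N + 4 * C\<^sup>2 + H + 1)"
        using r by (intro mult_left_mono add_right_mono add_left_mono power_mono) auto
      also have "\<dots> = N1 * (1/2) ^ k" by (simp add: N1_def r_def mult_ac)
      finally show ?thesis .
    qed
    have main: "- ((1/4) ^ k) - N1 * (1/2) ^ k \<le> (LINT x|M. (t x - s x) \<bullet> h x)" for k
    proof -
      have "(LINT x|M. (S k x - s x) \<bullet> h x) = (LINT x|M. (S k x - t x) \<bullet> h x) + (LINT x|M. (t x - s x) \<bullet> h x)"
        using Sh[of k] sh th by (simp add: inner_diff_left)
      then show ?thesis using lower[of k] St[of k] by linarith
    qed
    have "(\<lambda>k. - ((1/4) ^ k) - N1 * (1/2) ^ k) \<longlonglongrightarrow> - 0 - N1 * 0"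
      by (intro tendsto_intros LIMSEQ_power_zero) auto
    then show ?thesis using main by (intro LIMSEQ_le_const2) auto
  qed
  have t_adm: "(LINT x|M. t x \<bullet> h x) = (LINT x|M. s x \<bullet> h x)" if hX: "h \<in> X" for h
  proof -
    have i: "integrable M (\<lambda>x. s x \<bullet> h x)" "integrable M (\<lambda>x. t x \<bullet> h x)"
      using integrable_inner[OF _ _ s_int X_int[OF hX]] integrable_inner[OF _ _ t_int X_int[OF hX]] hX by auto
    have "(\<lambda>x. - h x) \<in> X" using X_lin[OF hX hX, of "-1" 0] by simp
    from pos[OF hX] pos[OF this] show ?thesis using i by (simp add: inner_diff_left)
  qed
  have le: "Gap (g k) \<le> (LINT x|M. fenchel_gap p q (t x) (g k x))" for k
  proof -
    note 1 = integrable_gap(1,2)[OF \<open>finite_measure M\<close> s_meas X_meas[OF gX[of k]] s_int X_int[OF gX[of k]]]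
    note 2 = integrable_gap(1,2)[OF \<open>finite_measure M\<close> t_meas X_meas[OF gX[of k]] t_int X_int[OF gX[of k]]]
    note 3 = integrable_inner[OF s_meas X_meas[OF gX[of k]] s_int X_int[OF gX[of k]]]
    note 4 = integrable_inner[OF t_meas X_meas[OF gX[of k]] t_int X_int[OF gX[of k]]]
    show ?thesis
      using minimal[OF t_meas t_int t_adm] 1 2 3 4 t_adm[OF gX[of k]]
      unfolding Gap_def fenchel_gap_def by simp
  qed
  define m where "m k x = (norm (t x) powr (p - 1) + 1) + norm (g k x)" for k x
  have [measurable]: "m k \<in> borel_measurable M" for k unfolding m_def by measurable
  have m0: "0 \<le> m k x" for k x by (simp add: m_def)
  define Q where "Q = 2 powr q * (2 powr q * (N + Vol) + B)"
  have mq: "m k x powr q \<le> 2 powr q * (2 powr q * ((norm (W x))\<^sup>2 + 1) + norm (g k x) powr q)" for k x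
  proof -
    have "m k x powr q \<le> 2 powr q * ((norm (t x) powr (p - 1) + 1) powr q + norm (g k x) powr q)"
      unfolding m_def using q2 by (intro powr_add_le) auto
    also have "\<dots> \<le> 2 powr q * (2 powr q * ((norm (t x) powr (p - 1)) powr q + 1 powr q) + norm (g k x) powr q)"
      using q2 by (intro mult_left_mono add_right_mono powr_add_le) auto
    also have "(norm (t x) powr (p - 1)) powr q = (norm (W x))\<^sup>2"
      by (simp only: powr_powr pq t_pow)
    finally show ?thesis by simp
  qed
  have mb_int: "integrable M (\<lambda>x. 2 powr q * (2 powr q * ((norm (W x))\<^sup>2 + 1) + norm (g k x) powr q))" for k
    using W_int X_int[OF gX[of k]] by auto
  have m_int: "integrable M (\<lambda>x. m k x powr q)" for k
    by (rule Bochner_Integration.integrable_bound[OF mb_int]) (use mq in \<open>auto intro!: AE_I2 order.trans[OF mq]\<close>)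
  have mQ: "(LINT x|M. m k x powr q) \<le> Q" for k
  proof -
    have "(LINT x|M. m k x powr q) \<le> (LINT x|M. 2 powr q * (2 powr q * ((norm (W x))\<^sup>2 + 1) + norm (g k x) powr q))"
      by (intro integral_mono m_int mb_int mq)
    also have "\<dots> = 2 powr q * (2 powr q * (N + Vol) + (LINT x|M. norm (g k x) powr q))"
      using W_int X_int[OF gX[of k]] by (simp add: N_def Vol_def)
    also have "\<dots> \<le> Q" unfolding Q_def using gB[of k] by (intro mult_left_mono add_left_mono) auto
    finally show ?thesis .
  qed
  define C where "C = D + 1"
  define N1 where "N1 = C * (6 * N + 4 * C\<^sup>2 + Q + 1)"
  have C: "1 \<le> C" using D by (simp add: C_def)
  have final: "Gap (g k) \<le> N1 * (1/2) ^ k" for k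
  proof -
    define r where "r = C * (1/2) ^ k"
    have r: "0 < r" "r \<le> C" using C by (auto simp: r_def mult_left_le power_le_one)
    have "D * (1/4) ^ k \<le> r\<^sup>2"
    proof -
      have "D * (1/4) ^ k \<le> (C * C) * (1/4) ^ k"
        using C D mult_mono[of 1 C D C] by (intro mult_right_mono) (auto simp: C_def)
      also have "\<dots> = r\<^sup>2" by (simp add: r_def power2_eq_square mult_ac flip: power_mult_distrib)
      finally show ?thesis .
    qed
    then have VWr: "(LINT x|M. (norm (V k x - W x))\<^sup>2) \<le> r\<^sup>2" using VW[of k] by linarith
    have Vk_int: "integrable M (\<lambda>x. (norm (V k x))\<^sup>2)" unfolding V_def using V_int gX by auto
    note L = integral_radial_powr_mult_le[of "V k" M W "m k" r, OF _ _ _ Vk_int W_int m_int m0 r(1) VWr]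
    have Pg: "radial_powr (2 / p) (V k x) = excess_powr (q - 1) (g k x)" for x by (simp add: V_def)
    have "Gap (g k) \<le> (LINT x|M. fenchel_gap p q (t x) (g k x))" by (rule le)
    also have "\<dots> \<le> (LINT x|M. norm (radial_powr (2/p) (V k x) - radial_powr (2/p) (W x)) * m k x)"
    proof (rule integral_mono)
      show "fenchel_gap p q (t x) (g k x) \<le> norm (radial_powr (2/p) (V k x) - radial_powr (2/p) (W x)) * m k x" for x
        using fenchel_gap_le[of "t x" "g k x"] unfolding Pg m_def t_def by (simp add: norm_minus_commute)
    qed (use L(1) integrable_gap(3)[OF \<open>finite_measure M\<close> t_meas X_meas[OF gX[of k]] t_int X_int[OF gX[of k]]] in auto)
    also have "\<dots> \<le> r * (6 * N + 4 * r\<^sup>2 + (LINT x|M. m k x powr q) + 1)"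
      using L(2) by (simp add: N_def)
    also have "\<dots> \<le> r * (6 * N + 4 * C\<^sup>2 + Q + 1)"
      using r mQ[of k] by (intro mult_left_mono add_mono power_mono) auto
    also have "\<dots> = N1 * (1/2) ^ k" by (simp add: N1_def r_def mult_ac)
    finally show ?thesis .
  qed
  have "(\<lambda>k. N1 * (1/2) ^ k) \<longlonglongrightarrow> N1 * 0"
    by (intro tendsto_intros LIMSEQ_power_zero) auto
  then have "eventually (\<lambda>k. N1 * (1/2) ^ k < e) sequentially" using e by (intro order_tendstoD) auto
  then obtain k where "N1 * (1/2) ^ k < e" using eventually_happens'[OF sequentially_bot] by blast
  then have "Gap (g k) \<le> e" using final[of k] by linarith
  then show ?thesis using gX[of k] unfolding Gap_def by blast
qed

end

section \<open>Integrability from mean-square difference quotients\<close>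

text \<open>
  The exponent \<open>t = 2 / (1 - c)\<close> is the fixed point of \<open>t = 2 + c t\<close>, so a bound \<open>M 2^(-t k)\<close>
  reproduces itself as soon as \<open>K M^c 2^t \<le> M\<close>, that is, for large \<open>M\<close>.
\<close>

lemma geometric_decay_of_recursion:
  fixes a :: "nat \<Rightarrow> real"
  assumes a0: "\<And>k. 0 \<le> a k" and K: "0 \<le> K" and c: "0 \<le> c" "c < 1"
    and rec: "\<And>k. a (Suc k) \<le> K * (1/4) ^ k * a k powr c"
  obtains M where "0 \<le> M" "\<And>k. a k \<le> M * 2 powr (- (2 / (1 - c)) * real k)"
proof -
  define t where "t = 2 / (1 - c)"
  define M where "M = max (max 1 (a 0)) ((K * 2 powr t) powr (1 / (1 - c)))"
  have M: "1 \<le> M" "a 0 \<le> M" by (auto simp: M_def)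
  have tc: "2 + t * c = t" using c by (simp add: t_def field_simps)
  have "K * 2 powr t = ((K * 2 powr t) powr (1 / (1 - c))) powr (1 - c)"
    using c K by (simp add: powr_powr)
  also have "\<dots> \<le> M powr (1 - c)" using c by (intro powr_mono2) (auto simp: M_def)
  finally have "M powr c * (K * 2 powr t) \<le> M powr c * M powr (1 - c)"
    using M by (intro mult_left_mono) auto
  also have "\<dots> = M" using M by (simp flip: powr_add)
  finally have KM: "K * M powr c * 2 powr t \<le> M" by (simp add: mult_ac)
  have "a k \<le> M * 2 powr (- t * real k)" for k
  proof (induction k)
    case 0
    then show ?case using M by simp
  next
    case (Suc k)
    have "a (Suc k) \<le> K * (1/4) ^ k * a k powr c" by (rule rec)
    also have "\<dots> \<le> K * (1/4) ^ k * (M * 2 powr (- t * real k)) powr c"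
      using Suc K c a0 by (intro mult_left_mono powr_mono2) auto
    also have "(1/4 :: real) ^ k = 2 powr (- 2 * real k)"
    proof -
      have "2 powr (- 2 * real k) = (2 powr (-2)) powr real k" by (simp only: powr_powr)
      also have "2 powr (-2) = (1/4 :: real)" by (simp add: powr_minus)
      finally show ?thesis by (simp add: powr_realpow)
    qed
    also have "K * 2 powr (- 2 * real k) * (M * 2 powr (- t * real k)) powr c
        = K * M powr c * 2 powr (- 2 * real k + - t * real k * c)"
      by (simp only: powr_mult powr_powr powr_add mult_ac)
    also have "- 2 * real k + - t * real k * c = - (2 + t * c) * real k" by (simp add: algebra_simps)
    also have "\<dots> = t + - t * real (Suc k)" unfolding tc by (simp add: algebra_simps)
    also have "K * M powr c * 2 powr (t + - t * real (Suc k)) = (K * M powr c * 2 powr t) * 2 powr (- t * real (Suc k))"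
      by (simp only: powr_add mult_ac)
    also have "\<dots> \<le> M * 2 powr (- t * real (Suc k))" using KM by (intro mult_right_mono) auto
    finally show ?case .
  qed
  then show ?thesis using that[of M] M by (simp add: t_def)
qed

lemma nn_integral_lborel_translate:
  fixes f :: "'a::euclidean_space \<Rightarrow> ennreal"
  assumes [measurable]: "f \<in> borel_measurable borel"
  shows "(\<integral>\<^sup>+x. f (x + h) \<partial>lborel) = (\<integral>\<^sup>+x. f x \<partial>lborel)"
proof -
  have "(\<integral>\<^sup>+x. f x \<partial>lborel) = (\<integral>\<^sup>+x. f x \<partial>distr lborel borel ((+) h))"
    by (simp only: lborel_distr_plus)
  also have "\<dots> = (\<integral>\<^sup>+x. f (h + x) \<partial>lborel)" by (rule nn_integral_distr) measurable
  finally show ?thesis by (simp add: add.commute)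
qed

text \<open>
  Choose the radius \<open>R\<close> such that the ball of radius \<open>R\<close> has twice the measure of \<open>{w > 2^k}\<close>. From each
  point with \<open>w > 2^(k+1)\<close>, at least half of the shifts \<open>h\<close> in that ball lead out of \<open>{w > 2^k}\<close>, and each
  of them contributes at least \<open>4^k\<close> to the squared increment. Integrating over \<open>x\<close> and \<open>h\<close> compares
  the measures of two consecutive level sets.
\<close>

lemma level_set_recursion:
  fixes w :: "'a::euclidean_space \<Rightarrow> real" and b C :: real
  assumes [measurable]: "w \<in> borel_measurable borel"
    and w2: "integrable lborel (\<lambda>x. (w x)\<^sup>2)"
    and C: "0 \<le> C" and b: "0 < b"
    and diff: "\<And>h. (\<integral>\<^sup>+x. ennreal ((w (x + h) - w x)\<^sup>2) \<partial>lborel) \<le> ennreal (C * norm h powr b)"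
  defines "a \<equiv> \<lambda>k. measure lborel {x. 2 ^ k < w x}"
  shows "a (Suc k) \<le> (2 * C * (2 / unit_ball_vol DIM('a)) powr (b / DIM('a))) * (1/4) ^ k * a k powr (b / DIM('a))"
    and "emeasure lborel {x. 2 ^ k < w x} = ennreal (a k)"
proof -
  have fin: "emeasure lborel {x. 2 ^ k < w x} = ennreal (a k)" for k
  proof -
    have "emeasure lborel {x. 2 ^ k < w x} = (\<integral>\<^sup>+x. indicator {x. 2 ^ k < w x} x \<partial>lborel)" by simp
    also have "\<dots> \<le> (\<integral>\<^sup>+x. ennreal ((w x)\<^sup>2) \<partial>lborel)"
    proof (intro nn_integral_mono)
      fix x
      have "1 \<le> (w x)\<^sup>2" if "2 ^ k < w x"
      proof -
        have "1 \<le> w x" using that one_le_power[of "2::real" k] by linarith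
        then show ?thesis by (simp add: one_le_power)
      qed
      then show "indicator {x. 2 ^ k < w x} x \<le> ennreal ((w x)\<^sup>2)" by (auto simp: indicator_def)
    qed
    also have "\<dots> < \<infinity>" using w2 by (simp add: nn_integral_eq_integral)
    finally show ?thesis unfolding a_def by (intro emeasure_eq_ennreal_measure) auto
  qed
  then show "emeasure lborel {x. 2 ^ k < w x} = ennreal (a k)" .
  have a0: "0 \<le> a k" for k by (simp add: a_def)
  show "a (Suc k) \<le> (2 * C * (2 / unit_ball_vol DIM('a)) powr (b / DIM('a))) * (1/4) ^ k * a k powr (b / DIM('a))"
  proof (cases "a k = 0")
    case True
    have "ennreal (a (Suc k)) \<le> ennreal (a k)"
      unfolding fin[symmetric]
      by (intro emeasure_mono) (auto intro: order.strict_trans1[rotated] power_increasing)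
    then have "a (Suc k) = 0" using True a0[of "Suc k"] by simp
    then show ?thesis using C True by simp
  next
    case False
    then have ak: "0 < a k" using a0[of k] by simp
    define n where "n = real DIM('a)"
    have n: "0 < n" by (simp add: n_def)
    define om where "om = unit_ball_vol n"
    have om: "0 < om" using n by (simp add: om_def)
    define R where "R = (2 * a k / om) powr (1 / n)"
    have R: "0 < R" using ak om by (simp add: R_def)
    have "R ^ DIM('a) = R powr n" using R by (simp add: n_def powr_realpow)
    also have "\<dots> = 2 * a k / om" using n ak om by (simp add: R_def powr_powr)
    finally have Rn: "om * R ^ DIM('a) = 2 * a k" using om by simp
    have ball: "emeasure lborel (ball (0::'a) R) = ennreal (2 * a k)"
      using emeasure_ball[of R "0::'a"] R Rn by (simp add: om_def n_def)
    define D where "D = {(x, h). h \<in> ball 0 R \<and> 2 ^ Suc k < w x \<and> w (x + h) \<le> 2 ^ k}"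
    have D [measurable]: "D \<in> sets (lborel \<Otimes>\<^sub>M lborel)"
    proof -
      have "{z \<in> space (borel \<Otimes>\<^sub>M borel). norm (snd z :: 'a) < R \<and> 2 ^ Suc k < w (fst z) \<and> w (fst z + snd z) \<le> 2 ^ k}
         \<in> sets (borel \<Otimes>\<^sub>M borel)" by measurable
      also have "{z \<in> space (borel \<Otimes>\<^sub>M borel). norm (snd z :: 'a) < R \<and> 2 ^ Suc k < w (fst z) \<and> w (fst z + snd z) \<le> 2 ^ k} = D"
        by (auto simp: D_def space_pair_measure)
      also have "sets (borel \<Otimes>\<^sub>M borel) = sets (lborel \<Otimes>\<^sub>M (lborel :: 'a measure))"
        by (intro sets_pair_measure_cong) auto
      finally show ?thesis .
    qed
    define I where "I x h = (ennreal (4 ^ k) * indicator D (x, h))" for x h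
    have [measurable]: "case_prod I \<in> borel_measurable (lborel \<Otimes>\<^sub>M lborel)"
      unfolding I_def by measurable
    have lower: "ennreal (4 ^ k * a k) * indicator {x. 2 ^ Suc k < w x} x \<le> (\<integral>\<^sup>+h. I x h \<partial>lborel)" for x
    proof (cases "2 ^ Suc k < w x")
      case True
      have "ennreal (2 * a k) = emeasure lborel (ball (0::'a) R)" by (simp add: ball)
      also have "\<dots> \<le> emeasure lborel ({h \<in> ball 0 R. w (x + h) \<le> 2 ^ k} \<union> {h. 2 ^ k < w (x + h)})"
        by (intro emeasure_mono) auto
      also have "\<dots> \<le> emeasure lborel {h \<in> ball 0 R. w (x + h) \<le> 2 ^ k} + emeasure lborel {h. 2 ^ k < w (x + h)}"
        by (intro emeasure_subadditive) auto
      also have "emeasure lborel {h. 2 ^ k < w (x + h)} = (\<integral>\<^sup>+h. indicator {y. 2 ^ k < w y} (h + x) \<partial>lborel)"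
      proof -
        have "indicator {y. 2 ^ k < w y} (h + x) = (indicator {h. 2 ^ k < w (x + h)} h :: ennreal)" for h
          by (simp add: indicator_def add.commute)
        then show ?thesis by simp
      qed
      also have "\<dots> = ennreal (a k)"
        by (subst nn_integral_lborel_translate) (auto simp: fin)
      finally have *: "ennreal (2 * a k) \<le> emeasure lborel {h \<in> ball 0 R. w (x + h) \<le> 2 ^ k} + ennreal (a k)" .
      have "ennreal (a k) + ennreal (a k) = ennreal (2 * a k)"
        using a0[of k] by (subst ennreal_plus[symmetric]) auto
      then have "ennreal (a k) + ennreal (a k) \<le> ennreal (a k) + emeasure lborel {h \<in> ball 0 R. w (x + h) \<le> 2 ^ k}"
        using * by (simp add: add.commute)
      then have "ennreal (a k) \<le> emeasure lborel {h \<in> ball 0 R. w (x + h) \<le> 2 ^ k}"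
        by (subst (asm) ennreal_add_left_cancel_le) auto
      then have "ennreal (4 ^ k) * ennreal (a k) \<le> ennreal (4 ^ k) * emeasure lborel {h \<in> ball 0 R. w (x + h) \<le> 2 ^ k}"
        by (intro mult_left_mono) auto
      also have "\<dots> = (\<integral>\<^sup>+h. ennreal (4 ^ k) * indicator {h \<in> ball 0 R. w (x + h) \<le> 2 ^ k} h \<partial>lborel)"
        by (subst nn_integral_cmult_indicator) auto
      also have "\<dots> = (\<integral>\<^sup>+h. I x h \<partial>lborel)"
        using True by (intro nn_integral_cong) (auto simp: I_def D_def indicator_def)
      finally show ?thesis using True a0[of k] by (simp add: ennreal_mult)
    qed simp
    have upper: "(\<integral>\<^sup>+x. I x h \<partial>lborel) \<le> ennreal (C * R powr b) * indicator (ball 0 R) h" for h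
    proof (cases "h \<in> ball 0 R")
      case True
      have "(\<integral>\<^sup>+x. I x h \<partial>lborel) \<le> (\<integral>\<^sup>+x. ennreal ((w (x + h) - w x)\<^sup>2) \<partial>lborel)"
      proof (intro nn_integral_mono)
        fix x
        have "(4::real) ^ k \<le> (w (x + h) - w x)\<^sup>2" if "2 ^ Suc k < w x" "w (x + h) \<le> 2 ^ k"
        proof -
          have "(4::real) ^ k = (2 ^ k)\<^sup>2" by (simp add: power2_eq_square flip: power_mult_distrib)
          also have "\<dots> \<le> (w x - w (x + h))\<^sup>2" using that by (intro power_mono) auto
          finally show ?thesis by (simp add: power2_commute)
        qed
        then show "I x h \<le> ennreal ((w (x + h) - w x)\<^sup>2)"
          by (auto simp: I_def D_def indicator_def)
      qed
      also have "\<dots> \<le> ennreal (C * norm h powr b)" by (rule diff)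
      also have "\<dots> \<le> ennreal (C * R powr b)"
        using True C b by (intro ennreal_leI mult_left_mono powr_mono2) auto
      finally show ?thesis using True by simp
    next
      case False
      then have "I x h = 0" for x by (simp add: I_def D_def)
      then show ?thesis by simp
    qed
    have "ennreal (4 ^ k * a k) * ennreal (a (Suc k)) = (\<integral>\<^sup>+x. ennreal (4 ^ k * a k) * indicator {x. 2 ^ Suc k < w x} x \<partial>lborel)"
      by (subst nn_integral_cmult_indicator) (auto simp only: fin, measurable)
    also have "\<dots> \<le> (\<integral>\<^sup>+x. (\<integral>\<^sup>+h. I x h \<partial>lborel) \<partial>lborel)" by (rule nn_integral_mono) (rule lower)
    also have "\<dots> = (\<integral>\<^sup>+h. (\<integral>\<^sup>+x. I x h \<partial>lborel) \<partial>lborel)"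
      by (rule lborel_pair.Fubini'[symmetric]) measurable
    also have "\<dots> \<le> (\<integral>\<^sup>+h. ennreal (C * R powr b) * indicator (ball (0::'a) R) h \<partial>lborel)"
      by (rule nn_integral_mono) (rule upper)
    also have "\<dots> = ennreal (C * R powr b) * ennreal (2 * a k)"
      by (subst nn_integral_cmult_indicator) (auto simp: ball)
    finally have "ennreal (4 ^ k * a k * a (Suc k)) \<le> ennreal (C * R powr b * (2 * a k))"
      using a0 C by (simp add: ennreal_mult)
    then have "4 ^ k * a k * a (Suc k) \<le> C * R powr b * (2 * a k)"
      using a0 C by (subst (asm) ennreal_le_iff) auto
    then have "a k * (4 ^ k * a (Suc k)) \<le> a k * (2 * C * R powr b)" by (simp add: mult_ac)
    then have "4 ^ k * a (Suc k) \<le> 2 * C * R powr b" using ak by simp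
    then have "a (Suc k) \<le> 2 * C * R powr b * (1/4) ^ k" by (simp add: field_simps)
    also have "R powr b = (2 / om * a k) powr (b / n)" by (simp add: R_def powr_powr)
    also have "\<dots> = (2 / om) powr (b / n) * a k powr (b / n)" using om ak by (subst powr_mult) auto
    finally show ?thesis by (simp add: om_def n_def mult_ac)
  qed
qed

text \<open>
  A mean-square increment of order \<open>|h|^(b/2)\<close> gives a weak-type bound with exponent
  \<open>2 n / (n - b)\<close> through the recursion for the level sets; on a bounded support all smaller exponents
  follow by summing over dyadic levels.
\<close>

theorem difference_quotient_embedding:
  fixes w :: "'a::euclidean_space \<Rightarrow> real" and b C r :: real
  assumes [measurable]: "w \<in> borel_measurable borel"
    and w0: "\<And>x. 0 \<le> w x"
    and w2: "integrable lborel (\<lambda>x. (w x)\<^sup>2)"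
    and supp: "bounded E" "\<And>x. x \<notin> E \<Longrightarrow> w x = 0"
    and C: "0 \<le> C" and b: "0 < b" "b < DIM('a)"
    and diff: "\<And>h. (\<integral>\<^sup>+x. ennreal ((w (x + h) - w x)\<^sup>2) \<partial>lborel) \<le> ennreal (C * norm h powr b)"
    and r: "0 < r" "r < 2 * DIM('a) / (DIM('a) - b)"
  shows "integrable lborel (\<lambda>x. w x powr r)"
proof -
  define a where "a k = measure lborel {x. 2 ^ k < w x}" for k :: nat
  define c where "c = b / DIM('a)"
  have c: "0 \<le> c" "c < 1" using b by (auto simp: c_def)
  note rec = level_set_recursion[OF assms(1) w2 C b(1) diff, folded a_def]
  define K where "K = 2 * C * (2 / unit_ball_vol DIM('a)) powr (b / DIM('a))"
  have "0 \<le> K" using C by (simp add: K_def)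
  then obtain M where M: "0 \<le> M" and aM: "\<And>k. a k \<le> M * 2 powr (- (2 / (1 - c)) * real k)"
    using geometric_decay_of_recursion[of a K c] rec(1) c by (auto simp: a_def K_def c_def)
  define t where "t = 2 / (1 - c)"
  have t: "t = 2 * DIM('a) / (DIM('a) - b)"
    using b by (simp add: t_def c_def field_simps)
  define B where "B = ball (0::'a) (SOME r. E \<subseteq> ball 0 r)"
  have EB: "E \<subseteq> B" unfolding B_def using bounded_subset_ballD[OF supp(1), of 0] by (metis (mono_tags, lifting) someI)
  have Bfin: "emeasure lborel B < \<infinity>" unfolding B_def by (intro emeasure_bounded_finite) auto
  have [measurable]: "B \<in> sets borel" by (simp add: B_def)
  have point: "ennreal (w x powr r) \<le> indicator B x + (\<Sum>k. ennreal (2 powr (r * real (Suc k))) * indicator {x. 2 ^ k < w x} x)"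
    (is "_ \<le> _ + suminf ?f") for x
  proof (cases "w x \<le> 1")
    case True
    then have "w x powr r \<le> 1" using w0[of x] r by (intro powr_le1) auto
    then have "ennreal (w x powr r) \<le> indicator B x"
      using EB supp(2)[of x] by (cases "x \<in> B") (auto simp: subset_iff)
    then show ?thesis by (rule order.trans) simp
  next
    case False
    obtain m where m: "w x \<le> 2 ^ m" using real_arch_pow[of 2 "w x"] by (auto intro: less_imp_le)
    define j where "j = (LEAST m. w x \<le> 2 ^ m)"
    have j: "w x \<le> 2 ^ j" unfolding j_def using m by (rule LeastI)
    have "j \<noteq> 0" using j False by (cases j) auto
    then obtain k where k: "j = Suc k" by (cases j) auto
    have "2 ^ k < w x" using not_less_Least[of k "\<lambda>m. w x \<le> 2 ^ m"] k by (simp add: j_def not_le)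
    then have "?f k = ennreal (2 powr (r * real (Suc k)))" by simp
    moreover have "w x powr r \<le> 2 powr (r * real (Suc k))"
    proof -
      have "w x powr r \<le> (2 ^ Suc k) powr r" using j k w0[of x] r by (intro powr_mono2) auto
      also have "(2::real) ^ Suc k = 2 powr (real (Suc k))" by (rule powr_realpow[symmetric]) simp
      finally show ?thesis by (simp add: powr_powr mult.commute)
    qed
    ultimately have "ennreal (w x powr r) \<le> ?f k" by (simp add: ennreal_leI)
    also have "\<dots> \<le> suminf ?f"
    proof -
      have "(\<Sum>i\<in>{k}. ?f i) \<le> suminf ?f" by (intro sum_le_suminf summableI) auto
      then show ?thesis by (simp only: sum.insert[OF finite.emptyI] sum.empty empty_iff not_False_eq_True add_0_right)
    qed
    finally show ?thesis by (rule order.trans) simp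
  qed
  define z where "z = 2 powr (r - t)"
  have z: "0 < z" "z < 1" using r(2) unfolding z_def t[symmetric] by (auto simp: powr_less_one)
  have "(\<integral>\<^sup>+x. ennreal (w x powr r) \<partial>lborel) \<le> (\<integral>\<^sup>+x. indicator B x + (\<Sum>k. ennreal (2 powr (r * real (Suc k))) * indicator {x. 2 ^ k < w x} x) \<partial>lborel)"
    by (intro nn_integral_mono point)
  also have "\<dots> = emeasure lborel B + (\<Sum>k. ennreal (2 powr (r * real (Suc k))) * ennreal (a k))"
    by (simp add: nn_integral_add nn_integral_suminf nn_integral_cmult_indicator rec(2))
  also have "(\<Sum>k. ennreal (2 powr (r * real (Suc k))) * ennreal (a k)) \<le> (\<Sum>k. ennreal (M * 2 powr r * z ^ k))"
  proof (intro suminf_le summableI)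
    fix k
    have "2 powr (r * real (Suc k)) * a k \<le> 2 powr (r * real (Suc k)) * (M * 2 powr (- t * real k))"
      using aM[of k] by (intro mult_left_mono) (auto simp: t_def)
    also have "\<dots> = M * 2 powr r * 2 powr ((r - t) * real k)"
      by (simp add: algebra_simps flip: powr_add)
    also have "2 powr ((r - t) * real k) = z ^ k"
      unfolding z_def by (simp add: powr_realpow[symmetric] powr_powr)
    finally show "ennreal (2 powr (r * real (Suc k))) * ennreal (a k) \<le> ennreal (M * 2 powr r * z ^ k)"
      by (subst ennreal_mult[symmetric]) (auto simp: a_def intro: ennreal_leI)
  qed
  also have "\<dots> = ennreal (\<Sum>k. M * 2 powr r * z ^ k)"
    using M z by (intro suminf_ennreal2) (auto intro!: summable_mult summable_geometric)
  finally have "(\<integral>\<^sup>+x. ennreal (w x powr r) \<partial>lborel) < \<infinity>"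
    using Bfin by (auto intro: order.strict_trans1 simp: add_left_mono)
  then show ?thesis by (intro integrableI_bounded) auto
qed

section \<open>Smooth test functions\<close>

definition smooth :: "('a::euclidean_space \<Rightarrow> real) \<Rightarrow> bool" where
  "smooth u \<longleftrightarrow> (\<forall>k. C_k k u)"

lemma partial_deriv_eqI: "(u has_derivative D) (at x) \<Longrightarrow> partial_deriv i u x = D i"
  using frechet_derivative_at[of u D x] by simp

lemma C_k_mono: "C_k (Suc k) u \<Longrightarrow> C_k k u"
proof (induction k arbitrary: u)
  case 0
  then show ?case
    by (auto intro!: continuous_at_imp_continuous_on differentiable_imp_continuous_within)
next
  case (Suc k)
  then show ?case by (metis C_k.simps(2))
qed

lemma C_k_continuous: "C_k k u \<Longrightarrow> continuous_on UNIV u"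
  by (induction k) (use C_k.simps(1) C_k_mono in blast)+

lemma has_derivative_frechet: "u differentiable (at x) \<Longrightarrow> (u has_derivative frechet_derivative u (at x)) (at x)"
  by (simp add: frechet_derivative_works)

lemma C_k_const: "C_k k (\<lambda>x. c)"
proof (induction k arbitrary: c)
  case (Suc k)
  have "partial_deriv i (\<lambda>x. c) = (\<lambda>x. 0)" for i :: 'a
    by (simp add: fun_eq_iff)
  then show ?case using Suc by simp
qed simp

lemma C_k_add: "C_k k u \<Longrightarrow> C_k k v \<Longrightarrow> C_k k (\<lambda>x. u x + v x)"
proof (induction k arbitrary: u v)
  case 0
  then show ?case by (auto intro: continuous_on_add)
next
  case (Suc k)
  have "partial_deriv i (\<lambda>x. u x + v x) = (\<lambda>x. partial_deriv i u x + partial_deriv i v x)" for i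
  proof
    fix x
    have "u differentiable (at x)" "v differentiable (at x)" using Suc.prems by auto
    then have "((\<lambda>x. u x + v x) has_derivative (\<lambda>h. frechet_derivative u (at x) h + frechet_derivative v (at x) h)) (at x)"
      by (intro has_derivative_add has_derivative_frechet)
    then show "partial_deriv i (\<lambda>x. u x + v x) x = partial_deriv i u x + partial_deriv i v x"
      by (rule partial_deriv_eqI)
  qed
  then show ?case using Suc by (auto intro!: differentiable_add)
qed

lemma partial_deriv_mult:
  assumes "u differentiable (at x)" "v differentiable (at x)"
  shows "partial_deriv i (\<lambda>x. u x * v x) x = u x * partial_deriv i v x + v x * partial_deriv i u x"
proof -
  have "((\<lambda>x. u x * v x) has_derivative (\<lambda>h. u x * frechet_derivative v (at x) h + frechet_derivative u (at x) h * v x)) (at x)"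
    using assms by (intro has_derivative_mult has_derivative_frechet)
  then show ?thesis by (subst partial_deriv_eqI) (auto simp: mult.commute)
qed

lemma C_k_mult: "C_k k u \<Longrightarrow> C_k k v \<Longrightarrow> C_k k (\<lambda>x. u x * v x)"
proof (induction k arbitrary: u v)
  case 0
  then show ?case by (auto intro: continuous_on_mult)
next
  case (Suc k)
  have d: "u differentiable (at x)" "v differentiable (at x)" for x using Suc.prems by auto
  have "partial_deriv i (\<lambda>x. u x * v x) = (\<lambda>x. u x * partial_deriv i v x + v x * partial_deriv i u x)" for i
    using partial_deriv_mult d by blast
  moreover have "C_k k u" "C_k k v" using Suc.prems by (blast intro: C_k_mono)+
  ultimately show ?case using Suc d by (auto intro!: differentiable_mult C_k_add)
qed

lemma smooth_const [simp]: "smooth (\<lambda>x. c)"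
  and smooth_mult: "smooth u \<Longrightarrow> smooth v \<Longrightarrow> smooth (\<lambda>x. u x * v x)"
  by (auto simp: smooth_def intro: C_k_const C_k_add C_k_mult)

lemma smooth_prod: "finite A \<Longrightarrow> (\<And>i. i \<in> A \<Longrightarrow> smooth (u i)) \<Longrightarrow> smooth (\<lambda>x. \<Prod>i\<in>A. u i x)"
  by (induction A rule: finite_induct) (auto intro: smooth_mult)

lemma smooth_differentiable: "smooth u \<Longrightarrow> u differentiable (at x)"
  unfolding smooth_def using C_k.simps(2)[of 0 u] by blast

lemma smooth_continuous: "smooth u \<Longrightarrow> continuous_on S u"
  unfolding smooth_def by (meson C_k_continuous continuous_on_subset subset_UNIV)

lemma smooth_partial: "smooth u \<Longrightarrow> i \<in> Basis \<Longrightarrow> smooth (partial_deriv i u)"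
  unfolding smooth_def by (metis C_k.simps(2))

lemma smooth_borel [measurable (raw)]: "smooth u \<Longrightarrow> u \<in> borel_measurable borel"
  by (intro borel_measurable_continuous_onI smooth_continuous)

lemma frechet_derivative_sum_Basis:
  assumes "u differentiable (at x)"
  shows "frechet_derivative u (at x) h = (\<Sum>i\<in>Basis. (h \<bullet> i) * partial_deriv i u x)"
proof -
  have lin: "linear (frechet_derivative u (at x))" using assms by (rule linear_frechet_derivative)
  have "frechet_derivative u (at x) h = frechet_derivative u (at x) (\<Sum>i\<in>Basis. (h \<bullet> i) *\<^sub>R i)"
    by (simp add: euclidean_representation)
  also have "\<dots> = (\<Sum>i\<in>Basis. (h \<bullet> i) * partial_deriv i u x)"
    using lin by (simp add: linear_sum linear_scale)
  finally show ?thesis .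
qed

lemma partial_deriv_compose_inner:
  fixes u :: "real \<Rightarrow> real" and e :: "'a::euclidean_space"
  assumes "u differentiable (at (c * (x \<bullet> e) + d))"
  shows "partial_deriv i (\<lambda>x. u (c * (x \<bullet> e) + d)) x = (c * (i \<bullet> e)) * partial_deriv 1 u (c * (x \<bullet> e) + d)"
proof -
  define D where "D = frechet_derivative u (at (c * (x \<bullet> e) + d))"
  have lin: "linear D" unfolding D_def using assms by (rule linear_frechet_derivative)
  have "((\<lambda>x. c * (x \<bullet> e) + d) has_derivative (\<lambda>h. c * (h \<bullet> e))) (at x)"
    by (auto intro!: derivative_eq_intros)
  then have "((\<lambda>x. u (c * (x \<bullet> e) + d)) has_derivative (\<lambda>h. D (c * (h \<bullet> e)))) (at x)"
    unfolding D_def by (rule has_derivative_compose) (rule has_derivative_frechet[OF assms])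
  then have "partial_deriv i (\<lambda>x. u (c * (x \<bullet> e) + d)) x = D (c * (i \<bullet> e))"
    by (rule partial_deriv_eqI)
  also have "D (c * (i \<bullet> e)) = (c * (i \<bullet> e)) * D 1"
    using linear_scale[OF lin, of "c * (i \<bullet> e)" 1] by simp
  finally show ?thesis by (simp add: D_def)
qed

lemma C_k_compose_inner:
  fixes u :: "real \<Rightarrow> real" and e :: "'a::euclidean_space"
  shows "C_k k u \<Longrightarrow> C_k k (\<lambda>x. u (c * (x \<bullet> e) + d))"
proof (induction k arbitrary: u)
  case 0
  then have "continuous_on UNIV u" by simp
  then have "continuous_on UNIV (\<lambda>x. u (c * (x \<bullet> e) + d))"
    by (rule continuous_on_compose2) (auto intro!: continuous_intros)
  then show ?case by simp
next
  case (Suc k)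
  have d: "u differentiable (at x)" for x using Suc.prems by auto
  have "(\<lambda>x. u (c * (x \<bullet> e) + d)) differentiable (at x)" for x
    by (rule differentiable_compose[OF d]) (auto intro!: derivative_intros)
  moreover have "partial_deriv i (\<lambda>x. u (c * (x \<bullet> e) + d)) = (\<lambda>x. (c * (i \<bullet> e)) * partial_deriv 1 u (c * (x \<bullet> e) + d))" for i
    using partial_deriv_compose_inner d by blast
  moreover have "C_k k (\<lambda>x. partial_deriv 1 u (c * (x \<bullet> e) + d))" using Suc by auto
  ultimately show ?case by (auto intro!: C_k_mult C_k_const)
qed

lemma partial_deriv_translate:
  assumes "u differentiable (at (x + a))"
  shows "frechet_derivative (\<lambda>x. u (x + a)) (at x) = frechet_derivative u (at (x + a))"
proof -
  have "((\<lambda>x. x + a) has_derivative (\<lambda>h. h)) (at x)" by (auto intro!: derivative_eq_intros)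
  then have "((\<lambda>x. u (x + a)) has_derivative frechet_derivative u (at (x + a))) (at x)"
    by (rule has_derivative_compose) (rule has_derivative_frechet[OF assms])
  then show ?thesis by (rule frechet_derivative_at[symmetric])
qed

lemma C_k_translate: "C_k k u \<Longrightarrow> C_k k (\<lambda>x. u (x + a))"
proof (induction k arbitrary: u)
  case 0
  then have "continuous_on UNIV u" by simp
  then have "continuous_on UNIV (\<lambda>x. u (x + a))"
    by (rule continuous_on_compose2) (auto intro!: continuous_intros)
  then show ?case by simp
next
  case (Suc k)
  have d: "u differentiable (at x)" for x using Suc.prems by auto
  have "(\<lambda>x. u (x + a)) differentiable (at x)" for x
    by (rule differentiable_compose[OF d]) (auto intro!: derivative_intros)
  moreover have "partial_deriv i (\<lambda>x. u (x + a)) = (\<lambda>x. partial_deriv i u (x + a))" for i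
    using partial_deriv_translate d by metis
  moreover have "C_k k (\<lambda>x. partial_deriv i u (x + a))" if "i \<in> Basis" for i
    using Suc.IH[of "partial_deriv i u"] Suc.prems that by simp
  ultimately show ?case by simp
qed

lemma smooth_translate: "smooth u \<Longrightarrow> smooth (\<lambda>x. u (x + a))"
  by (simp add: smooth_def C_k_translate)

text \<open>
  The functions \<open>exp (- 1 / t) / t ^ m\<close>, continued by zero to \<open>t \<le> 0\<close>. The denominator makes the family
  closed under differentiation up to linear combinations, so that smoothness is an induction on the order
  for all \<open>m\<close> simultaneously.
\<close>

definition flat_exp :: "nat \<Rightarrow> real \<Rightarrow> real" where
  "flat_exp m t = (if t \<le> 0 then 0 else exp (- 1 / t) / t ^ m)"

text \<open>
  One term of the exponential series at \<open>1 / t\<close>. The quadratic bound gives differentiability at the origin.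
\<close>

lemma flat_exp_le: "\<bar>flat_exp m t\<bar> \<le> fact (m + 2) * t\<^sup>2"
proof (cases "t \<le> 0")
  case False
  define s where "s = 1 / t"
  have s: "s > 0" using False by (simp add: s_def)
  have "s ^ (m + 2) / fact (m + 2) \<le> exp s"
  proof -
    have "(\<Sum>k\<in>{m + 2}. s ^ k /\<^sub>R fact k) \<le> (\<Sum>k. s ^ k /\<^sub>R fact k)"
      by (rule sum_le_suminf) (use s summable_exp_generic[of s] in auto)
    then show ?thesis by (simp add: exp_def divide_inverse mult.commute)
  qed
  then have "s ^ (m + 2) \<le> exp s * fact (m + 2)" by (subst (asm) pos_divide_le_eq) auto
  then have "exp (- s) * s ^ (m + 2) \<le> exp (- s) * (exp s * fact (m + 2))" by (intro mult_left_mono) auto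
  then have "exp (- s) * s ^ (m + 2) \<le> fact (m + 2)"
    unfolding mult.assoc[symmetric] exp_add[symmetric] by simp
  moreover have "exp (- s) * s ^ (m + 2) = exp (- 1 / t) / t ^ m / t\<^sup>2"
    by (simp add: s_def power_divide power_add power2_eq_square field_simps)
  ultimately have "exp (- 1 / t) / t ^ m / t\<^sup>2 \<le> fact (m + 2)" by simp
  then have "exp (- 1 / t) / t ^ m \<le> fact (m + 2) * t\<^sup>2"
    by (subst (asm) pos_divide_le_eq) (use False in auto)
  moreover have "\<bar>flat_exp m t\<bar> = exp (- 1 / t) / t ^ m" using False by (simp add: flat_exp_def)
  ultimately show ?thesis by (simp only:)
qed (simp add: flat_exp_def)

lemma flat_exp_derivative:
  "(flat_exp m has_real_derivative (flat_exp (m + 2) t - real m * flat_exp (m + 1) t)) (at t)"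
proof -
  consider "t < 0" | "t = 0" | "t > 0" by linarith
  then show ?thesis
  proof cases
    case 1
    have "(flat_exp m has_real_derivative 0) (at t)"
    proof (rule has_field_derivative_transform_within_open)
      show "((\<lambda>t. 0) has_real_derivative 0) (at t)" by simp
      show "open {..<0::real}" "t \<in> {..<0}" using 1 by auto
    qed (simp add: flat_exp_def)
    then show ?thesis using 1 by (simp add: flat_exp_def)
  next
    case 2
    have "(flat_exp m has_real_derivative 0) (at 0)"
      unfolding has_field_derivative_iff
    proof (rule Lim_null_comparison)
      have "norm ((flat_exp m y - flat_exp m 0) / (y - 0)) \<le> fact (m + 2) * \<bar>y\<bar>" for y
      proof (cases "y = 0")
        case False
        have "\<bar>flat_exp m y\<bar> \<le> (fact (m + 2) * \<bar>y\<bar>) * \<bar>y\<bar>"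
          using flat_exp_le[of m y] by (simp add: power2_eq_square mult.assoc)
        then have "\<bar>flat_exp m y\<bar> / \<bar>y\<bar> \<le> fact (m + 2) * \<bar>y\<bar>" using False by (subst pos_divide_le_eq) auto
        then show ?thesis by (simp add: flat_exp_def abs_divide)
      qed (simp add: flat_exp_def)
      then show "\<forall>\<^sub>F y in at 0. norm ((flat_exp m y - flat_exp m 0) / (y - 0)) \<le> fact (m + 2) * \<bar>y\<bar>" by simp
      show "((\<lambda>y::real. fact (m + 2) * \<bar>y\<bar>) \<longlongrightarrow> 0) (at 0)"
        by (intro tendsto_mult_right_zero tendsto_rabs_zero tendsto_ident_at)
    qed
    then show ?thesis using 2 by (simp add: flat_exp_def)
  next
    case 3
    have "(flat_exp m has_real_derivative
        ((exp (- 1 / t) * (1 / t\<^sup>2) * t ^ m - exp (- 1 / t) * (real m * t ^ (m - 1))) / (t ^ m * t ^ m))) (at t)"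
    proof (rule has_field_derivative_transform_within_open)
      show "((\<lambda>t. exp (- 1 / t) / t ^ m) has_real_derivative
        ((exp (- 1 / t) * (1 / t\<^sup>2) * t ^ m - exp (- 1 / t) * (real m * t ^ (m - 1))) / (t ^ m * t ^ m))) (at t)"
        using 3 by (auto intro!: derivative_eq_intros simp: power2_eq_square)
      show "open {0::real<..}" "t \<in> {0<..}" using 3 by auto
    qed (simp add: flat_exp_def)
    moreover have "(exp (- 1 / t) * (1 / t\<^sup>2) * t ^ m - exp (- 1 / t) * (real m * t ^ (m - 1))) / (t ^ m * t ^ m)
        = flat_exp (m + 2) t - real m * flat_exp (m + 1) t"
      using 3 by (cases m) (simp_all add: flat_exp_def power2_eq_square field_simps)
    ultimately show ?thesis by simp
  qed
qed

lemma smooth_flat_exp: "smooth (flat_exp m)"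
proof -
  have "C_k k (flat_exp m)" for k
  proof (induction k arbitrary: m)
    case 0
    show ?case
      by (auto intro!: continuous_at_imp_continuous_on DERIV_isCont[OF flat_exp_derivative])
  next
    case (Suc k)
    have hd: "(flat_exp m has_derivative (*) (flat_exp (m + 2) t - real m * flat_exp (m + 1) t)) (at t)" for t
      using flat_exp_derivative[of m t] by (simp add: has_field_derivative_def)
    have "partial_deriv 1 (flat_exp m) = (\<lambda>t. flat_exp (m + 2) t + (- real m) * flat_exp (m + 1) t)"
      using partial_deriv_eqI[OF hd] by (auto simp: fun_eq_iff)
    moreover have "C_k k (\<lambda>t. flat_exp (m + 2) t + (- real m) * flat_exp (m + 1) t)"
      by (intro C_k_add C_k_mult C_k_const Suc)
    ultimately show ?case using hd by (auto intro: differentiableI)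
  qed
  then show ?thesis by (simp add: smooth_def)
qed

text \<open>
  Positive exactly on the open box. Letting the parameter \<open>c\<close> grow turns the bump into the indicator of the
  box, because \<open>exp (- 1 / (c t))\<close> tends to \<open>1\<close> for \<open>t > 0\<close>.
\<close>

definition box_bump :: "real \<Rightarrow> 'a::euclidean_space \<Rightarrow> 'a \<Rightarrow> 'a \<Rightarrow> real" where
  "box_bump c a b x = (\<Prod>i\<in>Basis. flat_exp 0 (c * (x \<bullet> i - a \<bullet> i)) * flat_exp 0 (c * (b \<bullet> i - x \<bullet> i)))"

lemma flat_exp_0: "flat_exp 0 t = (if t \<le> 0 then 0 else exp (- 1 / t))"
  by (simp add: flat_exp_def)

lemma flat_exp_0_bounds: "0 \<le> flat_exp 0 t" "flat_exp 0 t \<le> 1"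
  by (auto simp: flat_exp_0)

lemma smooth_box_bump: "smooth (box_bump c a b)"
proof -
  have "smooth (\<lambda>x. flat_exp 0 (c * (x \<bullet> i) + (- c * (a \<bullet> i))) * flat_exp 0 ((- c) * (x \<bullet> i) + c * (b \<bullet> i)))" for i
    using smooth_flat_exp[of 0] unfolding smooth_def by (intro allI C_k_mult C_k_compose_inner) auto
  then have "smooth (\<lambda>x. \<Prod>i\<in>Basis. flat_exp 0 (c * (x \<bullet> i) + (- c * (a \<bullet> i))) * flat_exp 0 ((- c) * (x \<bullet> i) + c * (b \<bullet> i)))"
    by (intro smooth_prod) auto
  then show ?thesis by (simp add: box_bump_def[abs_def] algebra_simps)
qed

lemma box_bump_bounds: "0 \<le> box_bump c a b x" "box_bump c a b x \<le> 1"
  unfolding box_bump_def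
  by (auto intro!: prod_nonneg prod_le_1 mult_nonneg_nonneg mult_le_one flat_exp_0_bounds)

lemma box_bump_pos: "0 < c \<Longrightarrow> x \<in> box a b \<Longrightarrow> 0 < box_bump c a b x"
  unfolding box_bump_def by (auto intro!: prod_pos simp: flat_exp_0 mem_box mult_le_0_iff not_le)

lemma box_bump_zero: "0 < c \<Longrightarrow> x \<notin> box a b \<Longrightarrow> box_bump c a b x = 0"
  unfolding box_bump_def by (auto simp: flat_exp_0 mem_box not_less mult_le_0_iff)

lemma box_bump_limit: "(\<lambda>n. box_bump (real (Suc n)) a b x) \<longlonglongrightarrow> indicator (box a b) x"
proof (cases "x \<in> box a b")
  case True
  have fe: "(\<lambda>n. flat_exp 0 (real (Suc n) * t)) \<longlonglongrightarrow> 1" if "t > 0" for t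
  proof -
    have "(\<lambda>n. exp (- (1 / t) * (1 / real (Suc n)))) \<longlonglongrightarrow> exp (- (1 / t) * 0)"
      by (intro tendsto_intros LIMSEQ_Suc[OF lim_1_over_n])
    moreover have "flat_exp 0 (real (Suc n) * t) = exp (- (1 / t) * (1 / real (Suc n)))" for n
    proof -
      have "0 < real (Suc n) * t" using that by (intro mult_pos_pos) auto
      then have "flat_exp 0 (real (Suc n) * t) = exp (- 1 / (real (Suc n) * t))"
        unfolding flat_exp_0 by (simp only: not_le[symmetric] if_False)
      also have "- 1 / (real (Suc n) * t) = - (1 / t) * (1 / real (Suc n))" by (simp add: mult.commute)
      finally show ?thesis .
    qed
    ultimately show ?thesis by simp
  qed
  have "(\<lambda>n. box_bump (real (Suc n)) a b x) \<longlonglongrightarrow> (\<Prod>i\<in>(Basis::'a set). 1 * 1)"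
    unfolding box_bump_def using True by (intro tendsto_prod tendsto_mult fe) (auto simp: mem_box)
  then show ?thesis using True by simp
next
  case False
  then show ?thesis using box_bump_zero[of _ x a b] by simp
qed

lemma box_bump_test:
  assumes "0 < c" "cbox a b \<subseteq> \<Omega>"
  shows "box_bump c a b \<in> test_functions \<Omega>" and "closure {x. box_bump c a b x \<noteq> 0} \<subseteq> cbox a b"
proof -
  have "{x. box_bump c a b x \<noteq> 0} \<subseteq> cbox a b"
    using box_bump_zero[OF assms(1)] box_subset_cbox by blast
  then have *: "closure {x. box_bump c a b x \<noteq> 0} \<subseteq> cbox a b" by (intro closure_minimal) auto
  then show "closure {x. box_bump c a b x \<noteq> 0} \<subseteq> cbox a b" .
  have "compact (closure {x. box_bump c a b x \<noteq> 0})"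
    using * by (meson bounded_cbox bounded_subset closed_closure compact_eq_bounded_closed)
  then show "box_bump c a b \<in> test_functions \<Omega>"
    using * assms smooth_box_bump[of c a b] by (auto simp: test_functions_def smooth_def)
qed

lemma test_functionsI:
  assumes "smooth u" "compact K" "K \<subseteq> \<Omega>" "\<And>x. x \<notin> K \<Longrightarrow> u x = 0"
  shows "u \<in> test_functions \<Omega>"
proof -
  have *: "closure {x. u x \<noteq> 0} \<subseteq> K" using assms by (intro closure_minimal compact_imp_closed) auto
  moreover have "compact (closure {x. u x \<noteq> 0})"
    using * assms(2) by (meson bounded_subset closed_closure compact_eq_bounded_closed)
  ultimately show ?thesis using assms by (auto simp: test_functions_def smooth_def)
qed

lemma test_functionsE:
  assumes "u \<in> test_functions \<Omega>"
  obtains K where "smooth u" "compact K" "K \<subseteq> \<Omega>" "\<And>x. x \<notin> K \<Longrightarrow> u x = 0"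
    "\<And>x h. x \<notin> K \<Longrightarrow> frechet_derivative u (at x) h = 0"
proof
  show "smooth u" "compact (closure {x. u x \<noteq> 0})" "closure {x. u x \<noteq> 0} \<subseteq> \<Omega>"
    using assms by (auto simp: test_functions_def smooth_def)
  show z: "u x = 0" if "x \<notin> closure {x. u x \<noteq> 0}" for x
    using that closure_subset[of "{x. u x \<noteq> 0}"] by auto
  show "frechet_derivative u (at x) h = 0" if "x \<notin> closure {x. u x \<noteq> 0}" for x h
  proof -
    have "(u has_derivative (\<lambda>h. 0)) (at x)"
    proof (rule has_derivative_transform_within_open)
      show "((\<lambda>x. 0) has_derivative (\<lambda>h. 0)) (at x)" by simp
      show "open (- closure {x. u x \<noteq> 0})" "x \<in> - closure {x. u x \<noteq> 0}" using that by auto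
      show "0 = u y" if "y \<in> - closure {x. u x \<noteq> 0}" for y using z[of y] that by simp
    qed
    then show ?thesis by (rule partial_deriv_eqI)
  qed
qed

lemma test_smooth: "u \<in> test_functions \<Omega> \<Longrightarrow> smooth u"
  by (simp add: test_functions_def smooth_def)

lemma test_partial: "u \<in> test_functions \<Omega> \<Longrightarrow> i \<in> Basis \<Longrightarrow> partial_deriv i u \<in> test_functions \<Omega>"
  by (elim test_functionsE, rule test_functionsI) (auto intro: smooth_partial)

lemma test_mult: "u \<in> test_functions \<Omega> \<Longrightarrow> smooth v \<Longrightarrow> (\<lambda>x. u x * v x) \<in> test_functions \<Omega>"
  by (elim test_functionsE, rule test_functionsI[where K = K for K]) (auto intro: smooth_mult)

lemma test_mono: "u \<in> test_functions \<Omega> \<Longrightarrow> \<Omega> \<subseteq> \<Omega>' \<Longrightarrow> u \<in> test_functions \<Omega>'"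
  by (auto simp: test_functions_def)

lemma test_translate:
  assumes "u \<in> test_functions \<Omega>" "(\<lambda>x. x - a) ` \<Omega> \<subseteq> \<Omega>'"
  shows "(\<lambda>x. u (x + a)) \<in> test_functions \<Omega>'"
  using assms(1)
proof (rule test_functionsE)
  fix K assume K: "smooth u" "compact K" "K \<subseteq> \<Omega>" "\<And>x. x \<notin> K \<Longrightarrow> u x = 0"
  show ?thesis
  proof (rule test_functionsI)
    show "smooth (\<lambda>x. u (x + a))" using K by (intro smooth_translate)
    show "compact ((\<lambda>x. x - a) ` K)" using K by (intro compact_continuous_image continuous_intros)
    show "(\<lambda>x. x - a) ` K \<subseteq> \<Omega>'" using K assms by blast
    show "u (x + a) = 0" if "x \<notin> (\<lambda>x. x - a) ` K" for x
      using that K(4)[of "x + a"] by (metis add_diff_cancel image_eqI)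
  qed
qed

lemma test_bounded:
  assumes "u \<in> test_functions \<Omega>"
  obtains B where "0 \<le> B" "\<And>x. \<bar>u x\<bar> \<le> B"
  using assms
proof (rule test_functionsE)
  fix K assume K: "smooth u" "compact K" "\<And>x. x \<notin> K \<Longrightarrow> u x = 0"
  have "compact (u ` K)" using K by (intro compact_continuous_image smooth_continuous)
  then obtain B where "\<And>x. x \<in> K \<Longrightarrow> \<bar>u x\<bar> \<le> B"
    using compact_imp_bounded bounded_iff by (metis imageI real_norm_def)
  then have "\<bar>u x\<bar> \<le> max B 0" for x using K(3)[of x] by (cases "x \<in> K") (auto simp: le_max_iff_disj)
  then show ?thesis using that[of "max B 0"] by auto
qed

lemma test_integrable_mult:
  fixes v :: "'a::euclidean_space \<Rightarrow> real"
  assumes "u \<in> test_functions \<Omega>" "integrable lborel v"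
  shows "integrable lborel (\<lambda>x. v x * u x)"
proof -
  obtain B where B: "\<And>x. \<bar>u x\<bar> \<le> B" using test_bounded[OF assms(1)] by blast
  have [measurable]: "u \<in> borel_measurable borel" using smooth_borel test_smooth[OF assms(1)] .
  have [measurable]: "v \<in> borel_measurable borel" using assms(2) by auto
  show ?thesis
  proof (rule Bochner_Integration.integrable_bound)
    show "integrable lborel (\<lambda>x. v x * B)" using assms(2) by auto
    have "\<bar>v x * u x\<bar> \<le> \<bar>v x * B\<bar>" for x
      using B[of x] by (auto simp: abs_mult intro!: mult_left_mono)
    then show "AE x in lborel. norm (v x * u x) \<le> norm (v x * B)" by auto
  qed measurable
qed

lemma test_frechet_bounded:
  assumes u: "u \<in> test_functions \<Omega>"
  shows "\<exists>L\<ge>0. (\<forall>x h. \<bar>frechet_derivative u (at x) h\<bar> \<le> L * norm h) \<and>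
    (\<forall>x y. \<bar>u x - u y\<bar> \<le> L * norm (x - y))"
proof -
  have "\<forall>i\<in>Basis. \<exists>B. 0 \<le> B \<and> (\<forall>x. \<bar>partial_deriv i u x\<bar> \<le> B)"
    using test_bounded[OF test_partial[OF u]] by metis
  then obtain B where B: "\<And>i. i \<in> Basis \<Longrightarrow> 0 \<le> B i" "\<And>i x. i \<in> Basis \<Longrightarrow> \<bar>partial_deriv i u x\<bar> \<le> B i"
    by metis
  define L where "L = (\<Sum>i\<in>Basis. B i)"
  have L: "0 \<le> L" unfolding L_def using B by (intro sum_nonneg) auto
  have d: "u differentiable (at x)" for x by (rule smooth_differentiable[OF test_smooth[OF u]])
  have 1: "\<bar>frechet_derivative u (at x) h\<bar> \<le> L * norm h" for x h
  proof -
    have "\<bar>frechet_derivative u (at x) h\<bar> \<le> (\<Sum>i\<in>Basis. \<bar>(h \<bullet> i) * partial_deriv i u x\<bar>)"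
      by (subst frechet_derivative_sum_Basis[OF d]) (rule sum_abs)
    also have "\<dots> \<le> (\<Sum>i\<in>Basis. norm h * B i)"
      using B by (intro sum_mono) (auto simp: abs_mult intro!: mult_mono Basis_le_norm)
    finally show ?thesis by (simp add: L_def sum_distrib_left mult.commute)
  qed
  have 2: "\<bar>u x - u y\<bar> \<le> L * norm (x - y)" for x y
  proof -
    have "norm (u x - u y) \<le> L * norm (x - y)"
    proof (rule differentiable_bound[where f' = "\<lambda>x. frechet_derivative u (at x)"])
      show "(u has_derivative frechet_derivative u (at z)) (at z within UNIV)" for z
        using d has_derivative_frechet by auto
      show "onorm (frechet_derivative u (at z)) \<le> L" for z
        by (rule onorm_le) (use 1 in auto)
    qed auto
    then show ?thesis by simp
  qed
  show ?thesis using L 1 2 by (intro exI[of _ L] conjI allI)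
qed

text \<open>
  Box bumps converge to indicators of boxes, so the integral over every box vanishes; boxes form an
  intersection-stable generator of the Borel sets.
\<close>

lemma fundamental_lemma:
  fixes v :: "'a::euclidean_space \<Rightarrow> real"
  assumes v: "integrable lborel v"
    and test: "\<And>\<psi>. \<psi> \<in> test_functions UNIV \<Longrightarrow> (LINT x|lborel. v x * \<psi> x) = 0"
  shows "AE x in lborel. v x = 0"
proof (rule sigma_finite_measure.density_zero[OF sigma_finite_lborel v])
  have v_meas [measurable]: "v \<in> borel_measurable borel" using v by auto
  have set_int: "set_integrable lborel A v" if "A \<in> sets borel" for A
    unfolding set_integrable_def using integrable_mult_indicator[OF _ v, of A] that by simp
  have box0: "(LINT x:box a b|lborel. v x) = 0" for a b :: 'a
  proof -
    have "(\<lambda>n. LINT x|lborel. v x * box_bump (real (Suc n)) a b x) \<longlonglongrightarrow> (LINT x|lborel. v x * indicator (box a b) x)"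
    proof (rule integral_dominated_convergence[where w = "\<lambda>x. \<bar>v x\<bar>"])
      show "AE x in lborel. (\<lambda>n. v x * box_bump (real (Suc n)) a b x) \<longlonglongrightarrow> v x * indicator (box a b) x"
        by (intro AE_I2 tendsto_intros box_bump_limit)
      show "AE x in lborel. norm (v x * box_bump (real (Suc n)) a b x) \<le> \<bar>v x\<bar>" for n
        using box_bump_bounds[of "real (Suc n)" a b] by (auto simp: abs_mult intro!: mult_left_le)
      show "(\<lambda>x. v x * box_bump (real (Suc n)) a b x) \<in> borel_measurable lborel" for n
        using smooth_borel[OF smooth_box_bump[of "real (Suc n)" a b]] by measurable
    qed (use v in auto)
    moreover have "(LINT x|lborel. v x * box_bump (real (Suc n)) a b x) = 0" for n
      by (intro test box_bump_test) auto
    ultimately have "(LINT x|lborel. v x * indicator (box a b) x) = 0"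
      using LIMSEQ_unique[OF _ tendsto_const[of "0::real"]] by simp
    then show ?thesis by (simp add: set_lebesgue_integral_def mult.commute)
  qed
  have UNIV0: "(LINT x:UNIV|lborel. v x) = 0"
  proof -
    let ?B = "\<lambda>n::nat. box (- (real n *\<^sub>R One)) (real n *\<^sub>R One) :: 'a set"
    have "(\<lambda>n. LINT x:?B n|lborel. v x) \<longlonglongrightarrow> (LINT x:(\<Union>n. ?B n)|lborel. v x)"
    proof (rule set_integral_cont_up)
      show "incseq ?B"
      proof (clarsimp simp: incseq_def mem_box)
        fix m n :: nat and x i :: 'a
        assume "m \<le> n" "\<forall>i\<in>Basis. - real m < x \<bullet> i \<and> x \<bullet> i < real m" "i \<in> Basis"
        then have "- real m < x \<bullet> i" "x \<bullet> i < real m" "real m \<le> real n" by auto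
        then show "- real n < x \<bullet> i \<and> x \<bullet> i < real n" by linarith
      qed
    qed (auto intro!: set_int)
    then show ?thesis unfolding box0 UN_box_eq_UNIV using LIMSEQ_unique tendsto_const by metis
  qed
  fix A :: "'a set" assume "A \<in> sets lborel"
  have "Int_stable (range (\<lambda>(a, b). box a b :: 'a set))"
    by (auto simp: Int_stable_def box_Int_box)
  moreover have "range (\<lambda>(a, b). box a b :: 'a set) \<subseteq> Pow UNIV" by simp
  moreover have "A \<in> sigma_sets UNIV (range (\<lambda>(a, b). box a b))"
    using \<open>A \<in> sets lborel\<close> by (simp add: borel_eq_box)
  ultimately show "(LINT x:A|lborel. v x) = 0"
  proof (induction rule: sigma_sets_induct_disjoint)
    case empty
    show ?case by (simp add: set_lebesgue_integral_def)
  next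
    case (basic A)
    then show ?case using box0 by auto
  next
    case (compl A)
    then have "A \<in> sets borel" by (simp add: borel_eq_box)
    then have "(LINT x:A \<union> (UNIV - A)|lborel. v x) = (LINT x:A|lborel. v x) + (LINT x:UNIV - A|lborel. v x)"
      by (intro set_integral_Un set_int) auto
    then show ?case using UNIV0 compl by simp
  next
    case (union A)
    then have "A i \<in> sets borel" for i by (auto simp: borel_eq_box)
    then have "(LINT x:(\<Union>i. A i)|lborel. v x) = (\<Sum>i. LINT x:A i|lborel. v x)"
      using union(1) by (intro lebesgue_integral_countable_add set_int) (auto simp: disjoint_family_on_def)
    then show ?case using union by simp
  qed
qed

section \<open>Weak gradients and averages along segments\<close>

lemma lborel_translate:
  fixes f :: "'a::euclidean_space \<Rightarrow> 'b::{banach, second_countable_topology}"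
  assumes [measurable]: "f \<in> borel_measurable borel"
  shows "(LINT x|lborel. f (x + h)) = (LINT x|lborel. f x)"
    and "integrable lborel (\<lambda>x. f (x + h)) \<longleftrightarrow> integrable lborel f"
proof -
  have "(LINT x|lborel. f x) = (LINT x|distr lborel borel ((+) h). f x)"
    by (simp only: lborel_distr_plus)
  also have "\<dots> = (LINT x|lborel. f (h + x))" by (rule integral_distr) measurable
  finally show "(LINT x|lborel. f (x + h)) = (LINT x|lborel. f x)" by (simp add: add.commute)
  have "integrable lborel f \<longleftrightarrow> integrable (distr lborel borel ((+) h)) f"
    by (simp only: lborel_distr_plus)
  also have "\<dots> \<longleftrightarrow> integrable lborel (\<lambda>x. f (h + x))"
    by (rule integrable_distr_eq) measurable
  finally show "integrable lborel (\<lambda>x. f (x + h)) \<longleftrightarrow> integrable lborel f" by (simp add: add.commute)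
qed

definition weak_gradient_lborel :: "'a::euclidean_space set \<Rightarrow> ('a \<Rightarrow> real) \<Rightarrow> ('a \<Rightarrow> 'a) \<Rightarrow> bool" where
  "weak_gradient_lborel S u G \<longleftrightarrow> (\<forall>\<psi>\<in>test_functions S. \<forall>i\<in>Basis.
     (LINT x|lborel. u x * partial_deriv i \<psi> x) = - (LINT x|lborel. (G x \<bullet> i) * \<psi> x))"

text \<open>
  For a weak gradient \<open>G\<close> of \<open>u\<close> this represents the increment \<open>u(x + h) - u(x)\<close>.
\<close>

definition line_average :: "('a::euclidean_space \<Rightarrow> 'a) \<Rightarrow> 'a \<Rightarrow> 'a \<Rightarrow> real" where
  "line_average G h x = (LINT t|lborel. indicator {0..1} t * (G (x + t *\<^sub>R h) \<bullet> h))"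

lemma integrable_along_line:
  fixes g :: "'a::euclidean_space \<Rightarrow> real"
  assumes g: "integrable lborel g"
  shows "integrable (lborel \<Otimes>\<^sub>M lborel) (\<lambda>(x, t). indicator {0..1::real} t * g (x + t *\<^sub>R h))"
proof -
  have [measurable]: "g \<in> borel_measurable borel" using g by auto
  define f where "f x t = indicator {0..1::real} t * g (x + t *\<^sub>R h)" for x t
  have "case_prod f \<in> borel_measurable (borel \<Otimes>\<^sub>M borel)"
    unfolding f_def by measurable
  then have [measurable]: "case_prod f \<in> borel_measurable (lborel \<Otimes>\<^sub>M lborel)"
    by (simp cong: measurable_cong_sets)
  have "(\<integral>\<^sup>+z. ennreal (norm (case_prod f z)) \<partial>(lborel \<Otimes>\<^sub>M lborel))
     = (\<integral>\<^sup>+t. \<integral>\<^sup>+x. ennreal (norm (f x t)) \<partial>lborel \<partial>lborel)"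
    by (subst lborel_pair.nn_integral_snd[symmetric]) (simp_all)
  also have "\<dots> = (\<integral>\<^sup>+t. indicator {0..1::real} t * (\<integral>\<^sup>+x. ennreal \<bar>g x\<bar> \<partial>lborel) \<partial>lborel)"
  proof (intro nn_integral_cong)
    fix t :: real
    have "(\<integral>\<^sup>+x. ennreal (norm (f x t)) \<partial>lborel) = (\<integral>\<^sup>+x. indicator {0..1} t * ennreal \<bar>g (x + t *\<^sub>R h)\<bar> \<partial>lborel)"
      by (intro nn_integral_cong) (auto simp: f_def indicator_def)
    also have "\<dots> = indicator {0..1} t * (\<integral>\<^sup>+x. ennreal \<bar>g (x + t *\<^sub>R h)\<bar> \<partial>lborel)"
      by (rule nn_integral_cmult) measurable
    also have "(\<integral>\<^sup>+x. ennreal \<bar>g (x + t *\<^sub>R h)\<bar> \<partial>lborel) = (\<integral>\<^sup>+x. ennreal \<bar>g x\<bar> \<partial>lborel)"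
      by (rule nn_integral_lborel_translate) measurable
    finally show "(\<integral>\<^sup>+x. ennreal (norm (f x t)) \<partial>lborel) = indicator {0..1} t * (\<integral>\<^sup>+x. ennreal \<bar>g x\<bar> \<partial>lborel)" .
  qed
  also have "\<dots> = (\<integral>\<^sup>+x. ennreal \<bar>g x\<bar> \<partial>lborel)"
    by (subst nn_integral_multc) auto
  also have "\<dots> < \<infinity>" using g unfolding integrable_iff_bounded by simp
  finally have "integrable (lborel \<Otimes>\<^sub>M lborel) (case_prod f)"
    by (intro integrableI_bounded) auto
  then show ?thesis by (simp add: f_def[abs_def])
qed

lemma integrable_along_line_mult:
  fixes g :: "'a::euclidean_space \<Rightarrow> real"
  assumes g: "integrable lborel g" and [measurable]: "case_prod c \<in> borel_measurable (borel \<Otimes>\<^sub>M borel)"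
    and B: "\<And>x t. \<bar>c x t\<bar> \<le> B"
  shows "integrable (lborel \<Otimes>\<^sub>M lborel) (\<lambda>(x, t). indicator {0..1::real} t * g (x + t *\<^sub>R h) * c x t)"
proof (rule Bochner_Integration.integrable_bound)
  show "integrable (lborel \<Otimes>\<^sub>M lborel) (\<lambda>z. (case z of (x, t) \<Rightarrow> indicator {0..1::real} t * g (x + t *\<^sub>R h)) * B)"
    using integrable_along_line[OF g, of h] by auto
  have [measurable]: "g \<in> borel_measurable borel" using g by auto
  have "(\<lambda>(x, t). indicator {0..1::real} t * g (x + t *\<^sub>R h) * c x t) \<in> borel_measurable (borel \<Otimes>\<^sub>M borel)"
    by measurable
  then show "(\<lambda>(x, t). indicator {0..1::real} t * g (x + t *\<^sub>R h) * c x t) \<in> borel_measurable (lborel \<Otimes>\<^sub>M lborel)"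
    by (simp cong: measurable_cong_sets)
  have "\<bar>c x t\<bar> \<le> \<bar>B\<bar>" for x t using B[of x t] by linarith
  then show "AE z in lborel \<Otimes>\<^sub>M lborel. norm (case z of (x, t) \<Rightarrow> indicator {0..1::real} t * g (x + t *\<^sub>R h) * c x t)
     \<le> norm ((case z of (x, t) \<Rightarrow> indicator {0..1::real} t * g (x + t *\<^sub>R h)) * B)"
    by (intro AE_I2) (simp add: abs_mult mult_left_mono split: prod.split)
qed

lemma integrable_line_average:
  assumes "integrable lborel G"
  shows "integrable lborel (line_average G h)"
proof -
  have "integrable lborel (\<lambda>x. G x \<bullet> h)" using assms by auto
  from lborel_pair.integrable_fst[OF integrable_along_line[OF this, of h]]
  show ?thesis by (simp add: line_average_def[abs_def])
qed

lemma integral_directional_derivative: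
  assumes u: "smooth u"
  shows "(LINT t|lborel. indicator {0..1} t * frechet_derivative u (at (y - t *\<^sub>R h)) h) = u y - u (y - h)"
proof -
  have d: "u differentiable (at x)" for x using u by (rule smooth_differentiable)
  have "(LINT t|lborel. indicator {0..1} t *\<^sub>R frechet_derivative u (at (y - t *\<^sub>R h)) h)
     = - u (y - 1 *\<^sub>R h) - (- u (y - 0 *\<^sub>R h))"
  proof (rule integral_FTC_atLeastAtMost)
    fix t :: real
    have "((\<lambda>t. y - t *\<^sub>R h) has_derivative (\<lambda>s. - (s *\<^sub>R h))) (at t within {0..1})"
      by (auto intro!: derivative_eq_intros)
    then have "((\<lambda>t. u (y - t *\<^sub>R h)) has_derivative (\<lambda>s. frechet_derivative u (at (y - t *\<^sub>R h)) (- (s *\<^sub>R h)))) (at t within {0..1})"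
      by (rule has_derivative_compose) (rule has_derivative_frechet[OF d])
    then have "((\<lambda>t. - u (y - t *\<^sub>R h)) has_derivative (\<lambda>s. - frechet_derivative u (at (y - t *\<^sub>R h)) (- (s *\<^sub>R h)))) (at t within {0..1})"
      by (rule has_derivative_minus)
    moreover have "- frechet_derivative u (at (y - t *\<^sub>R h)) (- (s *\<^sub>R h)) = s *\<^sub>R frechet_derivative u (at (y - t *\<^sub>R h)) h" for s
      using linear_frechet_derivative[OF d, of "y - t *\<^sub>R h"] by (simp add: linear_neg linear_scale)
    ultimately show "((\<lambda>t. - u (y - t *\<^sub>R h)) has_vector_derivative frechet_derivative u (at (y - t *\<^sub>R h)) h) (at t within {0..1})"
      by (simp add: has_vector_derivative_def)
  next
    have "continuous_on {0..1} (\<lambda>t. \<Sum>i\<in>Basis. (h \<bullet> i) * partial_deriv i u (y - t *\<^sub>R h))"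
      by (intro continuous_intros continuous_on_compose2[OF smooth_continuous[OF smooth_partial[OF u], of _ UNIV]]) auto
    then show "continuous_on {0..1} (\<lambda>t. frechet_derivative u (at (y - t *\<^sub>R h)) h)"
      by (subst frechet_derivative_sum_Basis[OF d])
  qed simp
  then show ?thesis by simp
qed

lemma measurable_frechet [measurable]:
  assumes "smooth u"
  shows "(\<lambda>x. frechet_derivative u (at x) h) \<in> borel_measurable borel"
proof -
  have "(\<lambda>x. \<Sum>i\<in>Basis. (h \<bullet> i) * partial_deriv i u x) \<in> borel_measurable borel"
    using smooth_borel[OF smooth_partial[OF assms]] by measurable
  then show ?thesis
    by (subst frechet_derivative_sum_Basis[OF smooth_differentiable[OF assms]])
qed

text \<open>
  Formally \<open>\<nabla>(u(x + h) - u(x)) = G(x + h) - G(x)\<close>. For a fixed time \<open>t\<close>, translation and the weak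
  gradient identity, tested with the translated partial derivatives of \<open>\<eta>\<close>, turn \<open>G . h\<close> into \<open>u\<close> against a
  directional derivative of \<open>\<partial>\<^sub>i \<eta>\<close>. Integration over \<open>t\<close> evaluates that derivative to a
  difference, and the identity is used once more, backwards, with \<open>\<eta>\<close> and its translate.
\<close>

lemma line_average_weak_gradient:
  assumes u: "integrable lborel u" and G: "integrable lborel G"
    and wg: "weak_gradient_lborel \<Omega> u G"
    and chi: "\<eta> \<in> test_functions \<Omega>"
    and shift: "\<And>t. 0 \<le> t \<Longrightarrow> t \<le> 1 \<Longrightarrow> (\<lambda>x. \<eta> (x - t *\<^sub>R h)) \<in> test_functions \<Omega>"
    and i: "i \<in> Basis"
  shows "(LINT x|lborel. line_average G h x * partial_deriv i \<eta> x)
      = - (LINT x|lborel. ((G (x + h) - G x) \<bullet> i) * \<eta> x)"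
proof -
  have [measurable]: "u \<in> borel_measurable borel" "G \<in> borel_measurable borel" using u G by auto
  have smooth: "smooth \<eta>" using chi by (rule test_smooth)
  define \<rho> where "\<rho> = partial_deriv i \<eta>"
  have rho: "\<rho> \<in> test_functions \<Omega>" unfolding \<rho>_def by (rule test_partial[OF chi i])
  have rho_smooth: "smooth \<rho>" using rho by (rule test_smooth)
  have [measurable]: "\<rho> \<in> borel_measurable borel" using rho_smooth by (rule smooth_borel)
  have [measurable]: "\<eta> \<in> borel_measurable borel" using smooth by (rule smooth_borel)
  obtain B where B: "\<And>x. \<bar>\<rho> x\<bar> \<le> B" using test_bounded[OF rho] by blast
  obtain L where L: "\<forall>x h. \<bar>frechet_derivative \<rho> (at x) h\<bar> \<le> L * norm h"
    using test_frechet_bounded[OF rho] by (elim exE conjE)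
  have Gh: "integrable lborel (\<lambda>x. G x \<bullet> h)" and Gi: "integrable lborel (\<lambda>x. G x \<bullet> i)"
    by (intro integrable_inner_left G)+
  have rho_shift: "partial_deriv i (\<lambda>x. \<eta> (x - a)) = (\<lambda>x. \<rho> (x - a))" for a
  proof
    fix x
    show "partial_deriv i (\<lambda>x. \<eta> (x - a)) x = \<rho> (x - a)"
      unfolding \<rho>_def diff_conv_add_uminus
      by (rule fun_cong[OF partial_deriv_translate[OF smooth_differentiable[OF smooth]]])
  qed
  have slice: "(LINT x|lborel. (G (x + t *\<^sub>R h) \<bullet> h) * \<rho> x)
      = - (LINT y|lborel. u y * frechet_derivative \<rho> (at (y - t *\<^sub>R h)) h)" if t: "0 \<le> t" "t \<le> 1" for t
  proof -
    define \<rho>t where "\<rho>t y = \<rho> (y - t *\<^sub>R h)" for y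
    have rt: "\<rho>t \<in> test_functions \<Omega>"
      using test_partial[OF shift[OF t] i] by (simp add: rho_shift \<rho>t_def[abs_def])
    have prt: "partial_deriv j \<rho>t x = partial_deriv j \<rho> (x - t *\<^sub>R h)" for j x
        unfolding \<rho>t_def diff_conv_add_uminus
      by (rule fun_cong[OF partial_deriv_translate[OF smooth_differentiable[OF rho_smooth]]])
    have Gj: "integrable lborel (\<lambda>x. (G x \<bullet> j) * \<rho>t x)" for j
      using test_integrable_mult[OF rt, of "\<lambda>x. G x \<bullet> j"] G by auto
    have uj: "integrable lborel (\<lambda>x. u x * partial_deriv j \<rho>t x)" if "j \<in> Basis" for j
      using test_integrable_mult[OF test_partial[OF rt that] u] by auto
    have "(LINT x|lborel. (G (x + t *\<^sub>R h) \<bullet> h) * \<rho> x) = (LINT x|lborel. (\<lambda>y. (G y \<bullet> h) * \<rho>t y) (x + t *\<^sub>R h))"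
      by (simp add: \<rho>t_def)
    also have "\<dots> = (LINT y|lborel. (G y \<bullet> h) * \<rho>t y)"
      by (rule lborel_translate) (simp add: \<rho>t_def)
    also have "\<dots> = (LINT y|lborel. (\<Sum>j\<in>Basis. (h \<bullet> j) * ((G y \<bullet> j) * \<rho>t y)))"
      by (subst euclidean_inner) (simp add: sum_distrib_left sum_distrib_right mult_ac)
    also have "\<dots> = (\<Sum>j\<in>Basis. (h \<bullet> j) * (LINT y|lborel. (G y \<bullet> j) * \<rho>t y))"
      using Gj by (subst Bochner_Integration.integral_sum) auto
    also have "\<dots> = (\<Sum>j\<in>Basis. (h \<bullet> j) * - (LINT y|lborel. u y * partial_deriv j \<rho>t y))"
      using wg rt unfolding weak_gradient_lborel_def by (intro sum.cong) auto
    also have "\<dots> = - (\<Sum>j\<in>Basis. (LINT y|lborel. (h \<bullet> j) * (u y * partial_deriv j \<rho>t y)))"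
      by (simp add: sum_negf)
    also have "(\<Sum>j\<in>Basis. (LINT y|lborel. (h \<bullet> j) * (u y * partial_deriv j \<rho>t y)))
        = (LINT y|lborel. (\<Sum>j\<in>Basis. (h \<bullet> j) * (u y * partial_deriv j \<rho>t y)))"
      using uj by (subst Bochner_Integration.integral_sum) auto
    also have "\<dots> = (LINT y|lborel. u y * frechet_derivative \<rho> (at (y - t *\<^sub>R h)) h)"
      unfolding prt
      by (subst (2) frechet_derivative_sum_Basis[OF smooth_differentiable[OF rho_smooth]])
        (simp add: sum_distrib_left mult_ac)
    finally show ?thesis .
  qed
  have int1: "integrable (lborel \<Otimes>\<^sub>M lborel) (\<lambda>(x, t). indicator {0..1::real} t * (G (x + t *\<^sub>R h) \<bullet> h) * \<rho> x)"
    by (rule integrable_along_line_mult[OF Gh, of "\<lambda>x t. \<rho> x" B]) (use B in auto)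
  have mfr [measurable]: "(\<lambda>(y, t). frechet_derivative \<rho> (at (y - t *\<^sub>R h)) h) \<in> borel_measurable (borel \<Otimes>\<^sub>M borel)"
    using measurable_compose[OF _ measurable_frechet[OF rho_smooth], of "\<lambda>z. fst z - snd z *\<^sub>R h" "borel \<Otimes>\<^sub>M borel" h]
    by (simp add: case_prod_beta')
  have int2: "integrable (lborel \<Otimes>\<^sub>M lborel) (\<lambda>(y, t). indicator {0..1::real} t * u y * frechet_derivative \<rho> (at (y - t *\<^sub>R h)) h)"
    using integrable_along_line_mult[OF u mfr, of "L * norm h" 0] L by simp
  have "(LINT x|lborel. line_average G h x * \<rho> x)
      = (LINT x|lborel. (LINT t|lborel. indicator {0..1::real} t * (G (x + t *\<^sub>R h) \<bullet> h) * \<rho> x))"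
    by (simp add: line_average_def)
  also have "\<dots> = (LINT t|lborel. (LINT x|lborel. indicator {0..1::real} t * (G (x + t *\<^sub>R h) \<bullet> h) * \<rho> x))"
    by (rule lborel_pair.Fubini_integral[symmetric, OF int1])
  also have "\<dots> = (LINT t|lborel. - (LINT y|lborel. indicator {0..1::real} t * u y * frechet_derivative \<rho> (at (y - t *\<^sub>R h)) h))"
  proof (rule Bochner_Integration.integral_cong[OF refl])
    fix t :: real
    show "(LINT x|lborel. indicator {0..1::real} t * (G (x + t *\<^sub>R h) \<bullet> h) * \<rho> x)
       = - (LINT y|lborel. indicator {0..1::real} t * u y * frechet_derivative \<rho> (at (y - t *\<^sub>R h)) h)"
      using slice[of t] by (cases "t \<in> {0..1}") (auto simp: mult.assoc)
  qed
  also have "\<dots> = - (LINT y|lborel. (LINT t|lborel. indicator {0..1::real} t * u y * frechet_derivative \<rho> (at (y - t *\<^sub>R h)) h))"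
    using lborel_pair.Fubini_integral[OF int2] by simp
  also have "(LINT y|lborel. (LINT t|lborel. indicator {0..1::real} t * u y * frechet_derivative \<rho> (at (y - t *\<^sub>R h)) h))
      = (LINT y|lborel. u y * (\<rho> y - \<rho> (y - h)))"
    by (subst integral_directional_derivative[OF rho_smooth, symmetric])
      (simp add: mult.left_commute mult.assoc)
  also have "\<dots> = (LINT y|lborel. u y * \<rho> y) - (LINT y|lborel. u y * \<rho> (y - h))"
  proof -
    have "(\<lambda>y. \<rho> (y - h)) \<in> test_functions \<Omega>"
      using test_partial[OF shift[of 1] i] by (simp add: rho_shift)
    from test_integrable_mult[OF rho u] test_integrable_mult[OF this u] show ?thesis
      by (simp add: right_diff_distrib)
  qed
  also have "(LINT y|lborel. u y * \<rho> y) = - (LINT y|lborel. (G y \<bullet> i) * \<eta> y)"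
    using wg chi i unfolding weak_gradient_lborel_def \<rho>_def by blast
  also have "(LINT y|lborel. u y * \<rho> (y - h)) = - (LINT y|lborel. (G y \<bullet> i) * \<eta> (y - h))"
  proof -
    have "(LINT y|lborel. u y * partial_deriv i (\<lambda>x. \<eta> (x - h)) y) = - (LINT y|lborel. (G y \<bullet> i) * \<eta> (y - h))"
      using wg shift[of 1] i unfolding weak_gradient_lborel_def by auto
    then show ?thesis by (simp only: fun_cong[OF rho_shift])
  qed
  also have "(LINT y|lborel. (G y \<bullet> i) * \<eta> (y - h)) = (LINT x|lborel. (\<lambda>y. (G y \<bullet> i) * \<eta> (y - h)) (x + h))"
    by (rule lborel_translate(1)[symmetric]) measurable
  finally have "(LINT x|lborel. line_average G h x * \<rho> x)
     = (LINT y|lborel. (G y \<bullet> i) * \<eta> y) - (LINT x|lborel. (G (x + h) \<bullet> i) * \<eta> x)" by simp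
  moreover have "integrable lborel (\<lambda>x. (G x \<bullet> i) * \<eta> x)" by (rule test_integrable_mult[OF chi Gi])
  moreover have "integrable lborel (\<lambda>x. (G (x + h) \<bullet> i) * \<eta> x)"
    using lborel_translate(2)[of "\<lambda>x. G x \<bullet> i" h] Gi by (intro test_integrable_mult[OF chi]) auto
  ultimately show ?thesis by (simp add: \<rho>_def inner_diff_left left_diff_distrib)
qed

text \<open>
  Jensen's inequality on the unit interval, from the tangent inequality
  \<open>q m^(q - 1) a \<le> a^q + (q - 1) m^q\<close> at the mean \<open>m\<close>. The right-hand side may be infinite.
\<close>

lemma (in dual_exponents) jensen_powr:
  fixes f :: "real \<Rightarrow> real"
  assumes [measurable]: "f \<in> borel_measurable borel"
  shows "ennreal (\<bar>LINT t|lborel. indicator {0..1} t * f t\<bar> powr q)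
     \<le> (\<integral>\<^sup>+t. indicator {0..1} t * ennreal (\<bar>f t\<bar> powr q) \<partial>lborel)"
proof (cases "(\<integral>\<^sup>+t. indicator {0..1} t * ennreal (\<bar>f t\<bar> powr q) \<partial>lborel) = \<infinity>")
  case False
  have eq: "indicator {0..1} t * ennreal (\<bar>f t\<bar> powr q) = ennreal (indicator {0..1} t * \<bar>f t\<bar> powr q)" for t
    by (simp add: indicator_def)
  have iq: "integrable lborel (\<lambda>t. indicator {0..1} t * \<bar>f t\<bar> powr q)"
  proof (rule integrableI_nonneg)
    show "(\<integral>\<^sup>+t. ennreal (indicator {0..1} t * \<bar>f t\<bar> powr q) \<partial>lborel) < \<infinity>"
      using False unfolding eq by (simp only: infinity_ennreal_def top.not_eq_extremum)
  qed auto
  have i1: "integrable lborel (indicator {0..1::real} :: real \<Rightarrow> real)" by simp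
  have fi: "integrable lborel (\<lambda>t. indicator {0..1} t * \<bar>f t\<bar>)"
  proof (rule Bochner_Integration.integrable_bound[OF Bochner_Integration.integrable_add[OF i1 iq]])
    have "\<bar>f t\<bar> \<le> 1 + \<bar>f t\<bar> powr q" for t
    proof (cases "\<bar>f t\<bar> \<le> 1")
      case False
      then have "\<bar>f t\<bar> powr 1 \<le> \<bar>f t\<bar> powr q" using q2 by (intro powr_mono) auto
      then show ?thesis by simp
    qed (auto intro: add_increasing2)
    then show "AE t in lborel. norm (indicator {0..1} t * \<bar>f t\<bar>) \<le> norm (indicator {0..1} t + indicator {0..1} t * \<bar>f t\<bar> powr q)"
      by (auto simp: indicator_def)
  qed measurable
  define m where "m = (LINT t|lborel. indicator {0..1} t * \<bar>f t\<bar>)"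
  have m: "0 \<le> m" unfolding m_def by (intro integral_nonneg_AE) auto
  have tangent: "q * m powr (q - 1) * a \<le> a powr q + (q - 1) * m powr q" if a: "0 \<le> a" for a
  proof -
    have "m powr (q - 1) * a \<le> (m powr (q - 1)) powr p / p + a powr q / q"
      using a p_gt1 q_gt1 pq by (intro Youngs_inequality) auto
    also have "(m powr (q - 1)) powr p = m powr q" by (simp only: powr_powr pq)
    finally have "q * (m powr (q - 1) * a) \<le> q * (m powr q / p + a powr q / q)"
      using q2 by (intro mult_left_mono) auto
    also have "\<dots> = (q * (1 / p)) * m powr q + a powr q" using q2 by (simp add: field_simps)
    also have "q * (1 / p) = q - 1" unfolding pq(4) using q2 by (simp add: right_diff_distrib)
    finally show ?thesis by (simp add: mult.assoc)
  qed
  have "q * m powr (q - 1) * m = (LINT t|lborel. q * m powr (q - 1) * (indicator {0..1} t * \<bar>f t\<bar>))"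
    by (simp add: m_def)
  also have "\<dots> \<le> (LINT t|lborel. indicator {0..1} t * \<bar>f t\<bar> powr q + (q - 1) * m powr q * indicator {0..1} t)"
  proof (rule integral_mono)
    show "q * m powr (q - 1) * (indicator {0..1} t * \<bar>f t\<bar>) \<le> indicator {0..1} t * \<bar>f t\<bar> powr q + (q - 1) * m powr q * indicator {0..1} t" for t :: real
      using tangent[of "\<bar>f t\<bar>"] by (simp add: indicator_def)
  qed (use iq fi i1 in auto)
  also have "\<dots> = (LINT t|lborel. indicator {0..1} t * \<bar>f t\<bar> powr q) + (q - 1) * m powr q"
    using iq i1 by simp
  also have "q * m powr (q - 1) * m = q * m powr q"
    using m powr_mult_base[of m "q - 1"] by (simp add: mult_ac)
  finally have "m powr q \<le> (LINT t|lborel. indicator {0..1} t * \<bar>f t\<bar> powr q)"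
    by (simp add: algebra_simps)
  moreover have "\<bar>LINT t|lborel. indicator {0..1} t * f t\<bar> \<le> m"
    unfolding m_def using integral_abs_bound[of lborel "\<lambda>t. indicator {0..1} t * f t"] by (simp add: abs_mult)
  then have "\<bar>LINT t|lborel. indicator {0..1} t * f t\<bar> powr q \<le> m powr q" using q2 by (intro powr_mono2) auto
  ultimately have "ennreal (\<bar>LINT t|lborel. indicator {0..1} t * f t\<bar> powr q)
      \<le> ennreal (LINT t|lborel. indicator {0..1} t * \<bar>f t\<bar> powr q)"
    by (intro ennreal_leI) linarith
  also have "\<dots> = (\<integral>\<^sup>+t. indicator {0..1} t * ennreal (\<bar>f t\<bar> powr q) \<partial>lborel)"
    unfolding eq by (rule nn_integral_eq_integral[symmetric]) (use iq in auto)
  finally show ?thesis .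
qed simp

lemma (in dual_exponents) line_average_Lq:
  fixes G :: "'a::euclidean_space \<Rightarrow> 'a"
  assumes G [measurable]: "G \<in> borel_measurable borel" and Gq: "integrable lborel (\<lambda>x. norm (G x) powr q)"
  shows "integrable lborel (\<lambda>x. \<bar>line_average G h x\<bar> powr q)"
    and "(LINT x|lborel. \<bar>line_average G h x\<bar> powr q) \<le> norm h powr q * (LINT x|lborel. norm (G x) powr q)"
proof -
  have "case_prod (\<lambda>x t. indicator {0..1::real} t * (G (x + t *\<^sub>R h) \<bullet> h)) \<in> borel_measurable (borel \<Otimes>\<^sub>M borel)"
    by measurable
  then have "case_prod (\<lambda>x t. indicator {0..1::real} t * (G (x + t *\<^sub>R h) \<bullet> h)) \<in> borel_measurable (borel \<Otimes>\<^sub>M lborel)"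
    by (simp cong: measurable_cong_sets)
  from lborel.borel_measurable_lebesgue_integral[OF this]
  have [measurable]: "line_average G h \<in> borel_measurable borel" by (simp add: line_average_def[abs_def])
  define I where "I x t = (indicator {0..1::real} t * ennreal (\<bar>G (x + t *\<^sub>R h) \<bullet> h\<bar> powr q))" for x t
  have "case_prod I \<in> borel_measurable (borel \<Otimes>\<^sub>M borel)" unfolding I_def by measurable
  then have [measurable]: "case_prod I \<in> borel_measurable (lborel \<Otimes>\<^sub>M lborel)"
    by (simp cong: measurable_cong_sets)
  have "(\<integral>\<^sup>+x. ennreal (\<bar>line_average G h x\<bar> powr q) \<partial>lborel) \<le> (\<integral>\<^sup>+x. \<integral>\<^sup>+t. I x t \<partial>lborel \<partial>lborel)"
    unfolding line_average_def I_def by (intro nn_integral_mono jensen_powr) measurable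
  also have "\<dots> = (\<integral>\<^sup>+t. \<integral>\<^sup>+x. I x t \<partial>lborel \<partial>lborel)"
    by (rule lborel_pair.Fubini'[symmetric]) measurable
  also have "\<dots> \<le> (\<integral>\<^sup>+t. indicator {0..1::real} t * ennreal (norm h powr q * (LINT x|lborel. norm (G x) powr q)) \<partial>lborel)"
  proof (rule nn_integral_mono)
    fix t :: real
    have "(\<integral>\<^sup>+x. I x t \<partial>lborel) \<le> (\<integral>\<^sup>+x. indicator {0..1::real} t * ennreal (norm h powr q * norm (G (x + t *\<^sub>R h)) powr q) \<partial>lborel)"
    proof (rule nn_integral_mono)
      fix x
      have "\<bar>G (x + t *\<^sub>R h) \<bullet> h\<bar> powr q \<le> (norm h * norm (G (x + t *\<^sub>R h))) powr q"
        using Cauchy_Schwarz_ineq2[of "G (x + t *\<^sub>R h)" h] q2 by (intro powr_mono2) (auto simp: mult.commute)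
      then show "I x t \<le> indicator {0..1::real} t * ennreal (norm h powr q * norm (G (x + t *\<^sub>R h)) powr q)"
        unfolding I_def by (intro mult_left_mono ennreal_leI) (auto simp: powr_mult)
    qed
    also have "\<dots> = indicator {0..1::real} t * (\<integral>\<^sup>+x. ennreal (norm h powr q * norm (G (x + t *\<^sub>R h)) powr q) \<partial>lborel)"
      by (rule nn_integral_cmult) measurable
    also have "(\<integral>\<^sup>+x. ennreal (norm h powr q * norm (G (x + t *\<^sub>R h)) powr q) \<partial>lborel)
       = (\<integral>\<^sup>+x. ennreal (norm h powr q * norm (G x) powr q) \<partial>lborel)"
      by (rule nn_integral_lborel_translate) measurable
    also have "\<dots> = ennreal (norm h powr q * (LINT x|lborel. norm (G x) powr q))"
      using Gq by (subst nn_integral_eq_integral) auto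
    finally show "(\<integral>\<^sup>+x. I x t \<partial>lborel) \<le> indicator {0..1::real} t * ennreal (norm h powr q * (LINT x|lborel. norm (G x) powr q))" .
  qed
  also have "\<dots> = ennreal (norm h powr q * (LINT x|lborel. norm (G x) powr q))"
    by (subst nn_integral_multc) auto
  finally have nn: "(\<integral>\<^sup>+x. ennreal (\<bar>line_average G h x\<bar> powr q) \<partial>lborel) \<le> ennreal (norm h powr q * (LINT x|lborel. norm (G x) powr q))" .
  show i: "integrable lborel (\<lambda>x. \<bar>line_average G h x\<bar> powr q)"
    using nn by (intro integrableI_bounded) (auto intro: order.strict_trans1)
  have "ennreal (LINT x|lborel. \<bar>line_average G h x\<bar> powr q) \<le> ennreal (norm h powr q * (LINT x|lborel. norm (G x) powr q))"
    using nn nn_integral_eq_integral[OF i] by simp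
  then show "(LINT x|lborel. \<bar>line_average G h x\<bar> powr q) \<le> norm h powr q * (LINT x|lborel. norm (G x) powr q)"
    by (subst (asm) ennreal_le_iff) auto
qed

definition gradient :: "('a::euclidean_space \<Rightarrow> real) \<Rightarrow> 'a \<Rightarrow> 'a" where
  "gradient u x = (\<Sum>i\<in>Basis. partial_deriv i u x *\<^sub>R i)"

lemma gradient_inner: "i \<in> Basis \<Longrightarrow> gradient u x \<bullet> i = partial_deriv i u x"
  by (simp add: gradient_def inner_sum_left_Basis)

lemma gradient_measurable [measurable]: "smooth u \<Longrightarrow> gradient u \<in> borel_measurable borel"
  unfolding gradient_def using smooth_borel[OF smooth_partial] by measurable

text \<open>
  The product rule: a test function \<open>\<psi>\<close> on the whole space enters through \<open>\<theta> \<psi>\<close>, which is supported where the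
  translated weak gradient is available.
\<close>

lemma localised_average_weak_gradient:
  assumes u: "integrable lborel u" and G: "integrable lborel G"
    and wg: "weak_gradient_lborel \<Omega> u G"
    and \<theta>: "\<theta> \<in> test_functions \<Omega>"
    and shift: "\<And>t. 0 \<le> t \<Longrightarrow> t \<le> 1 \<Longrightarrow> (\<lambda>x. \<theta> (x - t *\<^sub>R h)) \<in> test_functions \<Omega>"
  shows "weak_gradient_lborel UNIV (\<lambda>x. \<theta> x * line_average G h x)
     (\<lambda>x. \<theta> x *\<^sub>R (G (x + h) - G x) + line_average G h x *\<^sub>R gradient \<theta> x)"
  unfolding weak_gradient_lborel_def
proof (intro ballI)
  fix \<psi> :: "'a \<Rightarrow> real" and i :: 'a
  assume psi: "\<psi> \<in> test_functions UNIV" and i: "i \<in> Basis"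
  have ps: "smooth \<psi>" and ts: "smooth \<theta>" using psi \<theta> by (auto intro: test_smooth)
  define D where "D = line_average G h"
  have D: "integrable lborel D" unfolding D_def by (rule integrable_line_average[OF G])
  have [measurable]: "G \<in> borel_measurable borel" using G by auto
  have chi: "(\<lambda>x. \<theta> x * \<psi> x) \<in> test_functions \<Omega>" by (rule test_mult[OF \<theta> ps])
  have chi_shift: "(\<lambda>x. \<theta> (x - t *\<^sub>R h) * \<psi> (x - t *\<^sub>R h)) \<in> test_functions \<Omega>" if "0 \<le> t" "t \<le> 1" for t
    using test_mult[OF shift[OF that] smooth_translate[OF ps, of "- (t *\<^sub>R h)"]] by simp
  have 1: "(LINT x|lborel. D x * partial_deriv i (\<lambda>x. \<theta> x * \<psi> x) x)
      = - (LINT x|lborel. ((G (x + h) - G x) \<bullet> i) * (\<theta> x * \<psi> x))"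
    unfolding D_def using line_average_weak_gradient[OF u G wg chi chi_shift i] by simp
  have pm: "partial_deriv i (\<lambda>x. \<theta> x * \<psi> x) x = \<theta> x * partial_deriv i \<psi> x + \<psi> x * partial_deriv i \<theta> x" for x
    by (rule partial_deriv_mult) (auto intro: smooth_differentiable ps ts)
  have i1: "integrable lborel (\<lambda>x. D x * (\<theta> x * partial_deriv i \<psi> x))"
    by (rule test_integrable_mult[OF test_mult[OF \<theta> smooth_partial[OF ps i]] D])
  have "integrable lborel (\<lambda>x. D x * (partial_deriv i \<theta> x * \<psi> x))"
    by (rule test_integrable_mult[OF test_mult[OF test_partial[OF \<theta> i] ps] D])
  then have i2: "integrable lborel (\<lambda>x. D x * (\<psi> x * partial_deriv i \<theta> x))" by (simp only: mult.commute[of "\<psi> _"])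
  have "integrable lborel (\<lambda>x. (G (x + h) - G x) \<bullet> i)"
    using lborel_translate(2)[of G h] G by (intro integrable_inner_left Bochner_Integration.integrable_diff) auto
  from test_integrable_mult[OF chi this]
  have i3: "integrable lborel (\<lambda>x. ((G (x + h) - G x) \<bullet> i) * (\<theta> x * \<psi> x))" .
  have "(LINT x|lborel. D x * (\<theta> x * partial_deriv i \<psi> x)) + (LINT x|lborel. D x * (\<psi> x * partial_deriv i \<theta> x))
     = - (LINT x|lborel. ((G (x + h) - G x) \<bullet> i) * (\<theta> x * \<psi> x))"
    using 1 unfolding pm distrib_left using i1 i2 by simp
  then have "(LINT x|lborel. D x * (\<theta> x * partial_deriv i \<psi> x))
     = - (LINT x|lborel. ((G (x + h) - G x) \<bullet> i) * (\<theta> x * \<psi> x) + D x * (\<psi> x * partial_deriv i \<theta> x))"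
    using i2 i3 by simp
  moreover have "((G (x + h) - G x) \<bullet> i) * (\<theta> x * \<psi> x) + D x * (\<psi> x * partial_deriv i \<theta> x)
      = ((\<theta> x *\<^sub>R (G (x + h) - G x) + D x *\<^sub>R gradient \<theta> x) \<bullet> i) * \<psi> x" for x
    using i by (simp add: inner_add_left gradient_inner algebra_simps)
  ultimately show "(LINT x|lborel. (\<theta> x * line_average G h x) * partial_deriv i \<psi> x) =
     - (LINT x|lborel. ((\<theta> x *\<^sub>R (G (x + h) - G x) + line_average G h x *\<^sub>R gradient \<theta> x) \<bullet> i) * \<psi> x)"
    unfolding D_def by (simp add: mult_ac)
qed

lemma weak_gradient_translate:
  assumes [measurable]: "u \<in> borel_measurable borel" "G \<in> borel_measurable borel"
    and wg: "weak_gradient_lborel UNIV u G"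
  shows "weak_gradient_lborel UNIV (\<lambda>x. u (x + a)) (\<lambda>x. G (x + a))"
  unfolding weak_gradient_lborel_def
proof (intro ballI)
  fix \<psi> :: "'a \<Rightarrow> real" and i :: 'a
  assume psi: "\<psi> \<in> test_functions UNIV" and i: "i \<in> Basis"
  have ps: "smooth \<psi>" using psi by (rule test_smooth)
  have [measurable]: "\<psi> \<in> borel_measurable borel" "partial_deriv i \<psi> \<in> borel_measurable borel"
    using smooth_borel[OF ps] smooth_borel[OF smooth_partial[OF ps i]] by auto
  have psi': "(\<lambda>x. \<psi> (x + - a)) \<in> test_functions UNIV" using psi by (rule test_translate) auto
  have pd: "partial_deriv i (\<lambda>x. \<psi> (x + - a)) x = partial_deriv i \<psi> (x + - a)" for x
    by (rule fun_cong[OF partial_deriv_translate[OF smooth_differentiable[OF ps]]])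
  have "(LINT x|lborel. u (x + a) * partial_deriv i \<psi> x) = (LINT x|lborel. (\<lambda>y. u y * partial_deriv i \<psi> (y + - a)) (x + a))"
    by simp
  also have "\<dots> = (LINT y|lborel. u y * partial_deriv i \<psi> (y + - a))" by (rule lborel_translate) measurable
  also have "\<dots> = - (LINT y|lborel. (G y \<bullet> i) * \<psi> (y + - a))"
    using wg psi' i unfolding weak_gradient_lborel_def pd[symmetric] by blast
  also have "(LINT y|lborel. (G y \<bullet> i) * \<psi> (y + - a)) = (LINT x|lborel. (\<lambda>y. (G y \<bullet> i) * \<psi> (y + - a)) (x + a))"
    by (rule lborel_translate(1)[symmetric]) measurable
  finally show "(LINT x|lborel. u (x + a) * partial_deriv i \<psi> x) = - (LINT x|lborel. (G (x + a) \<bullet> i) * \<psi> x)" by simp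
qed

section \<open>The difference estimate\<close>

context dual_exponents
begin

lemma weighted_young: "a * b \<le> c / 2 * a\<^sup>2 + b\<^sup>2 / (2 * c)" if "0 < c" for a b c :: real
proof -
  have "0 \<le> (c * a - b)\<^sup>2" by simp
  then have "2 * (c * (a * b)) \<le> c\<^sup>2 * a\<^sup>2 + b\<^sup>2" by (simp add: power2_diff power_mult_distrib)
  then have "(2 * (c * (a * b))) / (2 * c) \<le> (c\<^sup>2 * a\<^sup>2 + b\<^sup>2) / (2 * c)"
    using that by (intro divide_right_mono) auto
  then show ?thesis using that by (simp add: add_divide_distrib power2_eq_square)
qed

text \<open>
  Here \<open>z\<close> is the value of the cutoff, \<open>N\<close> that of the gradient of its square, \<open>D\<close> that of the
  increment of the potential, and \<open>\<eta> = |h|\<close>. The term with \<open>D N\<close> is absorbed: \<open>|s' - s| |D| / \<eta>\<close> is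
  bounded by \<open>|J s' - J s|\<close> times a square root, and the factor \<open>z\<close> in the bound for \<open>N\<close> allows half of
  the good term to pay for it.
\<close>

lemma pointwise_difference_estimate:
  fixes s s' g g' N :: "'b::euclidean_space" and z D \<Lambda> \<eta> :: real
  assumes z: "0 \<le> z" "z \<le> 1" and N: "norm N \<le> 2 * \<Lambda> * z" and \<Lambda>: "0 \<le> \<Lambda>" and \<eta>: "0 < \<eta>"
  defines "J \<equiv> radial_powr (p / 2) s" and "J' \<equiv> radial_powr (p / 2) s'"
  shows "z\<^sup>2 * (norm (J' - J))\<^sup>2 / (8 * q) \<le> (s' - s) \<bullet> (z\<^sup>2 *\<^sub>R (g' - g) + D *\<^sub>R N)
      + (2 * fenchel_gap p q s g + fenchel_gap p q s' g')
      + 32 * q * \<Lambda>\<^sup>2 * \<eta>\<^sup>2 * (2 * norm s powr p + 2 * norm s' powr p + (\<bar>D\<bar> / \<eta>) powr q)"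
proof -
  define c where "c = 1 / (4 * q)"
  have c: "0 < c" using q2 by (simp add: c_def)
  define T where "T = z * norm (J' - J)"
  define Z where "Z = (norm J' + norm J)\<^sup>2 + (\<bar>D\<bar> / \<eta>) powr q"
  have Z0: "0 \<le> Z" by (simp add: Z_def)
  have "z\<^sup>2 \<le> 1" using z by (simp add: power_le_one)
  have "z\<^sup>2 * ((norm (J' - J))\<^sup>2 * c - 2 * fenchel_gap p q s g - fenchel_gap p q s' g') \<le> z\<^sup>2 * ((s' - s) \<bullet> (g' - g))"
    using monotonicity_gap[of s' s g g'] unfolding J_def J'_def c_def by (intro mult_left_mono) auto
  moreover have "z\<^sup>2 * (2 * fenchel_gap p q s g + fenchel_gap p q s' g') \<le> 1 * (2 * fenchel_gap p q s g + fenchel_gap p q s' g')"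
    using \<open>z\<^sup>2 \<le> 1\<close> fenchel_gap_nonneg[of s g] fenchel_gap_nonneg[of s' g'] by (intro mult_right_mono) auto
  moreover have "T\<^sup>2 = z\<^sup>2 * (norm (J' - J))\<^sup>2" by (simp add: T_def power_mult_distrib)
  ultimately have 1: "c * T\<^sup>2 - (2 * fenchel_gap p q s g + fenchel_gap p q s' g') \<le> z\<^sup>2 * ((s' - s) \<bullet> (g' - g))"
    by (simp add: algebra_simps)
  have "norm (s' - s) * (\<bar>D\<bar> / \<eta>) \<le> 2 * sqrt Z * norm (J' - J)"
    using radial_powr_mult_le[of "\<bar>D\<bar> / \<eta>" J' J] \<eta> by (simp add: J_def J'_def Z_def)
  then have "(2 * \<Lambda> * z * \<eta>) * (norm (s' - s) * (\<bar>D\<bar> / \<eta>)) \<le> (2 * \<Lambda> * z * \<eta>) * (2 * sqrt Z * norm (J' - J))"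
    using z \<Lambda> \<eta> by (intro mult_left_mono) auto
  then have "norm (s' - s) * (\<bar>D\<bar> * (2 * \<Lambda> * z)) \<le> T * (4 * \<Lambda> * \<eta> * sqrt Z)"
    using \<eta> by (simp add: T_def mult_ac)
  also have "\<dots> \<le> c / 2 * T\<^sup>2 + (4 * \<Lambda> * \<eta> * sqrt Z)\<^sup>2 / (2 * c)" by (rule weighted_young[OF c])
  also have "(4 * \<Lambda> * \<eta> * sqrt Z)\<^sup>2 / (2 * c) = 32 * q * \<Lambda>\<^sup>2 * \<eta>\<^sup>2 * Z"
    using Z0 by (simp add: c_def power_mult_distrib)
  finally have 2: "norm (s' - s) * (\<bar>D\<bar> * (2 * \<Lambda> * z)) \<le> c / 2 * T\<^sup>2 + 32 * q * \<Lambda>\<^sup>2 * \<eta>\<^sup>2 * Z" .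
  have "\<bar>(s' - s) \<bullet> (D *\<^sub>R N)\<bar> \<le> norm (s' - s) * norm (D *\<^sub>R N)" by (rule Cauchy_Schwarz_ineq2)
  also have "\<dots> \<le> norm (s' - s) * (\<bar>D\<bar> * (2 * \<Lambda> * z))"
    using N by (auto intro!: mult_left_mono)
  finally have 3: "- (c / 2 * T\<^sup>2 + 32 * q * \<Lambda>\<^sup>2 * \<eta>\<^sup>2 * Z) \<le> (s' - s) \<bullet> (D *\<^sub>R N)" using 2 by linarith
  have "Z \<le> 2 * norm s powr p + 2 * norm s' powr p + (\<bar>D\<bar> / \<eta>) powr q"
    using sum_squares_bound[of "norm J'" "norm J"] norm_radial_powr_square[of s] norm_radial_powr_square[of s']
    unfolding Z_def J_def[symmetric] J'_def[symmetric] power2_sum by linarith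
  then have 4: "32 * q * \<Lambda>\<^sup>2 * \<eta>\<^sup>2 * Z \<le> 32 * q * \<Lambda>\<^sup>2 * \<eta>\<^sup>2 * (2 * norm s powr p + 2 * norm s' powr p + (\<bar>D\<bar> / \<eta>) powr q)"
    using q2 by (intro mult_left_mono) auto
  have "z\<^sup>2 * (norm (J' - J))\<^sup>2 / (8 * q) = c / 2 * T\<^sup>2" by (simp add: c_def T_def power_mult_distrib)
  moreover have "c * T\<^sup>2 = c / 2 * T\<^sup>2 + c / 2 * T\<^sup>2" by simp
  ultimately show ?thesis using 1 3 4 by (simp only: inner_add_right inner_scaleR_right)
qed

lemma integrable_localised_gradient:
  fixes k N :: "'a \<Rightarrow> 'b::euclidean_space" and c D :: "'a \<Rightarrow> real"
  assumes [measurable]: "k \<in> borel_measurable M" "N \<in> borel_measurable M" "c \<in> borel_measurable M" "D \<in> borel_measurable M"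
    and k: "integrable M (\<lambda>x. norm (k x) powr q)" and D: "integrable M (\<lambda>x. \<bar>D x\<bar> powr q)"
    and c: "\<And>x. \<bar>c x\<bar> \<le> 1" and N: "\<And>x. norm (N x) \<le> L"
  shows "integrable M (\<lambda>x. norm (c x *\<^sub>R k x + D x *\<^sub>R N x) powr q)"
proof (rule Bochner_Integration.integrable_bound)
  show "integrable M (\<lambda>x. 2 powr q * (norm (k x) powr q + L powr q * \<bar>D x\<bar> powr q))"
    using k D by auto
  have "norm (c x *\<^sub>R k x + D x *\<^sub>R N x) powr q \<le> 2 powr q * (norm (k x) powr q + L powr q * \<bar>D x\<bar> powr q)" for x
  proof -
    have L: "0 \<le> L" using order.trans[OF norm_ge_zero N] .
    have "norm (c x *\<^sub>R k x) \<le> norm (k x)" using c[of x] by (auto intro!: mult_left_le_one_le)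
    moreover have "norm (D x *\<^sub>R N x) \<le> L * \<bar>D x\<bar>"
      using mult_left_mono[OF N[of x], of "\<bar>D x\<bar>"] by (simp add: mult.commute)
    ultimately have "norm (c x *\<^sub>R k x + D x *\<^sub>R N x) \<le> norm (k x) + L * \<bar>D x\<bar>"
      by (intro order.trans[OF norm_triangle_ineq] add_mono)
    then have "norm (c x *\<^sub>R k x + D x *\<^sub>R N x) powr q \<le> (norm (k x) + L * \<bar>D x\<bar>) powr q"
      using q2 by (intro powr_mono2) auto
    also have "\<dots> \<le> 2 powr q * (norm (k x) powr q + (L * \<bar>D x\<bar>) powr q)"
      using L q2 by (intro powr_add_le) auto
    finally show ?thesis by (simp add: powr_mult)
  qed
  then show "AE x in M. norm (norm (c x *\<^sub>R k x + D x *\<^sub>R N x) powr q)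
      \<le> norm (2 powr q * (norm (k x) powr q + L powr q * \<bar>D x\<bar> powr q))"
    by (intro AE_I2) (auto intro: order.trans[OF _ abs_ge_self])
qed measurable

text \<open>
  The equation is the difference of the constraint tested with a localised increment and with its translate.
  Integrating the pointwise estimate, the gaps cost \<open>3 |h|^2\<close>, the cutoff costs \<open>O(|h|^2)\<close>, and
  the right-hand side is treated by Young's inequality after division by \<open>|h|^\<alpha>\<close> and \<open>|h|\<close>.
\<close>

lemma difference_estimate:
  fixes \<sigma> g N :: "'a::euclidean_space \<Rightarrow> 'a" and f \<zeta> D :: "'a \<Rightarrow> real" and h :: 'a
  assumes [measurable]: "\<sigma> \<in> borel_measurable borel" "g \<in> borel_measurable borel" "f \<in> borel_measurable borel"
      "\<zeta> \<in> borel_measurable borel" "D \<in> borel_measurable borel" "N \<in> borel_measurable borel"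
    and \<sigma>: "integrable lborel (\<lambda>x. norm (\<sigma> x) powr p)"
    and g: "integrable lborel (\<lambda>x. norm (g x) powr q)" "(LINT x|lborel. norm (g x) powr q) \<le> B"
    and gap: "integrable lborel (\<lambda>x. fenchel_gap p q (\<sigma> x) (g x))"
      "(LINT x|lborel. fenchel_gap p q (\<sigma> x) (g x)) \<le> (norm h)\<^sup>2"
    and \<zeta>: "\<And>x. 0 \<le> \<zeta> x" "\<And>x. \<zeta> x \<le> 1" and N: "\<And>x. norm (N x) \<le> 2 * \<Lambda> * \<zeta> x" and \<Lambda>: "0 \<le> \<Lambda>"
    and h: "h \<noteq> 0" "norm h \<le> 1" and \<alpha>: "0 < \<alpha>" "\<alpha> < 1"
    and D: "integrable lborel (\<lambda>x. \<bar>D x\<bar> powr q)"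
      "(LINT x|lborel. \<bar>D x\<bar> powr q) \<le> norm h powr q * (LINT x|lborel. norm (g x) powr q)"
    and f: "integrable lborel (\<lambda>x. \<bar>(\<zeta> x)\<^sup>2 * (f (x + h) - f x)\<bar> powr p)"
      "(LINT x|lborel. \<bar>(\<zeta> x)\<^sup>2 * (f (x + h) - f x)\<bar> powr p) \<le> F * norm h powr (\<alpha> * p)"
    and eq: "(LINT x|lborel. (\<sigma> (x + h) - \<sigma> x) \<bullet> ((\<zeta> x)\<^sup>2 *\<^sub>R (g (x + h) - g x) + D x *\<^sub>R N x))
      = (LINT x|lborel. (f (x + h) - f x) * ((\<zeta> x)\<^sup>2 * D x))"
  shows "(LINT x|lborel. (\<zeta> x)\<^sup>2 * (norm (radial_powr (p / 2) (\<sigma> (x + h)) - radial_powr (p / 2) (\<sigma> x)))\<^sup>2)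
    \<le> 8 * q * (3 + 32 * q * \<Lambda>\<^sup>2 * (4 * (LINT x|lborel. norm (\<sigma> x) powr p) + B) + F + B) * norm h powr (1 + \<alpha>)"
proof -
  define \<eta> where "\<eta> = norm h"
  have \<eta>: "0 < \<eta>" "\<eta> \<le> 1" using h by (auto simp: \<eta>_def)
  have \<eta>2: "\<eta>\<^sup>2 \<le> \<eta> powr (1 + \<alpha>)"
  proof -
    have "\<eta> powr 2 \<le> \<eta> powr (1 + \<alpha>)" using \<eta> \<alpha> by (intro powr_mono') auto
    then show ?thesis using \<eta> by simp
  qed
  define S where "S = (LINT x|lborel. norm (\<sigma> x) powr p)"
  define J where "J x = radial_powr (p / 2) (\<sigma> x)" for x
  have [measurable]: "J \<in> borel_measurable borel" unfolding J_def by measurable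
  define \<gamma> where "\<gamma> x = fenchel_gap p q (\<sigma> x) (g x)" for x
  have [measurable]: "\<gamma> \<in> borel_measurable borel" unfolding \<gamma>_def by measurable
  have \<gamma>: "integrable lborel \<gamma>" "(LINT x|lborel. \<gamma> x) \<le> \<eta>\<^sup>2" using gap by (auto simp: \<gamma>_def[abs_def] \<eta>_def)
  have \<gamma>h: "integrable lborel (\<lambda>x. \<gamma> (x + h))" "(LINT x|lborel. \<gamma> (x + h)) \<le> \<eta>\<^sup>2"
    using lborel_translate[of \<gamma> h] \<gamma> by auto
  have \<sigma>h: "integrable lborel (\<lambda>x. norm (\<sigma> (x + h)) powr p)" "(LINT x|lborel. norm (\<sigma> (x + h)) powr p) = S"
    using lborel_translate[of "\<lambda>x. norm (\<sigma> x) powr p" h] \<sigma> by (auto simp: S_def)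
  have gh: "integrable lborel (\<lambda>x. norm (g (x + h)) powr q)"
    using lborel_translate(2)[of "\<lambda>x. norm (g x) powr q" h] g by auto
  have d\<sigma>: "integrable lborel (\<lambda>x. norm (\<sigma> (x + h) - \<sigma> x) powr p)"
    by (rule integrable_powr_diff[OF _ _ \<sigma>h(1) \<sigma>]) (use p_gt1 in auto)
  have dg: "integrable lborel (\<lambda>x. norm (g (x + h) - g x) powr q)"
    by (rule integrable_powr_diff[OF _ _ gh g(1)]) (use q2 in auto)
  have Dq: "(LINT x|lborel. (\<bar>D x\<bar> / \<eta>) powr q) \<le> B" "integrable lborel (\<lambda>x. (\<bar>D x\<bar> / \<eta>) powr q)"
  proof -
    have e: "(\<bar>D x\<bar> / \<eta>) powr q = \<bar>D x\<bar> powr q / \<eta> powr q" for x using \<eta> by (simp add: powr_divide)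
    have "(LINT x|lborel. \<bar>D x\<bar> powr q) \<le> \<eta> powr q * B"
      using D(2) mult_left_mono[OF g(2), of "\<eta> powr q"] by (simp add: \<eta>_def)
    then show "(LINT x|lborel. (\<bar>D x\<bar> / \<eta>) powr q) \<le> B" unfolding e using \<eta> by (simp add: pos_divide_le_eq mult.commute)
    show "integrable lborel (\<lambda>x. (\<bar>D x\<bar> / \<eta>) powr q)" unfolding e using D(1) by simp
  qed
  define \<Phi> where "\<Phi> x = (\<zeta> x)\<^sup>2 *\<^sub>R (g (x + h) - g x) + D x *\<^sub>R N x" for x
  have [measurable]: "\<Phi> \<in> borel_measurable borel" unfolding \<Phi>_def by measurable
  have z1: "(\<zeta> x)\<^sup>2 \<le> 1" for x using \<zeta> by (simp add: power_le_one)
  have N': "norm (N x) \<le> 2 * \<Lambda>" for x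
    using N[of x] mult_left_mono[OF \<zeta>(2)[of x], of "2 * \<Lambda>"] \<Lambda> by simp
  have \<Phi>: "integrable lborel (\<lambda>x. norm (\<Phi> x) powr q)"
    unfolding \<Phi>_def by (rule integrable_localised_gradient[OF _ _ _ _ dg D(1) _ N']) (use z1 in auto)
  have inner: "integrable lborel (\<lambda>x. (\<sigma> (x + h) - \<sigma> x) \<bullet> \<Phi> x)"
    by (rule integrable_inner[OF _ _ d\<sigma> \<Phi>]) measurable
  have J: "integrable lborel (\<lambda>x. (norm (J x))\<^sup>2)" unfolding J_def norm_radial_powr_square by (rule \<sigma>)
  have Jh: "integrable lborel (\<lambda>x. (norm (J (x + h)))\<^sup>2)" unfolding J_def norm_radial_powr_square by (rule \<sigma>h)
  have dJ: "integrable lborel (\<lambda>x. (norm (J (x + h) - J x))\<^sup>2)"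
    by (intro integrable_norm_diff_square Jh J) measurable
  have zJ: "integrable lborel (\<lambda>x. (\<zeta> x)\<^sup>2 * (norm (J (x + h) - J x))\<^sup>2)"
    by (rule Bochner_Integration.integrable_bound[OF dJ]) (use z1 in \<open>auto intro!: AE_I2 mult_left_le_one_le\<close>)
  define A where "A = 32 * q * \<Lambda>\<^sup>2"
  have A: "0 \<le> A" using q2 by (simp add: A_def)
  have "(LINT x|lborel. (\<zeta> x)\<^sup>2 * (norm (J (x + h) - J x))\<^sup>2) / (8 * q)
     = (LINT x|lborel. (\<zeta> x)\<^sup>2 * (norm (J (x + h) - J x))\<^sup>2 / (8 * q))" by simp
  also have "\<dots> \<le> (LINT x|lborel. (\<sigma> (x + h) - \<sigma> x) \<bullet> \<Phi> x + (2 * \<gamma> x + \<gamma> (x + h))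
      + A * \<eta>\<^sup>2 * (2 * norm (\<sigma> x) powr p + 2 * norm (\<sigma> (x + h)) powr p + (\<bar>D x\<bar> / \<eta>) powr q))"
  proof (rule integral_mono)
    show "(\<zeta> x)\<^sup>2 * (norm (J (x + h) - J x))\<^sup>2 / (8 * q) \<le> (\<sigma> (x + h) - \<sigma> x) \<bullet> \<Phi> x + (2 * \<gamma> x + \<gamma> (x + h))
      + A * \<eta>\<^sup>2 * (2 * norm (\<sigma> x) powr p + 2 * norm (\<sigma> (x + h)) powr p + (\<bar>D x\<bar> / \<eta>) powr q)" for x
      unfolding J_def \<Phi>_def \<gamma>_def A_def
      by (rule pointwise_difference_estimate) (use \<zeta> N \<Lambda> \<eta> in auto)
  qed (use zJ inner \<gamma>(1) \<gamma>h(1) \<sigma> \<sigma>h(1) Dq(2) in auto)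
  also have "\<dots> = (LINT x|lborel. (\<sigma> (x + h) - \<sigma> x) \<bullet> \<Phi> x) + (2 * (LINT x|lborel. \<gamma> x) + (LINT x|lborel. \<gamma> (x + h)))
      + A * \<eta>\<^sup>2 * (2 * S + 2 * S + (LINT x|lborel. (\<bar>D x\<bar> / \<eta>) powr q))"
    using inner \<gamma>(1) \<gamma>h(1) \<sigma> \<sigma>h Dq(2) by (simp add: S_def)
  also have "\<dots> \<le> (LINT x|lborel. (\<sigma> (x + h) - \<sigma> x) \<bullet> \<Phi> x) + 3 * \<eta>\<^sup>2 + A * \<eta>\<^sup>2 * (4 * S + B)"
    using \<gamma>(2) \<gamma>h(2) mult_left_mono[OF Dq(1), of "A * \<eta>\<^sup>2"] A by (simp add: distrib_left)
  also have "(LINT x|lborel. (\<sigma> (x + h) - \<sigma> x) \<bullet> \<Phi> x) \<le> (F + B) * \<eta> powr (1 + \<alpha>)"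
  proof -
    define R where "R x = \<bar>(\<zeta> x)\<^sup>2 * (f (x + h) - f x)\<bar> powr p / \<eta> powr (\<alpha> * p) + (\<bar>D x\<bar> / \<eta>) powr q" for x
    have pt: "\<bar>(f (x + h) - f x) * ((\<zeta> x)\<^sup>2 * D x)\<bar> \<le> \<eta> powr (1 + \<alpha>) * R x" for x
    proof -
      define a where "a = \<bar>(\<zeta> x)\<^sup>2 * (f (x + h) - f x)\<bar> / \<eta> powr \<alpha>"
      define b where "b = \<bar>D x\<bar> / \<eta>"
      have ab: "0 \<le> a" "0 \<le> b" using \<eta> by (auto simp: a_def b_def)
      have "\<bar>(f (x + h) - f x) * ((\<zeta> x)\<^sup>2 * D x)\<bar> = \<eta> powr (1 + \<alpha>) * (a * b)"
        using \<eta> by (simp add: a_def b_def powr_add abs_mult)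
      also have "a * b \<le> a powr p + b powr q" using young_inner[of a b] ab by simp
      also have "a powr p = \<bar>(\<zeta> x)\<^sup>2 * (f (x + h) - f x)\<bar> powr p / \<eta> powr (\<alpha> * p)"
        using \<eta> by (simp add: a_def powr_divide powr_powr)
      finally show ?thesis by (simp add: R_def b_def mult_left_mono)
    qed
    have bi: "integrable lborel (\<lambda>x. \<eta> powr (1 + \<alpha>) * R x)"
      unfolding R_def using f(1) Dq(2) by auto
    have "(LINT x|lborel. (\<sigma> (x + h) - \<sigma> x) \<bullet> \<Phi> x) = (LINT x|lborel. (f (x + h) - f x) * ((\<zeta> x)\<^sup>2 * D x))"
      unfolding \<Phi>_def by (rule eq)
    also have "\<dots> \<le> (LINT x|lborel. \<eta> powr (1 + \<alpha>) * R x)"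
    proof (rule integral_mono[OF _ bi])
      show "integrable lborel (\<lambda>x. (f (x + h) - f x) * ((\<zeta> x)\<^sup>2 * D x))"
      proof (rule Bochner_Integration.integrable_bound[OF bi])
        show "AE x in lborel. norm ((f (x + h) - f x) * ((\<zeta> x)\<^sup>2 * D x)) \<le> norm (\<eta> powr (1 + \<alpha>) * R x)"
          unfolding real_norm_def by (intro AE_I2 order.trans[OF pt abs_ge_self])
      qed measurable
      show "(f (x + h) - f x) * ((\<zeta> x)\<^sup>2 * D x) \<le> \<eta> powr (1 + \<alpha>) * R x" for x
        by (rule order.trans[OF abs_ge_self pt])
    qed
    also have "\<dots> = \<eta> powr (1 + \<alpha>) * ((LINT x|lborel. \<bar>(\<zeta> x)\<^sup>2 * (f (x + h) - f x)\<bar> powr p) / \<eta> powr (\<alpha> * p) + (LINT x|lborel. (\<bar>D x\<bar> / \<eta>) powr q))"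
      unfolding R_def using f(1) Dq(2) by simp
    also have "\<dots> \<le> \<eta> powr (1 + \<alpha>) * (F + B)"
      using f(2) Dq(1) \<eta> by (intro mult_left_mono add_mono) (auto simp: \<eta>_def pos_divide_le_eq)
    finally show ?thesis by (simp add: mult.commute)
  qed
  finally have "(LINT x|lborel. (\<zeta> x)\<^sup>2 * (norm (J (x + h) - J x))\<^sup>2) / (8 * q)
     \<le> (F + B) * \<eta> powr (1 + \<alpha>) + (3 + A * (4 * S + B)) * \<eta>\<^sup>2" by (simp add: algebra_simps)
  also have "\<dots> \<le> (F + B) * \<eta> powr (1 + \<alpha>) + (3 + A * (4 * S + B)) * \<eta> powr (1 + \<alpha>)"
  proof (intro add_left_mono mult_left_mono \<eta>2)
    have "0 \<le> S" unfolding S_def by simp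
    moreover have "0 \<le> (LINT x|lborel. norm (g x) powr q)" by simp
    then have "0 \<le> B" using g(2) by linarith
    ultimately show "0 \<le> 3 + A * (4 * S + B)" using A by simp
  qed
  finally have "(LINT x|lborel. (\<zeta> x)\<^sup>2 * (norm (J (x + h) - J x))\<^sup>2) / (8 * q)
     \<le> (3 + A * (4 * S + B) + F + B) * \<eta> powr (1 + \<alpha>)" by (simp add: algebra_simps)
  then have "(LINT x|lborel. (\<zeta> x)\<^sup>2 * (norm (J (x + h) - J x))\<^sup>2)
     \<le> (3 + A * (4 * S + B) + F + B) * \<eta> powr (1 + \<alpha>) * (8 * q)"
    using q2 by (simp add: pos_divide_le_eq)
  then show ?thesis unfolding J_def A_def S_def \<eta>_def by (simp only: mult_ac)
qed

end

section \<open>Borel representatives and uniqueness of weak gradients\<close>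

lemma borel_imp_lebesgue_on:
  "f \<in> borel_measurable borel \<Longrightarrow> f \<in> borel_measurable (lebesgue_on S)"
  by (simp add: measurable_completion measurable_restrict_space1)

text \<open>
  Translations and Fubini's theorem are applied to Borel functions on the whole space. Fields on \<open>\<Omega>\<close> are
  therefore replaced by Borel functions which agree with them almost everywhere on \<open>\<Omega>\<close> and vanish
  elsewhere.
\<close>

lemma lborel_transfer:
  fixes f F :: "'a::euclidean_space \<Rightarrow> 'b::euclidean_space"
  assumes \<Omega>: "open \<Omega>"
    and f: "f \<in> borel_measurable (lebesgue_on \<Omega>)" and F: "F \<in> borel_measurable borel"
    and zero: "\<And>x. x \<notin> \<Omega> \<Longrightarrow> F x = 0" and ae: "AE x in lebesgue_on \<Omega>. f x = F x"
  shows "integral\<^sup>L (lebesgue_on \<Omega>) f = integral\<^sup>L lborel F"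
    and "integrable (lebesgue_on \<Omega>) f \<longleftrightarrow> integrable lborel F"
proof -
  note Fm = borel_imp_lebesgue_on[OF F, of \<Omega>]
  have Fi: "(\<lambda>x. indicator \<Omega> x *\<^sub>R F x) = F"
    using zero by (auto simp: fun_eq_iff indicator_def)
  have \<Omega>': "\<Omega> \<inter> space lebesgue \<in> sets lebesgue" using \<Omega> by auto
  have "integral\<^sup>L (lebesgue_on \<Omega>) f = integral\<^sup>L (lebesgue_on \<Omega>) F"
    by (rule integral_cong_AE[OF f Fm ae])
  also have "\<dots> = integral\<^sup>L lebesgue F"
    using integral_restrict_space[OF \<Omega>', of F] by (simp add: Fi)
  also have "\<dots> = integral\<^sup>L lborel F" using F by (intro integral_completion) simp
  finally show "integral\<^sup>L (lebesgue_on \<Omega>) f = integral\<^sup>L lborel F" .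
  have "integrable (lebesgue_on \<Omega>) f \<longleftrightarrow> integrable (lebesgue_on \<Omega>) F"
    by (rule integrable_cong_AE[OF f Fm ae])
  also have "\<dots> \<longleftrightarrow> integrable lebesgue F"
    using integrable_restrict_space[OF \<Omega>', of F] by (simp add: Fi)
  also have "\<dots> \<longleftrightarrow> integrable lborel F" using F by (intro integrable_completion) simp
  finally show "integrable (lebesgue_on \<Omega>) f \<longleftrightarrow> integrable lborel F" .
qed

lemma borel_representative:
  fixes u :: "'a::euclidean_space \<Rightarrow> 'b::euclidean_space"
  assumes \<Omega>: "open \<Omega>" and u: "u \<in> borel_measurable (lebesgue_on \<Omega>)"
  obtains v where "v \<in> borel_measurable borel" "\<And>x. x \<notin> \<Omega> \<Longrightarrow> v x = 0"
    "AE x in lebesgue_on \<Omega>. u x = v x"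
proof -
  have \<Omega>': "\<Omega> \<inter> space lebesgue \<in> sets lebesgue" using \<Omega> by auto
  have "\<exists>w\<in>borel_measurable lborel. AE x in lborel. indicator \<Omega> x * (u x \<bullet> i) = w x" for i
  proof -
    have "(\<lambda>x. u x \<bullet> i) \<in> borel_measurable (lebesgue_on \<Omega>)" using u by measurable
    then have "(\<lambda>x. indicator \<Omega> x * (u x \<bullet> i)) \<in> borel_measurable lebesgue"
      using borel_measurable_restrict_space_iff[OF \<Omega>', of "\<lambda>x. u x \<bullet> i"] by (simp add: mult.commute)
    then show ?thesis by (rule completion_ex_borel_measurable_real)
  qed
  then obtain w where w: "\<And>i. w i \<in> borel_measurable lborel"
    and ae: "\<And>i. AE x in lborel. indicator \<Omega> x * (u x \<bullet> i) = w i x" by metis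
  define v where "v x = indicator \<Omega> x *\<^sub>R (\<Sum>i\<in>Basis. w i x *\<^sub>R i)" for x
  have [measurable]: "w i \<in> borel_measurable borel" for i using w by simp
  have [measurable]: "\<Omega> \<in> sets borel" using \<Omega> by simp
  have "v \<in> borel_measurable borel" unfolding v_def by measurable
  moreover have "AE x in lebesgue_on \<Omega>. u x = v x"
  proof -
    have "AE x in lborel. \<forall>i\<in>(Basis::'b set). indicator \<Omega> x * (u x \<bullet> i) = w i x"
      using ae by (subst AE_ball_countable) (auto intro: countable_finite)
    then have "AE x in lborel. x \<in> \<Omega> \<longrightarrow> u x = v x"
    proof eventually_elim
      case (elim x)
      show ?case
      proof
        assume x: "x \<in> \<Omega>"
        have "u x = (\<Sum>i\<in>Basis. (u x \<bullet> i) *\<^sub>R i)" by (rule euclidean_representation[symmetric])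
        also have "\<dots> = (\<Sum>i\<in>Basis. w i x *\<^sub>R i)" using elim x by (intro sum.cong) auto
        finally show "u x = v x" using x by (simp add: v_def)
      qed
    qed
    then show ?thesis by (subst AE_restrict_space_iff[OF \<Omega>']) (rule AE_completion)
  qed
  ultimately show ?thesis using that[of v] by (auto simp: v_def)
qed

lemma Lp_spaceD:
  assumes "u \<in> Lp_space r S"
  shows "u \<in> borel_measurable (lebesgue_on S)" "integrable (lebesgue_on S) (\<lambda>x. norm (u x) powr r)"
  using assms by (auto simp: Lp_space_def)

lemma finite_measure_lebesgue_on: "bounded S \<Longrightarrow> open S \<Longrightarrow> finite_measure (lebesgue_on S)"
proof (rule finite_measureI)
  assume "bounded S" "open S"
  then show "emeasure (lebesgue_on S) (space (lebesgue_on S)) \<noteq> \<infinity>"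
    using emeasure_bounded_finite[of S] by (simp add: emeasure_restrict_space)
qed

lemma Lp_loc_1I:
  fixes u :: "'a::euclidean_space \<Rightarrow> 'b::euclidean_space"
  assumes "open \<Omega>" "integrable (lebesgue_on \<Omega>) u"
  shows "u \<in> Lp_loc 1 \<Omega>"
  unfolding Lp_loc_def Lp_space_def
proof (clarsimp, intro conjI)
  fix K assume K: "compact K" "K \<subseteq> \<Omega>"
  have "integrable (lebesgue_on K) u"
  proof -
    have 1: "K \<inter> space lebesgue \<in> sets lebesgue" "\<Omega> \<inter> space lebesgue \<in> sets lebesgue"
      using fmeasurableD[OF lmeasurable_compact[OF K(1)]] assms by auto
    have "integrable lebesgue (\<lambda>x. indicator \<Omega> x *\<^sub>R u x)"
      using assms(2) unfolding integrable_restrict_space[OF 1(2)] .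
    then have "integrable lebesgue (\<lambda>x. indicator K x *\<^sub>R indicator \<Omega> x *\<^sub>R u x)"
      using integrable_mult_indicator[of K lebesgue "\<lambda>x. indicator \<Omega> x *\<^sub>R u x"] 1 by simp
    moreover have "(\<lambda>x. indicator K x *\<^sub>R indicator \<Omega> x *\<^sub>R u x) = (\<lambda>x. indicator K x *\<^sub>R u x)"
      using K by (auto simp: indicator_def fun_eq_iff)
    ultimately show ?thesis unfolding integrable_restrict_space[OF 1(1)] by simp
  qed
  then show "u \<in> borel_measurable (lebesgue_on K)" "integrable (lebesgue_on K) (\<lambda>x. norm (u x))" by auto
qed

lemma Lp_loc_test_mult:
  fixes w :: "'a::euclidean_space \<Rightarrow> 'b::euclidean_space"
  assumes \<Omega>: "open \<Omega>" and w: "w \<in> Lp_loc 1 \<Omega>" and \<psi>: "\<psi> \<in> test_functions \<Omega>"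
  shows "integrable (lebesgue_on \<Omega>) (\<lambda>x. \<psi> x *\<^sub>R w x)"
  using \<psi>
proof (rule test_functionsE)
  fix K assume K: "smooth \<psi>" "compact K" "K \<subseteq> \<Omega>" "\<And>x. x \<notin> K \<Longrightarrow> \<psi> x = 0"
  have 1: "K \<inter> space lebesgue \<in> sets lebesgue" "\<Omega> \<inter> space lebesgue \<in> sets lebesgue"
    using fmeasurableD[OF lmeasurable_compact[OF K(2)]] \<Omega> by auto
  have "w \<in> Lp_space 1 K" using w K by (auto simp: Lp_loc_def)
  then have wK: "w \<in> borel_measurable (lebesgue_on K)" "integrable (lebesgue_on K) (\<lambda>x. norm (w x))"
    by (auto simp: Lp_space_def)
  obtain B where B: "\<And>x. \<bar>\<psi> x\<bar> \<le> B" using test_bounded[OF \<psi>] by blast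
  have [measurable]: "\<psi> \<in> borel_measurable (lebesgue_on K)"
    by (intro borel_imp_lebesgue_on smooth_borel K)
  have "integrable (lebesgue_on K) (\<lambda>x. \<psi> x *\<^sub>R w x)"
  proof (rule Bochner_Integration.integrable_bound)
    show "integrable (lebesgue_on K) (\<lambda>x. B * norm (w x))" using wK by simp
    have "norm (\<psi> x *\<^sub>R w x) \<le> norm (B * norm (w x))" for x
      using B[of x] by (auto simp: abs_mult intro!: mult_right_mono)
    then show "AE x in lebesgue_on K. norm (\<psi> x *\<^sub>R w x) \<le> norm (B * norm (w x))" by simp
  qed (use wK in measurable)
  then have "integrable lebesgue (\<lambda>x. indicator K x *\<^sub>R \<psi> x *\<^sub>R w x)"
    unfolding integrable_restrict_space[OF 1(1)] .
  moreover have "(\<lambda>x. indicator K x *\<^sub>R \<psi> x *\<^sub>R w x) = (\<lambda>x. indicator \<Omega> x *\<^sub>R \<psi> x *\<^sub>R w x)"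
    using K by (auto simp: indicator_def fun_eq_iff)
  ultimately show ?thesis unfolding integrable_restrict_space[OF 1(2)] by simp
qed

lemma open_countable_box_cover:
  fixes \<Omega> :: "'a::euclidean_space set"
  assumes "open \<Omega>"
  obtains F where "countable F" "\<And>z. z \<in> F \<Longrightarrow> cbox (fst z) (snd z) \<subseteq> \<Omega>"
    "\<Omega> \<subseteq> (\<Union>z\<in>F. box (fst z) (snd z))"
proof -
  define C where "C = {box (fst z) (snd z) | z :: 'a \<times> 'a. cbox (fst z) (snd z) \<subseteq> \<Omega>}"
  have "\<Omega> \<subseteq> \<Union>C"
  proof
    fix x assume "x \<in> \<Omega>"
    then obtain a b where "cbox a b \<subseteq> \<Omega>" "x \<in> box a b"
      using open_contains_cbox[OF assms] by metis
    then show "x \<in> \<Union>C" unfolding C_def by force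
  qed
  moreover have "\<And>S. S \<in> C \<Longrightarrow> open S" by (auto simp: C_def)
  then obtain D where D: "D \<subseteq> C" "countable D" "\<Union>D = \<Union>C" by (rule Lindelof)
  then have "\<forall>S\<in>D. \<exists>z. S = box (fst z) (snd z) \<and> cbox (fst z) (snd z) \<subseteq> \<Omega>" by (auto simp: C_def)
  then obtain s where s: "\<And>S. S \<in> D \<Longrightarrow> S = box (fst (s S)) (snd (s S)) \<and> cbox (fst (s S)) (snd (s S)) \<subseteq> \<Omega>" by metis
  show ?thesis
  proof (rule that[of "s ` D"])
    show "countable (s ` D)" using D by simp
    show "cbox (fst z) (snd z) \<subseteq> \<Omega>" if "z \<in> s ` D" for z using that s by auto
    show "\<Omega> \<subseteq> (\<Union>z\<in>s ` D. box (fst z) (snd z))"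
    proof
      fix x assume "x \<in> \<Omega>"
      then obtain S where "S \<in> D" "x \<in> S" using \<open>\<Omega> \<subseteq> \<Union>C\<close> D by blast
      then show "x \<in> (\<Union>z\<in>s ` D. box (fst z) (snd z))" using s[of S] by auto
    qed
  qed
qed

text \<open>
  Weak gradients are only locally integrable, so the fundamental lemma is applied to the difference
  multiplied by a test function; countably many box bumps suffice to cover \<open>\<Omega>\<close>.
\<close>

lemma weak_gradient_unique:
  fixes G G' :: "'a::euclidean_space \<Rightarrow> 'a"
  assumes \<Omega>: "open \<Omega>" and G: "has_weak_gradient \<Omega> \<phi> G" and G': "has_weak_gradient \<Omega> \<phi> G'"
  shows "AE x in lebesgue_on \<Omega>. G x = G' x"
proof -
  have loc: "G \<in> Lp_loc 1 \<Omega>" "G' \<in> Lp_loc 1 \<Omega>" using G G' by (auto simp: has_weak_gradient_def)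
  have \<Omega>': "\<Omega> \<inter> space lebesgue \<in> sets lebesgue" using \<Omega> by auto
  define w where "w x = G x - G' x" for x
  have key: "AE x in lebesgue_on \<Omega>. \<theta> x * (w x \<bullet> i) = 0" if \<theta>: "\<theta> \<in> test_functions \<Omega>" and i: "i \<in> Basis" for \<theta> i
  proof -
    have 1: "integrable (lebesgue_on \<Omega>) (\<lambda>x. \<eta> x *\<^sub>R G x)" "integrable (lebesgue_on \<Omega>) (\<lambda>x. \<eta> x *\<^sub>R G' x)"
      if "\<eta> \<in> test_functions \<Omega>" for \<eta>
      using Lp_loc_test_mult[OF \<Omega> loc(1) that] Lp_loc_test_mult[OF \<Omega> loc(2) that] by auto
    have 2: "integrable (lebesgue_on \<Omega>) (\<lambda>x. \<eta> x * (w x \<bullet> i))" if "\<eta> \<in> test_functions \<Omega>" for \<eta>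
    proof -
      have "integrable (lebesgue_on \<Omega>) (\<lambda>x. (\<eta> x *\<^sub>R G x - \<eta> x *\<^sub>R G' x) \<bullet> i)"
        using 1[OF that] by auto
      then show ?thesis by (simp add: w_def algebra_simps inner_diff_left)
    qed
    have zero: "(LINT x|lebesgue_on \<Omega>. \<eta> x * (w x \<bullet> i)) = 0" if "\<eta> \<in> test_functions \<Omega>" for \<eta>
    proof -
      have "(LINT x|lebesgue_on \<Omega>. (G x \<bullet> i) * \<eta> x) = (LINT x|lebesgue_on \<Omega>. (G' x \<bullet> i) * \<eta> x)"
      proof -
        have wg: "(LINT x|lebesgue_on \<Omega>. \<phi> x * partial_deriv i \<eta> x) = - (LINT x|lebesgue_on \<Omega>. (H x \<bullet> i) * \<eta> x)"
          if "has_weak_gradient \<Omega> \<phi> H" for H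
          using that \<open>\<eta> \<in> test_functions \<Omega>\<close> i unfolding has_weak_gradient_def by blast
        from wg[OF G] wg[OF G'] show ?thesis by linarith
      qed
      moreover have "integrable (lebesgue_on \<Omega>) (\<lambda>x. (G x \<bullet> i) * \<eta> x)" "integrable (lebesgue_on \<Omega>) (\<lambda>x. (G' x \<bullet> i) * \<eta> x)"
        using integrable_inner_left[OF 1(1)[OF that], of i] integrable_inner_left[OF 1(2)[OF that], of i]
        by (auto simp: mult.commute)
      ultimately have "(LINT x|lebesgue_on \<Omega>. (G x \<bullet> i) * \<eta> x - (G' x \<bullet> i) * \<eta> x) = 0" by simp
      then show ?thesis by (simp add: w_def inner_diff_left algebra_simps)
    qed
    define f where "f x = \<theta> x * (w x \<bullet> i)" for x
    have f: "integrable (lebesgue_on \<Omega>) f" unfolding f_def by (rule 2[OF \<theta>])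
    then have fm: "f \<in> borel_measurable (lebesgue_on \<Omega>)" by auto
    obtain v where v: "v \<in> borel_measurable borel" "\<And>x. x \<notin> \<Omega> \<Longrightarrow> v x = 0" "AE x in lebesgue_on \<Omega>. f x = v x"
      using borel_representative[OF \<Omega> fm] by blast
    have "AE x in lborel. v x = 0"
    proof (rule fundamental_lemma)
      show "integrable lborel v" using f lborel_transfer(2)[OF \<Omega> fm v] by simp
      fix \<psi> :: "'a \<Rightarrow> real" assume psi: "\<psi> \<in> test_functions UNIV"
      have "\<psi> \<in> borel_measurable borel" by (rule smooth_borel[OF test_smooth[OF psi]])
      have "(LINT x|lebesgue_on \<Omega>. f x * \<psi> x) = (LINT x|lborel. v x * \<psi> x)"
      proof (rule lborel_transfer(1)[OF \<Omega>])
        show "(\<lambda>x. f x * \<psi> x) \<in> borel_measurable (lebesgue_on \<Omega>)"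
          by (intro borel_measurable_times fm borel_imp_lebesgue_on) fact
        show "(\<lambda>x. v x * \<psi> x) \<in> borel_measurable borel"
          by (intro borel_measurable_times v(1)) fact
        show "AE x in lebesgue_on \<Omega>. f x * \<psi> x = v x * \<psi> x" using v(3) by eventually_elim simp
        show "v x * \<psi> x = 0" if "x \<notin> \<Omega>" for x using v(2)[OF that] by simp
      qed
      moreover have "(LINT x|lebesgue_on \<Omega>. f x * \<psi> x) = 0"
        using zero[OF test_mult[OF \<theta> test_smooth[OF psi]]] by (simp add: f_def mult_ac)
      ultimately show "(LINT x|lborel. v x * \<psi> x) = 0" by simp
    qed
    then have "AE x in lebesgue. x \<in> \<Omega> \<longrightarrow> v x = 0" by (auto intro: AE_completion)
    then have "AE x in lebesgue_on \<Omega>. v x = 0" by (subst AE_restrict_space_iff[OF \<Omega>'])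
    with v(3) show ?thesis by eventually_elim (simp add: f_def)
  qed
  obtain F :: "('a \<times> 'a) set" where F: "countable F" "\<And>z. z \<in> F \<Longrightarrow> cbox (fst z) (snd z) \<subseteq> \<Omega>"
    "\<Omega> \<subseteq> (\<Union>z\<in>F. box (fst z) (snd z))" using open_countable_box_cover[OF \<Omega>] by blast
  have "AE x in lebesgue_on \<Omega>. \<forall>z\<in>F. \<forall>i\<in>Basis. box_bump 1 (fst z) (snd z) x * (w x \<bullet> i) = 0"
  proof -
    have "AE x in lebesgue_on \<Omega>. \<forall>i\<in>Basis. box_bump 1 (fst z) (snd z) x * (w x \<bullet> i) = 0" if "z \<in> F" for z
      unfolding AE_ball_countable[OF countable_finite[OF finite_Basis]]
      by (intro ballI key box_bump_test(1)[OF _ F(2)[OF that]]) simp_all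
    then show ?thesis unfolding AE_ball_countable[OF F(1)] by blast
  qed
  moreover have "AE x in lebesgue_on \<Omega>. x \<in> \<Omega>" by (rule AE_I2) simp
  ultimately show ?thesis
  proof eventually_elim
    case (elim x)
    then obtain z where z: "z \<in> F" "x \<in> box (fst z) (snd z)" using F(3) by blast
    then have "box_bump 1 (fst z) (snd z) x \<noteq> 0" using box_bump_pos[of 1 x "fst z" "snd z"] by simp
    have wi: "w x \<bullet> i = 0" if "i \<in> Basis" for i
    proof -
      have "box_bump 1 (fst z) (snd z) x * (w x \<bullet> i) = 0" using elim z that by blast
      then show ?thesis using \<open>box_bump 1 (fst z) (snd z) x \<noteq> 0\<close> by simp
    qed
    have "w x = 0" by (rule euclidean_eqI) (simp add: wi)
    then show "G x = G' x" by (simp add: w_def)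
  qed
qed

text \<open>
  The space \<open>X\<close> to which the duality theorem is applied.
\<close>

definition Lq_gradients :: "real \<Rightarrow> 'a::euclidean_space set \<Rightarrow> ('a \<Rightarrow> 'a) set" where
  "Lq_gradients q \<Omega> = {G \<in> Lp_space q \<Omega>. \<exists>\<phi>\<in>Lp_space q \<Omega>. has_weak_gradient \<Omega> \<phi> G}"

context dual_exponents
begin

lemma Lp_space_lincomb:
  fixes u v :: "'a::euclidean_space \<Rightarrow> 'b::euclidean_space"
  assumes "u \<in> Lp_space q S" "v \<in> Lp_space q S"
  shows "(\<lambda>x. a *\<^sub>R u x + b *\<^sub>R v x) \<in> Lp_space q S"
proof -
  note u = Lp_spaceD[OF assms(1)] and v = Lp_spaceD[OF assms(2)]
  have [measurable]: "u \<in> borel_measurable (lebesgue_on S)" "v \<in> borel_measurable (lebesgue_on S)"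
    using u v by auto
  have 1: "integrable (lebesgue_on S) (\<lambda>x. norm (a *\<^sub>R u x) powr q)"
    "integrable (lebesgue_on S) (\<lambda>x. norm (- b *\<^sub>R v x) powr q)"
    using u v by (simp_all add: powr_mult)
  have "integrable (lebesgue_on S) (\<lambda>x. norm (a *\<^sub>R u x - (- b *\<^sub>R v x)) powr q)"
    by (rule integrable_powr_diff[OF _ _ 1]) (use q2 in auto)
  then show ?thesis by (simp add: Lp_space_def)
qed

lemma Lq_gradients_lincomb:
  fixes G G' :: "'a::euclidean_space \<Rightarrow> 'a"
  assumes \<Omega>: "open \<Omega>" "bounded \<Omega>" and G: "G \<in> Lq_gradients q \<Omega>" and G': "G' \<in> Lq_gradients q \<Omega>"
  shows "(\<lambda>x. a *\<^sub>R G x + b *\<^sub>R G' x) \<in> Lq_gradients q \<Omega>"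
proof -
  obtain u u' where u: "u \<in> Lp_space q \<Omega>" "has_weak_gradient \<Omega> u G"
    and u': "u' \<in> Lp_space q \<Omega>" "has_weak_gradient \<Omega> u' G'"
    using G G' by (auto simp: Lq_gradients_def)
  have Gq: "G \<in> Lp_space q \<Omega>" "G' \<in> Lp_space q \<Omega>" using G G' by (auto simp: Lq_gradients_def)
  have L1: "integrable (lebesgue_on \<Omega>) k" if "k \<in> Lp_space q \<Omega>" for k :: "'a \<Rightarrow> 'c::euclidean_space"
    using that q2 by (intro integrable_of_powr[OF finite_measure_lebesgue_on[OF \<Omega>(2,1)], of k q]) (auto simp: Lp_space_def)
  define U where "U x = a * u x + b * u' x" for x
  define W where "W x = a *\<^sub>R G x + b *\<^sub>R G' x" for x
  have UW: "U \<in> Lp_space q \<Omega>" "W \<in> Lp_space q \<Omega>"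
    using Lp_space_lincomb[OF u(1) u'(1), of a b] Lp_space_lincomb[OF Gq, of a b] by (simp_all add: U_def[abs_def] W_def[abs_def])
  have "has_weak_gradient \<Omega> U W"
    unfolding has_weak_gradient_def
  proof (intro conjI ballI)
    show "U \<in> Lp_loc 1 \<Omega>" "W \<in> Lp_loc 1 \<Omega>" using L1 UW Lp_loc_1I[OF \<Omega>(1)] by blast+
    fix \<psi> :: "'a \<Rightarrow> real" and i :: 'a assume psi: "\<psi> \<in> test_functions \<Omega>" and i: "i \<in> Basis"
    have I: "integrable (lebesgue_on \<Omega>) (\<lambda>x. k x * \<eta> x)" if "integrable (lebesgue_on \<Omega>) k" "\<eta> \<in> test_functions \<Omega>" for k \<eta> :: "'a \<Rightarrow> real"
      using Lp_loc_test_mult[OF \<Omega>(1) Lp_loc_1I[OF \<Omega>(1) that(1)] that(2)] by (simp add: mult.commute)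
    note dpsi = test_partial[OF psi i]
    have "(LINT x|lebesgue_on \<Omega>. U x * partial_deriv i \<psi> x)
       = (LINT x|lebesgue_on \<Omega>. a * (u x * partial_deriv i \<psi> x) + b * (u' x * partial_deriv i \<psi> x))"
      by (simp add: U_def algebra_simps)
    also have "\<dots> = a * (LINT x|lebesgue_on \<Omega>. u x * partial_deriv i \<psi> x) + b * (LINT x|lebesgue_on \<Omega>. u' x * partial_deriv i \<psi> x)"
      using I[OF L1[OF u(1)] dpsi] I[OF L1[OF u'(1)] dpsi] by simp
    also have "\<dots> = - (a * (LINT x|lebesgue_on \<Omega>. (G x \<bullet> i) * \<psi> x) + b * (LINT x|lebesgue_on \<Omega>. (G' x \<bullet> i) * \<psi> x))"
      using u(2) u'(2) psi i by (simp add: has_weak_gradient_def)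
    also have "a * (LINT x|lebesgue_on \<Omega>. (G x \<bullet> i) * \<psi> x) + b * (LINT x|lebesgue_on \<Omega>. (G' x \<bullet> i) * \<psi> x)
       = (LINT x|lebesgue_on \<Omega>. a * ((G x \<bullet> i) * \<psi> x) + b * ((G' x \<bullet> i) * \<psi> x))"
      using I[OF integrable_inner_left[OF L1[OF Gq(1)]] psi, of i] I[OF integrable_inner_left[OF L1[OF Gq(2)]] psi, of i] by simp
    also have "\<dots> = (LINT x|lebesgue_on \<Omega>. (W x \<bullet> i) * \<psi> x)"
      by (simp add: W_def inner_add_left algebra_simps)
    finally show "(LINT x|lebesgue_on \<Omega>. U x * partial_deriv i \<psi> x) = - (LINT x|lebesgue_on \<Omega>. (W x \<bullet> i) * \<psi> x)" .
  qed
  then show ?thesis using UW unfolding Lq_gradients_def W_def[symmetric] by blast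
qed

text \<open>
  A field in \<open>L\<^sup>p\<close> orthogonal to \<open>Lq_gradients\<close> may be added to the minimiser without violating the constraint. The
  constraint is tested with every weak gradient of a function in \<open>W\<^sup>1\<^sup>,\<^sup>q\<close>; by uniqueness each of them agrees
  almost everywhere with one in \<open>L\<^sup>q\<close>.
\<close>

lemma minimiser_gap_vanishes:
  fixes s :: "'a::euclidean_space \<Rightarrow> 'a"
  assumes \<Omega>: "open \<Omega>" "bounded \<Omega>"
    and min: "is_arg_min (congestion_cost p \<Omega>) (admissible p q \<Omega> f) s" and e: "0 < e"
  shows "\<exists>G\<in>Lq_gradients q \<Omega>. (LINT x|lebesgue_on \<Omega>. fenchel_gap p q (s x) (G x)) \<le> e"
proof (rule dual_gap_vanishes[OF finite_measure_lebesgue_on[OF \<Omega>(2,1)] _ _ _ _ _ _ _ e])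
  have adm: "admissible p q \<Omega> f s" using min by (simp add: is_arg_min_def)
  show "s \<in> borel_measurable (lebesgue_on \<Omega>)" "integrable (lebesgue_on \<Omega>) (\<lambda>x. norm (s x) powr p)"
    using adm by (auto simp: admissible_def Lp_space_def)
  show "G \<in> borel_measurable (lebesgue_on \<Omega>)" "integrable (lebesgue_on \<Omega>) (\<lambda>x. norm (G x) powr q)"
    if "G \<in> Lq_gradients q \<Omega>" for G using that by (auto simp: Lq_gradients_def Lp_space_def)
  have "has_weak_gradient \<Omega> (\<lambda>x. 0) (\<lambda>x. 0)"
    using Lp_loc_1I[OF \<Omega>(1), of "\<lambda>x. 0::real"] Lp_loc_1I[OF \<Omega>(1), of "\<lambda>x. 0::'a"]
    by (simp add: has_weak_gradient_def)
  moreover have "(\<lambda>x. 0::real) \<in> Lp_space q \<Omega>" "(\<lambda>x. 0::'a) \<in> Lp_space q \<Omega>" by (auto simp: Lp_space_def)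
  ultimately show "Lq_gradients q \<Omega> \<noteq> {}" unfolding Lq_gradients_def by blast
  show "(\<lambda>x. a *\<^sub>R G x + b *\<^sub>R k x) \<in> Lq_gradients q \<Omega>"
    if "G \<in> Lq_gradients q \<Omega>" "k \<in> Lq_gradients q \<Omega>" for G k a b
    by (rule Lq_gradients_lincomb[OF \<Omega> that])
  fix t :: "'a \<Rightarrow> 'a"
  assume t: "t \<in> borel_measurable (lebesgue_on \<Omega>)" "integrable (lebesgue_on \<Omega>) (\<lambda>x. norm (t x) powr p)"
    and orth: "\<And>G. G \<in> Lq_gradients q \<Omega> \<Longrightarrow> (LINT x|lebesgue_on \<Omega>. t x \<bullet> G x) = (LINT x|lebesgue_on \<Omega>. s x \<bullet> G x)"
  have "admissible p q \<Omega> f t"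
    unfolding admissible_def
  proof (intro conjI ballI allI impI)
    show "t \<in> Lp_space p \<Omega>" using t by (simp add: Lp_space_def)
    fix \<phi> G assume \<phi>: "\<phi> \<in> W1_space q \<Omega>" and G: "has_weak_gradient \<Omega> \<phi> G"
    then obtain G' where G': "G' \<in> Lp_space q \<Omega>" "has_weak_gradient \<Omega> \<phi> G'" and phi: "\<phi> \<in> Lp_space q \<Omega>"
      by (auto simp: W1_space_def)
    have ae: "AE x in lebesgue_on \<Omega>. G' x = G x" by (rule weak_gradient_unique[OF \<Omega>(1) G'(2) G])
    have G'm: "G' \<in> borel_measurable (lebesgue_on \<Omega>)" using G' by (simp add: Lp_space_def)
    have Gm: "G \<in> borel_measurable (lebesgue_on \<Omega>)"
    proof -
      have \<Omega>': "\<Omega> \<inter> space lebesgue \<in> sets lebesgue" using \<Omega> by auto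
      have "(\<lambda>x. indicator \<Omega> x *\<^sub>R G' x) \<in> borel_measurable lebesgue"
        using G'm borel_measurable_restrict_space_iff[OF \<Omega>'] by blast
      moreover have "AE x in lebesgue. indicator \<Omega> x *\<^sub>R G' x = indicator \<Omega> x *\<^sub>R G x"
        using ae unfolding AE_restrict_space_iff[OF \<Omega>'] by eventually_elim (auto simp: indicator_def)
      ultimately have "(\<lambda>x. indicator \<Omega> x *\<^sub>R G x) \<in> borel_measurable lebesgue" by (rule borel_measurable_AE)
      then show ?thesis using borel_measurable_restrict_space_iff[OF \<Omega>'] by blast
    qed
    have "G' \<in> Lq_gradients q \<Omega>" using G' phi by (auto simp: Lq_gradients_def)
    then have "(LINT x|lebesgue_on \<Omega>. t x \<bullet> G' x) = (LINT x|lebesgue_on \<Omega>. s x \<bullet> G' x)" by (rule orth)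
    also have "\<dots> = (LINT x|lebesgue_on \<Omega>. f x * \<phi> x)"
      using adm \<phi> G' by (auto simp: admissible_def)
    also have "(LINT x|lebesgue_on \<Omega>. t x \<bullet> G' x) = (LINT x|lebesgue_on \<Omega>. t x \<bullet> G x)"
      by (rule integral_cong_AE) (use t Gm G'm ae in auto)
    finally show "(LINT x|lebesgue_on \<Omega>. t x \<bullet> G x) = (LINT x|lebesgue_on \<Omega>. f x * \<phi> x)" .
  qed
  then have "congestion_cost p \<Omega> s \<le> congestion_cost p \<Omega> t" using min by (auto simp: is_arg_min_def not_less)
  then show "(LINT x|lebesgue_on \<Omega>. field_cost p (s x)) \<le> (LINT x|lebesgue_on \<Omega>. field_cost p (t x))"
    by (simp add: congestion_cost_def field_cost_def)
qed

end

section \<open>Local regularity of the minimiser\<close>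

lemma lborel_AE_translate:
  fixes P :: "'a::euclidean_space \<Rightarrow> bool"
  assumes "AE x in lborel. P x"
  shows "AE x in lborel. P (x + h)"
proof -
  obtain N where N: "{x \<in> space lborel. \<not> P x} \<subseteq> N" "emeasure lborel N = 0" "N \<in> sets lborel"
    using assms by (rule AE_E)
  have [measurable]: "N \<in> sets borel" using N(3) by simp
  have "(\<integral>\<^sup>+x. indicator N (x + h) \<partial>lborel) = (\<integral>\<^sup>+x. indicator N x \<partial>lborel)"
    by (rule nn_integral_lborel_translate) measurable
  also have "\<dots> = 0" using N by simp
  finally have "AE x in lborel. indicator N (x + h) = (0::ennreal)"
    by (subst (asm) nn_integral_0_iff_AE) auto
  then show ?thesis
  proof eventually_elim
    case (elim x)
    then show ?case using N(1) by (auto simp: indicator_def split: if_splits)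
  qed
qed

lemma norm_gradient_le:
  fixes L :: real
  assumes L: "\<And>x h. \<bar>frechet_derivative \<zeta> (at x) h\<bar> \<le> L * norm h"
  shows "norm (gradient \<zeta> (x::'a::euclidean_space)) \<le> DIM('a) * L"
proof -
  have "norm (gradient \<zeta> x) \<le> (\<Sum>i\<in>Basis. \<bar>gradient \<zeta> x \<bullet> i\<bar>)" by (rule norm_le_l1)
  also have "\<dots> \<le> (\<Sum>i\<in>(Basis::'a set). L)"
  proof (rule sum_mono)
    fix i :: 'a assume "i \<in> Basis"
    then show "\<bar>gradient \<zeta> x \<bullet> i\<bar> \<le> L" using L[of x i] by (simp add: gradient_inner)
  qed
  finally show ?thesis by simp
qed

lemma gradient_square:
  assumes "smooth \<zeta>"
  shows "gradient (\<lambda>x. \<zeta> x * \<zeta> x) x = (2 * \<zeta> x) *\<^sub>R gradient \<zeta> x"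
proof -
  have d: "\<zeta> differentiable (at x)" using assms by (rule smooth_differentiable)
  show ?thesis
  proof (rule euclidean_eqI)
    fix i :: 'a assume i: "i \<in> Basis"
    have "partial_deriv i (\<lambda>x. \<zeta> x * \<zeta> x) x = \<zeta> x * partial_deriv i \<zeta> x + \<zeta> x * partial_deriv i \<zeta> x"
      by (rule partial_deriv_mult[OF d d])
    then show "gradient (\<lambda>x. \<zeta> x * \<zeta> x) x \<bullet> i = ((2 * \<zeta> x) *\<^sub>R gradient \<zeta> x) \<bullet> i"
      by (simp add: gradient_inner[OF i])
  qed
qed

text \<open>
  Reads off the bound on increments for a Borel representative. Translation preserves null sets, so the
  increments of the two representatives agree almost everywhere.
\<close>

lemma Besov_difference_bound:
  fixes v V :: "'a::euclidean_space \<Rightarrow> real"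
  assumes v: "v \<in> Besov_infty \<alpha> m" and m: "0 < m"
    and V: "V \<in> borel_measurable borel" and ae: "AE x in lborel. v x = V x"
  obtains F where "0 \<le> F" "\<And>h. h \<noteq> 0 \<Longrightarrow> (LINT x|lborel. \<bar>V (x + h) - V x\<bar> powr m) \<le> F * norm h powr (\<alpha> * m)"
proof -
  have [measurable]: "V \<in> borel_measurable borel" by (rule V)
  define Q where "Q h = (LINT x|lebesgue. \<bar>v (x + h) - v x\<bar> powr m / norm h powr (\<alpha> * m))" for h
  have "bdd_above ((\<lambda>h. Q h powr (1 / m)) ` (UNIV - {0}))" using v by (simp add: Besov_infty_def Q_def)
  then obtain B where B: "\<And>h. h \<noteq> 0 \<Longrightarrow> Q h powr (1 / m) \<le> B" by (auto simp: bdd_above_def)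
  have bound: "(LINT x|lborel. \<bar>V (x + h) - V x\<bar> powr m) \<le> max 0 B powr m * norm h powr (\<alpha> * m)" if h: "h \<noteq> 0" for h
  proof -
    have e: "AE x in lborel. \<bar>V (x + h) - V x\<bar> powr m / norm h powr (\<alpha> * m) = \<bar>v (x + h) - v x\<bar> powr m / norm h powr (\<alpha> * m)"
      using ae lborel_AE_translate[OF ae, of h] by eventually_elim simp
    have bm: "(\<lambda>x. \<bar>V (x + h) - V x\<bar> powr m / norm h powr (\<alpha> * m)) \<in> borel_measurable borel" by measurable
    then have lm: "(\<lambda>x. \<bar>V (x + h) - V x\<bar> powr m / norm h powr (\<alpha> * m)) \<in> borel_measurable lebesgue"
      by (intro measurable_completion) simp
    have "Q h = (LINT x|lebesgue. \<bar>V (x + h) - V x\<bar> powr m / norm h powr (\<alpha> * m))"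
      unfolding Q_def
    proof (rule integral_cong_AE)
      show "(\<lambda>x. \<bar>v (x + h) - v x\<bar> powr m / norm h powr (\<alpha> * m)) \<in> borel_measurable lebesgue"
        by (rule borel_measurable_AE[OF lm AE_completion[OF e]])
      show "AE x in lebesgue. \<bar>v (x + h) - v x\<bar> powr m / norm h powr (\<alpha> * m) = \<bar>V (x + h) - V x\<bar> powr m / norm h powr (\<alpha> * m)"
        using AE_completion[OF e] by eventually_elim (rule sym)
    qed (rule lm)
    also have "\<dots> = (LINT x|lborel. \<bar>V (x + h) - V x\<bar> powr m / norm h powr (\<alpha> * m))"
      using bm by (intro integral_completion) simp
    also have "\<dots> = (LINT x|lborel. \<bar>V (x + h) - V x\<bar> powr m) / norm h powr (\<alpha> * m)" by simp
    finally have Q: "Q h = (LINT x|lborel. \<bar>V (x + h) - V x\<bar> powr m) / norm h powr (\<alpha> * m)" .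
    then have Q0: "0 \<le> Q h" by simp
    have "Q h = (Q h powr (1 / m)) powr m" using Q0 m by (simp add: powr_powr)
    also have "\<dots> \<le> max 0 B powr m" using B[OF h] m by (intro powr_mono2) auto
    finally show ?thesis unfolding Q using h by (simp add: pos_divide_le_eq)
  qed
  show ?thesis by (rule that[OF _ bound]) auto
qed

context dual_exponents
begin

text \<open>
  A function on the whole space that vanishes outside \<open>\<Omega>\<close> is an admissible test function in the constraint.
\<close>

lemma tested_equation:
  fixes s \<sigma> \<Phi> :: "'a::euclidean_space \<Rightarrow> 'a" and f F \<phi> :: "'a \<Rightarrow> real"
  assumes \<Omega>: "open \<Omega>" "bounded \<Omega>" and adm: "admissible p q \<Omega> f s"
    and \<sigma>: "\<sigma> \<in> borel_measurable borel" "\<And>x. x \<notin> \<Omega> \<Longrightarrow> \<sigma> x = 0" "AE x in lebesgue_on \<Omega>. s x = \<sigma> x"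
    and f: "f \<in> borel_measurable (lebesgue_on \<Omega>)"
    and F: "F \<in> borel_measurable borel" "\<And>x. x \<notin> \<Omega> \<Longrightarrow> F x = 0" "AE x in lebesgue_on \<Omega>. f x = F x"
    and \<phi>: "\<phi> \<in> borel_measurable borel" "integrable lborel (\<lambda>x. \<bar>\<phi> x\<bar> powr q)" "\<And>x. x \<notin> \<Omega> \<Longrightarrow> \<phi> x = 0"
    and \<Phi>: "\<Phi> \<in> borel_measurable borel" "integrable lborel (\<lambda>x. norm (\<Phi> x) powr q)" "\<And>x. x \<notin> \<Omega> \<Longrightarrow> \<Phi> x = 0"
    and wg: "weak_gradient_lborel UNIV \<phi> \<Phi>"
  shows "(LINT x|lborel. \<sigma> x \<bullet> \<Phi> x) = (LINT x|lborel. F x * \<phi> x)"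
proof -
  have refl: "AE x in lebesgue_on \<Omega>. k x = k x" for k :: "'a \<Rightarrow> 'c" by simp
  have Lp: "\<phi> \<in> Lp_space q \<Omega>"
  proof -
    have "integrable (lebesgue_on \<Omega>) (\<lambda>x. norm (\<phi> x) powr q) \<longleftrightarrow> integrable lborel (\<lambda>x. norm (\<phi> x) powr q)"
      using \<phi> by (intro lborel_transfer(2)[OF \<Omega>(1)] borel_imp_lebesgue_on) auto
    then show ?thesis using \<phi> by (auto simp: Lp_space_def intro: borel_imp_lebesgue_on)
  qed
  have LP: "\<Phi> \<in> Lp_space q \<Omega>"
  proof -
    have "integrable (lebesgue_on \<Omega>) (\<lambda>x. norm (\<Phi> x) powr q) \<longleftrightarrow> integrable lborel (\<lambda>x. norm (\<Phi> x) powr q)"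
      using \<Phi> by (intro lborel_transfer(2)[OF \<Omega>(1)] borel_imp_lebesgue_on) auto
    then show ?thesis using \<Phi> by (auto simp: Lp_space_def intro: borel_imp_lebesgue_on)
  qed
  have wgO: "has_weak_gradient \<Omega> \<phi> \<Phi>"
    unfolding has_weak_gradient_def
  proof (intro conjI ballI)
    note fm = finite_measure_lebesgue_on[OF \<Omega>(2,1)]
    show "\<phi> \<in> Lp_loc 1 \<Omega>"
      by (rule Lp_loc_1I[OF \<Omega>(1) integrable_of_powr[OF fm Lp_spaceD(1)[OF Lp] _ Lp_spaceD(2)[OF Lp]]]) (use q2 in simp)
    show "\<Phi> \<in> Lp_loc 1 \<Omega>"
      by (rule Lp_loc_1I[OF \<Omega>(1) integrable_of_powr[OF fm Lp_spaceD(1)[OF LP] _ Lp_spaceD(2)[OF LP]]]) (use q2 in simp)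
    fix \<psi> :: "'a \<Rightarrow> real" and i :: 'a assume psi: "\<psi> \<in> test_functions \<Omega>" and i: "i \<in> Basis"
    have m: "\<psi> \<in> borel_measurable borel" "partial_deriv i \<psi> \<in> borel_measurable borel"
      using smooth_borel[OF test_smooth[OF psi]] smooth_borel[OF smooth_partial[OF test_smooth[OF psi] i]] by auto
    have m1: "(\<lambda>x. \<phi> x * partial_deriv i \<psi> x) \<in> borel_measurable borel"
      using \<phi>(1) m(2) by (rule borel_measurable_times)
    have m2: "(\<lambda>x. (\<Phi> x \<bullet> i) * \<psi> x) \<in> borel_measurable borel"
      using \<Phi>(1) m(1) by (intro borel_measurable_times borel_measurable_inner) auto
    have "(LINT x|lebesgue_on \<Omega>. \<phi> x * partial_deriv i \<psi> x) = (LINT x|lborel. \<phi> x * partial_deriv i \<psi> x)"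
      by (rule lborel_transfer(1)[OF \<Omega>(1) borel_imp_lebesgue_on[OF m1] m1 _ refl]) (simp add: \<phi>(3))
    also have "\<dots> = - (LINT x|lborel. (\<Phi> x \<bullet> i) * \<psi> x)"
      using wg i test_mono[OF psi subset_UNIV] unfolding weak_gradient_lborel_def by blast
    also have "(LINT x|lborel. (\<Phi> x \<bullet> i) * \<psi> x) = (LINT x|lebesgue_on \<Omega>. (\<Phi> x \<bullet> i) * \<psi> x)"
      by (rule lborel_transfer(1)[OF \<Omega>(1) borel_imp_lebesgue_on[OF m2] m2 _ refl, symmetric]) (simp add: \<Phi>(3))
    finally show "(LINT x|lebesgue_on \<Omega>. \<phi> x * partial_deriv i \<psi> x) = - (LINT x|lebesgue_on \<Omega>. (\<Phi> x \<bullet> i) * \<psi> x)" .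
  qed
  have "\<phi> \<in> W1_space q \<Omega>" using Lp LP wgO by (auto simp: W1_space_def)
  then have eq: "(LINT x|lebesgue_on \<Omega>. s x \<bullet> \<Phi> x) = (LINT x|lebesgue_on \<Omega>. f x * \<phi> x)"
    using adm wgO by (auto simp: admissible_def)
  have sm: "s \<in> borel_measurable (lebesgue_on \<Omega>)" using adm by (simp add: admissible_def Lp_space_def)
  have 1: "(LINT x|lebesgue_on \<Omega>. s x \<bullet> \<Phi> x) = (LINT x|lborel. \<sigma> x \<bullet> \<Phi> x)"
  proof (rule lborel_transfer(1)[OF \<Omega>(1)])
    show "(\<lambda>x. s x \<bullet> \<Phi> x) \<in> borel_measurable (lebesgue_on \<Omega>)"
      by (intro borel_measurable_inner sm borel_imp_lebesgue_on \<Phi>(1))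
    show "(\<lambda>x. \<sigma> x \<bullet> \<Phi> x) \<in> borel_measurable borel" by (intro borel_measurable_inner \<sigma>(1) \<Phi>(1))
    show "AE x in lebesgue_on \<Omega>. s x \<bullet> \<Phi> x = \<sigma> x \<bullet> \<Phi> x" using \<sigma>(3) by eventually_elim simp
  qed (simp add: \<sigma>(2))
  have 2: "(LINT x|lebesgue_on \<Omega>. f x * \<phi> x) = (LINT x|lborel. F x * \<phi> x)"
  proof (rule lborel_transfer(1)[OF \<Omega>(1)])
    show "(\<lambda>x. f x * \<phi> x) \<in> borel_measurable (lebesgue_on \<Omega>)"
      by (intro borel_measurable_times f borel_imp_lebesgue_on \<phi>(1))
    show "(\<lambda>x. F x * \<phi> x) \<in> borel_measurable borel" by (intro borel_measurable_times F(1) \<phi>(1))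
    show "AE x in lebesgue_on \<Omega>. f x * \<phi> x = F x * \<phi> x" using F(3) by eventually_elim simp
  qed (simp add: F(2))
  show ?thesis using eq 1 2 by simp
qed

lemma borel_gap_minimising:
  fixes s \<sigma> :: "'a::euclidean_space \<Rightarrow> 'a"
  assumes \<Omega>: "open \<Omega>" "bounded \<Omega>"
    and min: "is_arg_min (congestion_cost p \<Omega>) (admissible p q \<Omega> f) s"
    and \<sigma>: "\<sigma> \<in> borel_measurable borel" "\<And>x. x \<notin> \<Omega> \<Longrightarrow> \<sigma> x = 0" "AE x in lebesgue_on \<Omega>. s x = \<sigma> x"
    and e: "0 < e"
  shows "\<exists>u g. integrable lborel u \<and> integrable lborel g \<and> (\<forall>x. x \<notin> \<Omega> \<longrightarrow> g x = 0) \<and>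
    integrable lborel (\<lambda>x. norm (g x) powr q) \<and> weak_gradient_lborel \<Omega> u g \<and>
    integrable lborel (\<lambda>x. fenchel_gap p q (\<sigma> x) (g x)) \<and> (LINT x|lborel. fenchel_gap p q (\<sigma> x) (g x)) \<le> e"
proof -
  note fm = finite_measure_lebesgue_on[OF \<Omega>(2,1)]
  have adm: "admissible p q \<Omega> f s" using min by (simp add: is_arg_min_def)
  have s: "s \<in> borel_measurable (lebesgue_on \<Omega>)" "integrable (lebesgue_on \<Omega>) (\<lambda>x. norm (s x) powr p)"
    using adm by (auto simp: admissible_def Lp_space_def)
  obtain G where G: "G \<in> Lq_gradients q \<Omega>" and gap: "(LINT x|lebesgue_on \<Omega>. fenchel_gap p q (s x) (G x)) \<le> e"
    using minimiser_gap_vanishes[OF \<Omega> min e] by blast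
  obtain \<phi> where phi: "\<phi> \<in> Lp_space q \<Omega>" and wg: "has_weak_gradient \<Omega> \<phi> G" and Gq: "G \<in> Lp_space q \<Omega>"
    using G by (auto simp: Lq_gradients_def)
  note phi' = Lp_spaceD[OF phi] and G' = Lp_spaceD[OF Gq]
  have int: "integrable (lebesgue_on \<Omega>) \<phi>" "integrable (lebesgue_on \<Omega>) G"
    using integrable_of_powr[OF fm phi'(1) _ phi'(2)] integrable_of_powr[OF fm G'(1) _ G'(2)] q2 by auto
  obtain u where u: "u \<in> borel_measurable borel" "\<And>x. x \<notin> \<Omega> \<Longrightarrow> u x = 0" "AE x in lebesgue_on \<Omega>. \<phi> x = u x"
    using borel_representative[OF \<Omega>(1) phi'(1)] by blast
  obtain g where g: "g \<in> borel_measurable borel" "\<And>x. x \<notin> \<Omega> \<Longrightarrow> g x = 0" "AE x in lebesgue_on \<Omega>. G x = g x"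
    using borel_representative[OF \<Omega>(1) G'(1)] by blast
  have ui: "integrable lborel u" using lborel_transfer(2)[OF \<Omega>(1) phi'(1) u] int(1) by simp
  have gi: "integrable lborel g" using lborel_transfer(2)[OF \<Omega>(1) G'(1) g] int(2) by simp
  have gq: "integrable lborel (\<lambda>x. norm (g x) powr q)"
  proof -
    have "integrable (lebesgue_on \<Omega>) (\<lambda>x. norm (G x) powr q) \<longleftrightarrow> integrable lborel (\<lambda>x. norm (g x) powr q)"
    proof (rule lborel_transfer(2)[OF \<Omega>(1)])
      show "AE x in lebesgue_on \<Omega>. norm (G x) powr q = norm (g x) powr q" using g(3) by eventually_elim simp
      show "(\<lambda>x. norm (G x) powr q) \<in> borel_measurable (lebesgue_on \<Omega>)" using G' by auto
      show "(\<lambda>x. norm (g x) powr q) \<in> borel_measurable borel" using g(1) by measurable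
    qed (simp add: g(2))
    then show ?thesis using G'(2) by simp
  qed
  have wgb: "weak_gradient_lborel \<Omega> u g"
    unfolding weak_gradient_lborel_def
  proof (intro ballI)
    fix \<psi> :: "'a \<Rightarrow> real" and i :: 'a assume psi: "\<psi> \<in> test_functions \<Omega>" and i: "i \<in> Basis"
    have m: "\<psi> \<in> borel_measurable borel" "partial_deriv i \<psi> \<in> borel_measurable borel"
      using smooth_borel[OF test_smooth[OF psi]] smooth_borel[OF smooth_partial[OF test_smooth[OF psi] i]] by auto
    have 1: "(LINT x|lebesgue_on \<Omega>. \<phi> x * partial_deriv i \<psi> x) = (LINT x|lborel. u x * partial_deriv i \<psi> x)"
    proof (rule lborel_transfer(1)[OF \<Omega>(1)])
      show "(\<lambda>x. \<phi> x * partial_deriv i \<psi> x) \<in> borel_measurable (lebesgue_on \<Omega>)"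
        by (rule borel_measurable_times[OF phi'(1) borel_imp_lebesgue_on[OF m(2)]])
      show "(\<lambda>x. u x * partial_deriv i \<psi> x) \<in> borel_measurable borel" by (rule borel_measurable_times[OF u(1) m(2)])
      show "AE x in lebesgue_on \<Omega>. \<phi> x * partial_deriv i \<psi> x = u x * partial_deriv i \<psi> x" using u(3) by eventually_elim simp
    qed (simp add: u(2))
    have 2: "(LINT x|lebesgue_on \<Omega>. (G x \<bullet> i) * \<psi> x) = (LINT x|lborel. (g x \<bullet> i) * \<psi> x)"
    proof (rule lborel_transfer(1)[OF \<Omega>(1)])
      show "(\<lambda>x. (G x \<bullet> i) * \<psi> x) \<in> borel_measurable (lebesgue_on \<Omega>)"
        by (intro borel_measurable_times borel_measurable_inner G'(1) borel_imp_lebesgue_on[OF m(1)]) simp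
      show "(\<lambda>x. (g x \<bullet> i) * \<psi> x) \<in> borel_measurable borel"
        by (intro borel_measurable_times borel_measurable_inner g(1) m(1)) simp
      show "AE x in lebesgue_on \<Omega>. (G x \<bullet> i) * \<psi> x = (g x \<bullet> i) * \<psi> x" using g(3) by eventually_elim simp
    qed (simp add: g(2))
    have "(LINT x|lebesgue_on \<Omega>. \<phi> x * partial_deriv i \<psi> x) = - (LINT x|lebesgue_on \<Omega>. (G x \<bullet> i) * \<psi> x)"
      using wg psi i unfolding has_weak_gradient_def by blast
    then show "(LINT x|lborel. u x * partial_deriv i \<psi> x) = - (LINT x|lborel. (g x \<bullet> i) * \<psi> x)"
      unfolding 1 2 .
  qed
  have gm: "(\<lambda>x. fenchel_gap p q (s x) (G x)) \<in> borel_measurable (lebesgue_on \<Omega>)"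
    using s(1) G'(1) by (rule measurable_fenchel_gap)
  have gm': "(\<lambda>x. fenchel_gap p q (\<sigma> x) (g x)) \<in> borel_measurable borel"
    using \<sigma>(1) g(1) by (rule measurable_fenchel_gap)
  have g0: "fenchel_gap p q (\<sigma> x) (g x) = 0" if "x \<notin> \<Omega>" for x
    using \<sigma>(2)[OF that] g(2)[OF that] by (simp add: fenchel_gap_def field_cost_def conjugate_cost_def)
  have gae: "AE x in lebesgue_on \<Omega>. fenchel_gap p q (s x) (G x) = fenchel_gap p q (\<sigma> x) (g x)"
    using \<sigma>(3) g(3) by eventually_elim simp
  note gap' = lborel_transfer[OF \<Omega>(1) gm gm' g0 gae]
  have "integrable (lebesgue_on \<Omega>) (\<lambda>x. fenchel_gap p q (s x) (G x))"
    by (rule integrable_gap(3)[OF fm s(1) G'(1) s(2) G'(2)])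
  then have "integrable lborel (\<lambda>x. fenchel_gap p q (\<sigma> x) (g x))" "(LINT x|lborel. fenchel_gap p q (\<sigma> x) (g x)) \<le> e"
    using gap' gap by auto
  then show ?thesis using ui gi g(2) gq wgb by blast
qed

text \<open>
  For \<open>|h| < \<delta>\<close> the translates by \<open>t h\<close> of the support of \<open>\<zeta>\<close> stay inside \<open>\<Omega>\<close> for \<open>0 \<le> t \<le> 1\<close>. The
  constraint is tested with \<open>\<phi> = \<zeta>^2 D\<close>, where \<open>D\<close> is the averaged increment of an almost optimal
  potential with gap at most \<open>|h|^2\<close>, and with the translate of \<open>\<phi>\<close>. Constants must not depend on the chosen
  potential: its gradient is bounded in \<open>L\<^sup>q\<close> by the gap and the norm of \<open>\<sigma>\<close>. The Besov hypothesis
  concerns increments of \<open>\<zeta>^2 f\<close>, whereas the estimate needs \<open>\<zeta>^2\<close> times increments of \<open>f\<close>; the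
  commutator is of order \<open>|h|\<close> in \<open>L\<^sup>p\<close>.
\<close>

lemma local_difference_bound:
  fixes s \<sigma> :: "'a::euclidean_space \<Rightarrow> 'a"
  assumes \<Omega>: "open \<Omega>" "bounded \<Omega>" and \<alpha>: "0 < \<alpha>" "\<alpha> < 1"
    and f: "f \<in> Lp_space p \<Omega>" "f \<in> Besov_infty_loc \<alpha> p \<Omega>"
    and min: "is_arg_min (congestion_cost p \<Omega>) (admissible p q \<Omega> f) s"
    and \<sigma>: "\<sigma> \<in> borel_measurable borel" "\<And>x. x \<notin> \<Omega> \<Longrightarrow> \<sigma> x = 0" "AE x in lebesgue_on \<Omega>. s x = \<sigma> x"
    and \<sigma>p: "integrable lborel (\<lambda>x. norm (\<sigma> x) powr p)"
    and \<zeta>: "\<zeta> \<in> test_functions \<Omega>" "\<And>x. 0 \<le> \<zeta> x" "\<And>x. \<zeta> x \<le> 1"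
  shows "\<exists>C \<delta>. 0 \<le> C \<and> 0 < \<delta> \<and> \<delta> \<le> 1 \<and> (\<forall>h. h \<noteq> 0 \<longrightarrow> norm h < \<delta> \<longrightarrow>
     (LINT x|lborel. (\<zeta> x)\<^sup>2 * (norm (radial_powr (p / 2) (\<sigma> (x + h)) - radial_powr (p / 2) (\<sigma> x)))\<^sup>2)
       \<le> C * norm h powr (1 + \<alpha>))"
proof -
  have adm: "admissible p q \<Omega> f s" using min by (simp add: is_arg_min_def)
  note \<sigma>m [measurable] = \<sigma>(1)
  note fp = Lp_spaceD[OF f(1)]
  obtain F where F: "F \<in> borel_measurable borel" "\<And>x. x \<notin> \<Omega> \<Longrightarrow> F x = 0" "AE x in lebesgue_on \<Omega>. f x = F x"
    using borel_representative[OF \<Omega>(1) fp(1)] by blast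
  note Fm [measurable] = F(1)
  have Fp: "integrable lborel (\<lambda>x. \<bar>F x\<bar> powr p)"
  proof -
    have "integrable (lebesgue_on \<Omega>) (\<lambda>x. norm (f x) powr p) \<longleftrightarrow> integrable lborel (\<lambda>x. \<bar>F x\<bar> powr p)"
    proof (rule lborel_transfer(2)[OF \<Omega>(1)])
      show "AE x in lebesgue_on \<Omega>. norm (f x) powr p = \<bar>F x\<bar> powr p" using F(3) by eventually_elim simp
      show "(\<lambda>x. norm (f x) powr p) \<in> borel_measurable (lebesgue_on \<Omega>)" using fp by auto
      show "(\<lambda>x. \<bar>F x\<bar> powr p) \<in> borel_measurable borel" by measurable
      show "\<bar>F x\<bar> powr p = 0" if "x \<notin> \<Omega>" for x using F(2)[OF that] by simp
    qed
    then show ?thesis using fp(2) by simp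
  qed
  have zs: "smooth \<zeta>" by (rule test_smooth[OF \<zeta>(1)])
  note zm [measurable] = smooth_borel[OF zs]
  define \<theta> where "\<theta> x = \<zeta> x * \<zeta> x" for x
  have \<theta>: "\<theta> \<in> test_functions \<Omega>" unfolding \<theta>_def by (rule test_mult[OF \<zeta>(1) zs])
  have \<theta>s: "smooth \<theta>" by (rule test_smooth[OF \<theta>])
  have \<theta>2: "\<theta> x = (\<zeta> x)\<^sup>2" for x by (simp add: \<theta>_def power2_eq_square)
  have \<theta>1: "\<bar>\<theta> x\<bar> \<le> 1" for x unfolding \<theta>2 using \<zeta>(2,3)[of x] by (simp add: power_le_one)
  note \<theta>m [measurable] = smooth_borel[OF \<theta>s]
  note gm [measurable] = gradient_measurable[OF \<theta>s]
  obtain K where K: "compact K" "K \<subseteq> \<Omega>" "\<And>x. x \<notin> K \<Longrightarrow> \<zeta> x = 0" using \<zeta>(1) by (rule test_functionsE) blast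
  obtain \<epsilon> where \<epsilon>: "0 < \<epsilon>" "(\<Union>x\<in>K. ball x \<epsilon>) \<subseteq> \<Omega>"
    using compact_subset_open_imp_ball_epsilon_subset[OF K(1) \<Omega>(1) K(2)] by blast
  define \<delta> where "\<delta> = min \<epsilon> 1"
  have \<delta>: "0 < \<delta>" "\<delta> \<le> 1" "\<delta> \<le> \<epsilon>" using \<epsilon>(1) by (auto simp: \<delta>_def)
  have K_shift: "x + y \<in> \<Omega>" if "x \<in> K" "norm y < \<delta>" for x y
  proof -
    have "x + y \<in> ball x \<epsilon>" using that \<delta> by (simp add: dist_norm)
    then show ?thesis using \<epsilon>(2) that by blast
  qed
  obtain L where L: "0 \<le> L" "\<forall>x h. \<bar>frechet_derivative \<zeta> (at x) h\<bar> \<le> L * norm h"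
    using test_frechet_bounded[OF \<zeta>(1)] by blast
  define \<Lambda> where "\<Lambda> = DIM('a) * L"
  have \<Lambda>: "0 \<le> \<Lambda>" using L by (simp add: \<Lambda>_def)
  have N: "norm (gradient \<theta> x) \<le> 2 * \<Lambda> * \<zeta> x" for x
  proof -
    have "norm (gradient \<theta> x) = 2 * \<zeta> x * norm (gradient \<zeta> x)"
      unfolding \<theta>_def gradient_square[OF zs] using \<zeta>(2)[of x] by simp
    also have "\<dots> \<le> 2 * \<zeta> x * \<Lambda>"
      unfolding \<Lambda>_def using \<zeta>(2)[of x] L(2) by (intro mult_left_mono norm_gradient_le) auto
    finally show ?thesis by (simp add: mult_ac)
  qed
  obtain M where M: "0 \<le> M" "\<forall>x y. \<bar>\<theta> x - \<theta> y\<bar> \<le> M * norm (x - y)"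
    using test_frechet_bounded[OF \<theta>] by blast
  have \<theta>0: "\<theta> x = 0" "gradient \<theta> x = 0" if "x \<notin> K" for x
    using K(3)[OF that] N[of x] by (simp_all add: \<theta>_def)
  obtain E where E: "0 \<le> E" "\<And>h. h \<noteq> 0 \<Longrightarrow>
      (LINT x|lborel. \<bar>\<theta> (x + h) * F (x + h) - \<theta> x * F x\<bar> powr p) \<le> E * norm h powr (\<alpha> * p)"
  proof (rule Besov_difference_bound[where v = "\<lambda>x. \<theta> x * f x" and V = "\<lambda>x. \<theta> x * F x" and \<alpha> = \<alpha> and m = p])
    show "(\<lambda>x. \<theta> x * f x) \<in> Besov_infty \<alpha> p" using f(2) \<theta> by (simp add: Besov_infty_loc_def)
    show "AE x in lborel. \<theta> x * f x = \<theta> x * F x"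
    proof -
      have \<Omega>': "\<Omega> \<inter> space lebesgue \<in> sets lebesgue" using \<Omega> by auto
      have "AE x in lebesgue. x \<in> \<Omega> \<longrightarrow> f x = F x" using F(3) unfolding AE_restrict_space_iff[OF \<Omega>'] .
      then have "AE x in lborel. x \<in> \<Omega> \<longrightarrow> f x = F x" by (simp only: AE_completion_iff)
      then show ?thesis
      proof eventually_elim
        case (elim x)
        then show ?case using \<theta>0(1)[of x] K(2) by (cases "x \<in> K") auto
      qed
    qed
  qed (use p_gt1 in auto)
  define SF where "SF = (LINT x|lborel. \<bar>F x\<bar> powr p)"
  define A where "A = 2 powr p * (E + M powr p * SF)"
  define S where "S = (LINT x|lborel. norm (\<sigma> x) powr p)"
  define B where "B = 2 powr q * (measure lborel \<Omega> + 4 * q + 2 * S)"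
  define C where "C = 8 * q * (3 + 32 * q * \<Lambda>\<^sup>2 * (4 * S + B) + A + B)"
  have nonneg: "0 \<le> SF" "0 \<le> S" by (auto simp: SF_def S_def)
  have "0 \<le> A" "0 \<le> B" using nonneg E M q2 by (auto simp: A_def B_def)
  then have C: "0 \<le> C" using nonneg q2 by (simp add: C_def)
  have main: "(LINT x|lborel. (\<zeta> x)\<^sup>2 * (norm (radial_powr (p / 2) (\<sigma> (x + h)) - radial_powr (p / 2) (\<sigma> x)))\<^sup>2)
       \<le> C * norm h powr (1 + \<alpha>)" if h: "h \<noteq> 0" "norm h < \<delta>" for h
  proof -
    have h1: "norm h \<le> 1" using h \<delta> by simp
    have h2: "0 < (norm h)\<^sup>2" "(norm h)\<^sup>2 \<le> 1" using h h1 by (auto simp: power_le_one)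
    obtain u g where u: "integrable lborel u" and g: "integrable lborel g" "\<And>x. x \<notin> \<Omega> \<Longrightarrow> g x = 0"
        "integrable lborel (\<lambda>x. norm (g x) powr q)" and wg: "weak_gradient_lborel \<Omega> u g"
      and gap: "integrable lborel (\<lambda>x. fenchel_gap p q (\<sigma> x) (g x))"
        "(LINT x|lborel. fenchel_gap p q (\<sigma> x) (g x)) \<le> (norm h)\<^sup>2"
      using borel_gap_minimising[OF \<Omega> min \<sigma> h2(1)] by blast
    have gbm [measurable]: "g \<in> borel_measurable borel" using g(1) by auto
    define D where "D = line_average g h"
    have D: "integrable lborel D" unfolding D_def by (rule integrable_line_average[OF g(1)])
    then have Dm [measurable]: "D \<in> borel_measurable borel" by auto
    note Dq = line_average_Lq[OF gbm g(3), of h, folded D_def]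
    \<comment> \<open>\<open>|g|^q\<close> is bounded by \<open>1 + |V g|^2\<close> up to a constant, and \<open>V g\<close> is close to \<open>J \<sigma>\<close> in \<open>L\<^sup>2\<close>.\<close>
    have gB: "(LINT x|lborel. norm (g x) powr q) \<le> B"
    proof -
      have ind: "integrable lborel (indicator \<Omega> :: 'a \<Rightarrow> real)"
        using \<Omega> emeasure_bounded_finite[OF \<Omega>(2)] by simp
      have "(LINT x|lborel. norm (g x) powr q)
        \<le> (LINT x|lborel. 2 powr q * (indicator \<Omega> x + 4 * q * fenchel_gap p q (\<sigma> x) (g x) + 2 * norm (\<sigma> x) powr p))"
      proof (rule integral_mono)
        show "norm (g x) powr q \<le> 2 powr q * (indicator \<Omega> x + 4 * q * fenchel_gap p q (\<sigma> x) (g x) + 2 * norm (\<sigma> x) powr p)" for x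
        proof (cases "x \<in> \<Omega>")
          case True
          have "(norm (excess_powr (q / 2) (g x)))\<^sup>2 \<le> 2 * (norm (excess_powr (q / 2) (g x) - radial_powr (p / 2) (\<sigma> x)))\<^sup>2
              + 2 * (norm (radial_powr (p / 2) (\<sigma> x)))\<^sup>2"
            using norm_diff_square_le[of "excess_powr (q / 2) (g x)" 0 "radial_powr (p / 2) (\<sigma> x)"] by simp
          moreover have "(norm (excess_powr (q / 2) (g x) - radial_powr (p / 2) (\<sigma> x)))\<^sup>2 \<le> 2 * q * fenchel_gap p q (\<sigma> x) (g x)"
            using fenchel_gap_ge[of "\<sigma> x" "g x"] q2 by (simp add: norm_minus_commute pos_divide_le_eq mult.commute)
          ultimately have "(norm (excess_powr (q / 2) (g x)))\<^sup>2 \<le> 4 * q * fenchel_gap p q (\<sigma> x) (g x) + 2 * norm (\<sigma> x) powr p"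
            unfolding norm_radial_powr_square by linarith
          then have "2 powr q * (1 + (norm (excess_powr (q / 2) (g x)))\<^sup>2)
              \<le> 2 powr q * (indicator \<Omega> x + 4 * q * fenchel_gap p q (\<sigma> x) (g x) + 2 * norm (\<sigma> x) powr p)"
            using True by (intro mult_left_mono) auto
          then show ?thesis using norm_powr_le_excess[of "g x"] by linarith
        next
          case False
          then show ?thesis using g(2)[of x] fenchel_gap_nonneg[of "\<sigma> x" "g x"] q2 by simp
        qed
      qed (use g(3) ind gap(1) \<sigma>p in auto)
      also have "\<dots> = 2 powr q * (measure lborel \<Omega> + 4 * q * (LINT x|lborel. fenchel_gap p q (\<sigma> x) (g x)) + 2 * S)"
        using ind gap(1) \<sigma>p \<Omega> by (simp add: S_def)
      also have "\<dots> \<le> B"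
        unfolding B_def using gap(2) h2(2) q2 by (intro mult_left_mono add_right_mono add_left_mono) auto
      finally show ?thesis .
    qed
    have shift: "(\<lambda>x. \<theta> (x - t *\<^sub>R h)) \<in> test_functions \<Omega>" if t: "0 \<le> t" "t \<le> 1" for t
    proof (rule test_functionsI)
      show "smooth (\<lambda>x. \<theta> (x - t *\<^sub>R h))" using smooth_translate[OF \<theta>s, of "- (t *\<^sub>R h)"] by simp
      show "compact ((\<lambda>x. x + t *\<^sub>R h) ` K)" by (intro compact_continuous_image continuous_intros K(1))
      have "norm (t *\<^sub>R h) < \<delta>" using t h(2) mult_left_le_one_le[of "norm h" t] by simp
      then show "(\<lambda>x. x + t *\<^sub>R h) ` K \<subseteq> \<Omega>" using K_shift by blast
      show "\<theta> (x - t *\<^sub>R h) = 0" if "x \<notin> (\<lambda>x. x + t *\<^sub>R h) ` K" for x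
      proof (rule \<theta>0)
        show "x - t *\<^sub>R h \<notin> K" using that by (metis diff_add_cancel image_eqI)
      qed
    qed
    define \<phi> where "\<phi> x = \<theta> x * D x" for x
    define \<Phi> where "\<Phi> x = \<theta> x *\<^sub>R (g (x + h) - g x) + D x *\<^sub>R gradient \<theta> x" for x
    have phm [measurable]: "\<phi> \<in> borel_measurable borel" "\<Phi> \<in> borel_measurable borel"
      unfolding \<phi>_def \<Phi>_def by measurable
    have wgU: "weak_gradient_lborel UNIV \<phi> \<Phi>"
      unfolding \<phi>_def \<Phi>_def D_def by (rule localised_average_weak_gradient[OF u g(1) wg \<theta> shift])
    have phq: "integrable lborel (\<lambda>x. \<bar>\<phi> x\<bar> powr q)"
    proof (rule Bochner_Integration.integrable_bound[OF Dq(1)])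
      have "\<bar>\<phi> x\<bar> powr q \<le> \<bar>D x\<bar> powr q" for x
        using \<theta>1[of x] q2 mult_right_mono[OF \<theta>1[of x], of "\<bar>D x\<bar>"] by (intro powr_mono2) (auto simp: \<phi>_def abs_mult)
      then show "AE x in lborel. norm (\<bar>\<phi> x\<bar> powr q) \<le> norm (\<bar>D x\<bar> powr q)" by simp
    qed measurable
    have ghq: "integrable lborel (\<lambda>x. norm (g (x + h)) powr q)"
      using lborel_translate(2)[of "\<lambda>x. norm (g x) powr q" h] g(3) by simp
    have dgq: "integrable lborel (\<lambda>x. norm (g (x + h) - g x) powr q)"
      by (rule integrable_powr_diff[OF _ _ ghq g(3)]) (use q2 in auto)
    have "norm (gradient \<theta> x) \<le> 2 * \<Lambda>" for x
      using N[of x] mult_left_mono[OF \<zeta>(3)[of x], of "2 * \<Lambda>"] \<Lambda> by simp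
    then have Phq: "integrable lborel (\<lambda>x. norm (\<Phi> x) powr q)"
      unfolding \<Phi>_def by (intro integrable_localised_gradient[OF _ _ _ _ dgq Dq(1) \<theta>1]) measurable
    have supp: "\<phi> x = 0" "\<Phi> x = 0" if "x \<notin> K" for x using \<theta>0[OF that] by (simp_all add: \<phi>_def \<Phi>_def)
    have t1: "(LINT x|lborel. \<sigma> x \<bullet> \<Phi> x) = (LINT x|lborel. F x * \<phi> x)"
      by (rule tested_equation[OF \<Omega> adm \<sigma> fp(1) F phm(1) phq _ phm(2) Phq _ wgU]) (use supp K(2) in blast)+
    have t2: "(LINT x|lborel. \<sigma> x \<bullet> \<Phi> (x + - h)) = (LINT x|lborel. F x * \<phi> (x + - h))"
    proof (rule tested_equation[OF \<Omega> adm \<sigma> fp(1) F _ _ _ _ _ _ weak_gradient_translate[OF phm wgU]])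
      show "integrable lborel (\<lambda>x. \<bar>\<phi> (x + - h)\<bar> powr q)"
        using lborel_translate(2)[of "\<lambda>x. \<bar>\<phi> x\<bar> powr q" "- h"] phq by simp
      show "integrable lborel (\<lambda>x. norm (\<Phi> (x + - h)) powr q)"
        using lborel_translate(2)[of "\<lambda>x. norm (\<Phi> x) powr q" "- h"] Phq by simp
      have "x + - h \<notin> K" if "x \<notin> \<Omega>" for x
        using K_shift[of "x + - h" h] that h(2) by auto
      then show "\<phi> (x + - h) = 0" "\<Phi> (x + - h) = 0" if "x \<notin> \<Omega>" for x using supp that by blast+
    qed measurable
    have "(LINT x|lborel. \<sigma> x \<bullet> \<Phi> (x + - h)) = (LINT x|lborel. (\<lambda>y. \<sigma> y \<bullet> \<Phi> (y + - h)) (x + h))"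
      by (rule lborel_translate(1)[symmetric]) measurable
    then have t3: "(LINT x|lborel. \<sigma> x \<bullet> \<Phi> (x + - h)) = (LINT x|lborel. \<sigma> (x + h) \<bullet> \<Phi> x)" by simp
    have "(LINT x|lborel. F x * \<phi> (x + - h)) = (LINT x|lborel. (\<lambda>y. F y * \<phi> (y + - h)) (x + h))"
      by (rule lborel_translate(1)[symmetric]) measurable
    then have t4: "(LINT x|lborel. F x * \<phi> (x + - h)) = (LINT x|lborel. F (x + h) * \<phi> x)" by simp
    have \<sigma>hp: "integrable lborel (\<lambda>x. norm (\<sigma> (x + h)) powr p)"
      using lborel_translate(2)[of "\<lambda>x. norm (\<sigma> x) powr p" h] \<sigma>p by simp
    have Fhp: "integrable lborel (\<lambda>x. \<bar>F (x + h)\<bar> powr p)" "(LINT x|lborel. \<bar>F (x + h)\<bar> powr p) = SF"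
      using lborel_translate[of "\<lambda>x. \<bar>F x\<bar> powr p" h] Fp by (simp_all add: SF_def)
    have i1: "integrable lborel (\<lambda>x. \<sigma> x \<bullet> \<Phi> x)" by (rule integrable_inner[OF _ _ \<sigma>p Phq]) measurable
    have i2: "integrable lborel (\<lambda>x. \<sigma> (x + h) \<bullet> \<Phi> x)" by (rule integrable_inner[OF _ _ \<sigma>hp Phq]) measurable
    have i3: "integrable lborel (\<lambda>x. F x * \<phi> x)"
      using integrable_inner[of F lborel \<phi>] Fp phq by simp
    have i4: "integrable lborel (\<lambda>x. F (x + h) * \<phi> x)"
      using integrable_inner[of "\<lambda>x. F (x + h)" lborel \<phi>] Fhp(1) phq by simp
    have eq: "(LINT x|lborel. (\<sigma> (x + h) - \<sigma> x) \<bullet> \<Phi> x) = (LINT x|lborel. (F (x + h) - F x) * \<phi> x)"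
      using t1 t2 t3 t4 i1 i2 i3 i4 by (simp add: inner_diff_left left_diff_distrib)
    have Tb: "integrable lborel (\<lambda>x. \<bar>\<theta> (x + h) * F (x + h) - \<theta> x * F x\<bar> powr p)"
    proof -
      have a: "integrable lborel (\<lambda>x. \<bar>\<theta> x * F x\<bar> powr p)"
      proof (rule Bochner_Integration.integrable_bound[OF Fp])
        have "\<bar>\<theta> x * F x\<bar> powr p \<le> \<bar>F x\<bar> powr p" for x
          using p_gt1 mult_right_mono[OF \<theta>1[of x], of "\<bar>F x\<bar>"] by (intro powr_mono2) (auto simp: abs_mult)
        then show "AE x in lborel. norm (\<bar>\<theta> x * F x\<bar> powr p) \<le> norm (\<bar>F x\<bar> powr p)" by simp
      qed measurable
      have b: "integrable lborel (\<lambda>x. \<bar>\<theta> (x + h) * F (x + h)\<bar> powr p)"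
        using lborel_translate(2)[of "\<lambda>x. \<bar>\<theta> x * F x\<bar> powr p" h] a by simp
      show ?thesis using integrable_powr_diff[of "\<lambda>x. \<theta> (x + h) * F (x + h)" lborel "\<lambda>x. \<theta> x * F x" p] a b p_gt1 by simp
    qed
    have fb: "\<bar>(\<zeta> x)\<^sup>2 * (F (x + h) - F x)\<bar> powr p
       \<le> 2 powr p * (\<bar>\<theta> (x + h) * F (x + h) - \<theta> x * F x\<bar> powr p + (M * norm h) powr p * \<bar>F (x + h)\<bar> powr p)" for x
    proof -
      have "(\<zeta> x)\<^sup>2 * (F (x + h) - F x) = (\<theta> (x + h) * F (x + h) - \<theta> x * F x) - (\<theta> (x + h) - \<theta> x) * F (x + h)"
        by (simp add: \<theta>2 algebra_simps)
      then have "\<bar>(\<zeta> x)\<^sup>2 * (F (x + h) - F x)\<bar> \<le> \<bar>\<theta> (x + h) * F (x + h) - \<theta> x * F x\<bar> + \<bar>(\<theta> (x + h) - \<theta> x) * F (x + h)\<bar>" by linarith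
      also have "\<bar>(\<theta> (x + h) - \<theta> x) * F (x + h)\<bar> \<le> (M * norm h) * \<bar>F (x + h)\<bar>"
        unfolding abs_mult using M(2)[rule_format, of "x + h" x] by (intro mult_right_mono) auto
      finally have "\<bar>(\<zeta> x)\<^sup>2 * (F (x + h) - F x)\<bar> powr p
          \<le> (\<bar>\<theta> (x + h) * F (x + h) - \<theta> x * F x\<bar> + (M * norm h) * \<bar>F (x + h)\<bar>) powr p"
        using p_gt1 by (intro powr_mono2) auto
      also have "\<dots> \<le> 2 powr p * (\<bar>\<theta> (x + h) * F (x + h) - \<theta> x * F x\<bar> powr p + ((M * norm h) * \<bar>F (x + h)\<bar>) powr p)"
        using M(1) p_gt1 by (intro powr_add_le) auto
      finally show ?thesis by (simp add: powr_mult)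
    qed
    have fbi: "integrable lborel (\<lambda>x. 2 powr p * (\<bar>\<theta> (x + h) * F (x + h) - \<theta> x * F x\<bar> powr p + (M * norm h) powr p * \<bar>F (x + h)\<bar> powr p))"
      using Tb Fhp(1) by auto
    have f1: "integrable lborel (\<lambda>x. \<bar>(\<zeta> x)\<^sup>2 * (F (x + h) - F x)\<bar> powr p)"
    proof (rule Bochner_Integration.integrable_bound[OF fbi])
      show "AE x in lborel. norm (\<bar>(\<zeta> x)\<^sup>2 * (F (x + h) - F x)\<bar> powr p)
        \<le> norm (2 powr p * (\<bar>\<theta> (x + h) * F (x + h) - \<theta> x * F x\<bar> powr p + (M * norm h) powr p * \<bar>F (x + h)\<bar> powr p))"
        using order.trans[OF fb abs_ge_self] by (intro AE_I2) simp
    qed measurable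
    have "(LINT x|lborel. \<bar>(\<zeta> x)\<^sup>2 * (F (x + h) - F x)\<bar> powr p)
       \<le> (LINT x|lborel. 2 powr p * (\<bar>\<theta> (x + h) * F (x + h) - \<theta> x * F x\<bar> powr p + (M * norm h) powr p * \<bar>F (x + h)\<bar> powr p))"
      by (rule integral_mono[OF f1 fbi fb])
    also have "\<dots> = 2 powr p * ((LINT x|lborel. \<bar>\<theta> (x + h) * F (x + h) - \<theta> x * F x\<bar> powr p) + (M * norm h) powr p * SF)"
      using Tb Fhp by simp
    also have "\<dots> \<le> 2 powr p * (E * norm h powr (\<alpha> * p) + (M powr p * norm h powr (\<alpha> * p)) * SF)"
    proof (intro mult_left_mono add_mono E(2) h(1) mult_right_mono nonneg)
      have "norm h powr p \<le> norm h powr (\<alpha> * p)" using h h1 \<alpha> p_gt1 by (intro powr_mono') auto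
      then show "(M * norm h) powr p \<le> M powr p * norm h powr (\<alpha> * p)"
        by (simp add: powr_mult mult_left_mono)
    qed simp
    also have "\<dots> = A * norm h powr (\<alpha> * p)" by (simp add: A_def algebra_simps)
    finally have f2: "(LINT x|lborel. \<bar>(\<zeta> x)\<^sup>2 * (F (x + h) - F x)\<bar> powr p) \<le> A * norm h powr (\<alpha> * p)" .
    have "(LINT x|lborel. (\<zeta> x)\<^sup>2 * (norm (radial_powr (p / 2) (\<sigma> (x + h)) - radial_powr (p / 2) (\<sigma> x)))\<^sup>2)
      \<le> 8 * q * (3 + 32 * q * \<Lambda>\<^sup>2 * (4 * (LINT x|lborel. norm (\<sigma> x) powr p) + B) + A + B) * norm h powr (1 + \<alpha>)"
    proof (rule difference_estimate[OF \<sigma>m gbm Fm zm Dm gm \<sigma>p g(3) gB gap \<zeta>(2,3) N \<Lambda> h(1) h1 \<alpha> Dq f1 f2])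
      have "\<Phi> x = (\<zeta> x)\<^sup>2 *\<^sub>R (g (x + h) - g x) + D x *\<^sub>R gradient \<theta> x" "\<phi> x = (\<zeta> x)\<^sup>2 * D x" for x
        unfolding \<Phi>_def \<phi>_def \<theta>2[of x] by (rule refl)+
      then show "(LINT x|lborel. (\<sigma> (x + h) - \<sigma> x) \<bullet> ((\<zeta> x)\<^sup>2 *\<^sub>R (g (x + h) - g x) + D x *\<^sub>R gradient \<theta> x))
         = (LINT x|lborel. (F (x + h) - F x) * ((\<zeta> x)\<^sup>2 * D x))"
        using eq by (simp only:)
    qed
    then show ?thesis by (simp add: C_def S_def)
  qed
  show ?thesis using C \<delta> main by blast
qed

text \<open>
  The embedding is applied to \<open>w = \<zeta> |J \<sigma>|\<close>. For small \<open>h\<close> its increments are controlled by those of \<open>J \<sigma>\<close>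
  and by the Lipschitz constant of \<open>\<zeta>\<close>; for \<open>|h| \<ge> \<delta>\<close> the norm of \<open>J \<sigma>\<close> in \<open>L\<^sup>2\<close> is enough, at the price of the
  factor \<open>\<delta>^(- 1 - \<alpha>)\<close>. Finally \<open>w^(2 r / p) = \<zeta>^(2 r / p) |\<sigma>|^r\<close>.
\<close>

lemma weighted_higher_integrability:
  fixes s \<sigma> :: "'a::euclidean_space \<Rightarrow> 'a" and \<alpha> r :: real
  assumes \<Omega>: "open \<Omega>" "bounded \<Omega>" and \<alpha>: "0 < \<alpha>" "\<alpha> < 1" and dim: "2 \<le> DIM('a)"
    and f: "f \<in> Lp_space p \<Omega>" "f \<in> Besov_infty_loc \<alpha> p \<Omega>"
    and min: "is_arg_min (congestion_cost p \<Omega>) (admissible p q \<Omega> f) s"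
    and \<sigma>: "\<sigma> \<in> borel_measurable borel" "\<And>x. x \<notin> \<Omega> \<Longrightarrow> \<sigma> x = 0" "AE x in lebesgue_on \<Omega>. s x = \<sigma> x"
    and \<sigma>p: "integrable lborel (\<lambda>x. norm (\<sigma> x) powr p)"
    and \<zeta>: "\<zeta> \<in> test_functions \<Omega>" "\<And>x. 0 \<le> \<zeta> x" "\<And>x. \<zeta> x \<le> 1"
    and r: "0 < r" "r < DIM('a) * p / (DIM('a) - \<alpha> - 1)"
  shows "integrable lborel (\<lambda>x. \<zeta> x powr (2 * r / p) * norm (\<sigma> x) powr r)"
proof -
  obtain C \<delta> where C: "0 \<le> C" "0 < \<delta>" "\<delta> \<le> 1"
    and diff: "\<And>h. h \<noteq> 0 \<Longrightarrow> norm h < \<delta> \<Longrightarrow>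
     (LINT x|lborel. (\<zeta> x)\<^sup>2 * (norm (radial_powr (p / 2) (\<sigma> (x + h)) - radial_powr (p / 2) (\<sigma> x)))\<^sup>2)
       \<le> C * norm h powr (1 + \<alpha>)"
    using local_difference_bound[OF \<Omega> \<alpha> f min \<sigma> \<sigma>p \<zeta>] by blast
  note \<sigma>m [measurable] = \<sigma>(1)
  have zs: "smooth \<zeta>" by (rule test_smooth[OF \<zeta>(1)])
  note zm [measurable] = smooth_borel[OF zs]
  obtain K where K: "compact K" "\<And>x. x \<notin> K \<Longrightarrow> \<zeta> x = 0" using \<zeta>(1) by (rule test_functionsE) blast
  obtain M where M: "0 \<le> M" "\<forall>x y. \<bar>\<zeta> x - \<zeta> y\<bar> \<le> M * norm (x - y)"
    using test_frechet_bounded[OF \<zeta>(1)] by blast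
  define J where "J x = radial_powr (p / 2) (\<sigma> x)" for x
  have [measurable]: "J \<in> borel_measurable borel" unfolding J_def by measurable
  have J2: "(norm (J x))\<^sup>2 = norm (\<sigma> x) powr p" for x unfolding J_def by (rule norm_radial_powr_square)
  define w where "w x = \<zeta> x * norm (J x)" for x
  have wm [measurable]: "w \<in> borel_measurable borel" unfolding w_def by measurable
  define S where "S = (LINT x|lborel. norm (\<sigma> x) powr p)"
  have S: "0 \<le> S" by (simp add: S_def)
  have \<sigma>h: "integrable lborel (\<lambda>x. norm (\<sigma> (x + h)) powr p)" "(LINT x|lborel. norm (\<sigma> (x + h)) powr p) = S" for h
    using lborel_translate[of "\<lambda>x. norm (\<sigma> x) powr p" h] \<sigma>p by (simp_all add: S_def)
  have wle: "(w x)\<^sup>2 \<le> norm (\<sigma> x) powr p" for x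
  proof -
    have "(\<zeta> x)\<^sup>2 \<le> 1" using \<zeta>(2,3) by (simp add: power_le_one)
    then show ?thesis unfolding w_def power_mult_distrib J2 using mult_right_mono[of "(\<zeta> x)\<^sup>2" 1 "norm (\<sigma> x) powr p"] by simp
  qed
  have w2: "integrable lborel (\<lambda>x. (w x)\<^sup>2)"
    by (rule Bochner_Integration.integrable_bound[OF \<sigma>p]) (use wle in auto)
  define C' where "C' = 2 * C + 2 * M\<^sup>2 * S + 4 * S / \<delta> powr (1 + \<alpha>)"
  have C': "0 \<le> C'" using C S by (simp add: C'_def)
  have bound: "(\<integral>\<^sup>+x. ennreal ((w (x + h) - w x)\<^sup>2) \<partial>lborel) \<le> ennreal (C' * norm h powr (1 + \<alpha>))" for h
  proof -
    have "\<exists>k. integrable lborel k \<and> (\<forall>x. (w (x + h) - w x)\<^sup>2 \<le> k x) \<and>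
        (LINT x|lborel. k x) \<le> C' * norm h powr (1 + \<alpha>)"
    proof -
      consider "h = 0" | "h \<noteq> 0" "norm h < \<delta>" | "\<delta> \<le> norm h" by linarith
      then show ?thesis
      proof cases
        case 1
        then show ?thesis using C' by (intro exI[of _ "\<lambda>x. 0"]) auto
      next
        case 2
        have Jp: "integrable lborel (\<lambda>x. (norm (J x))\<^sup>2)" unfolding J2 by (rule \<sigma>p)
        have Jhp: "integrable lborel (\<lambda>x. (norm (J (x + h)))\<^sup>2)" unfolding J2 by (rule \<sigma>h)
        have dJ: "integrable lborel (\<lambda>x. (norm (J (x + h) - J x))\<^sup>2)"
          by (rule integrable_norm_diff_square[OF _ _ Jhp Jp]) measurable
        have zJ: "integrable lborel (\<lambda>x. (\<zeta> x)\<^sup>2 * (norm (J (x + h) - J x))\<^sup>2)"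
        proof (rule Bochner_Integration.integrable_bound[OF dJ])
          have "(\<zeta> x)\<^sup>2 \<le> 1" for x using \<zeta>(2,3) by (simp add: power_le_one)
          then have "(\<zeta> x)\<^sup>2 * (norm (J (x + h) - J x))\<^sup>2 \<le> 1 * (norm (J (x + h) - J x))\<^sup>2" for x
            by (intro mult_right_mono) auto
          then show "AE x in lborel. norm ((\<zeta> x)\<^sup>2 * (norm (J (x + h) - J x))\<^sup>2) \<le> norm ((norm (J (x + h) - J x))\<^sup>2)"
            by simp
        qed measurable
        define k where "k x = 2 * ((\<zeta> x)\<^sup>2 * (norm (J (x + h) - J x))\<^sup>2) + 2 * (M * norm h)\<^sup>2 * norm (\<sigma> (x + h)) powr p" for x
        have "integrable lborel k" unfolding k_def using zJ \<sigma>h(1)[of h] by auto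
        moreover have "(w (x + h) - w x)\<^sup>2 \<le> k x" for x
        proof -
          have "w (x + h) - w x = \<zeta> x * (norm (J (x + h)) - norm (J x)) + (\<zeta> (x + h) - \<zeta> x) * norm (J (x + h))"
            by (simp add: w_def algebra_simps)
          then have "(w (x + h) - w x)\<^sup>2 \<le> 2 * (\<zeta> x * (norm (J (x + h)) - norm (J x)))\<^sup>2 + 2 * ((\<zeta> (x + h) - \<zeta> x) * norm (J (x + h)))\<^sup>2"
            using sum_squares_bound[of "\<zeta> x * (norm (J (x + h)) - norm (J x))" "(\<zeta> (x + h) - \<zeta> x) * norm (J (x + h))"]
            by (simp only: power2_sum)
          also have "(\<zeta> x * (norm (J (x + h)) - norm (J x)))\<^sup>2 \<le> (\<zeta> x)\<^sup>2 * (norm (J (x + h) - J x))\<^sup>2"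
          proof -
            have "\<bar>norm (J (x + h)) - norm (J x)\<bar>\<^sup>2 \<le> (norm (J (x + h) - J x))\<^sup>2"
              by (intro power_mono norm_triangle_ineq3) auto
            then show ?thesis by (simp add: power_mult_distrib mult_left_mono)
          qed
          also have "((\<zeta> (x + h) - \<zeta> x) * norm (J (x + h)))\<^sup>2 \<le> (M * norm h)\<^sup>2 * norm (\<sigma> (x + h)) powr p"
          proof -
            have "\<bar>\<zeta> (x + h) - \<zeta> x\<bar>\<^sup>2 \<le> (M * norm h)\<^sup>2"
              using M(2)[rule_format, of "x + h" x] by (intro power_mono) auto
            then have "(\<zeta> (x + h) - \<zeta> x)\<^sup>2 * norm (\<sigma> (x + h)) powr p \<le> (M * norm h)\<^sup>2 * norm (\<sigma> (x + h)) powr p"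
              by (intro mult_right_mono) auto
            then show ?thesis by (simp add: power_mult_distrib J2)
          qed
          finally show ?thesis by (simp add: k_def)
        qed
        moreover have "(LINT x|lborel. k x) \<le> C' * norm h powr (1 + \<alpha>)"
        proof -
          have "(LINT x|lborel. k x) = 2 * (LINT x|lborel. (\<zeta> x)\<^sup>2 * (norm (J (x + h) - J x))\<^sup>2) + 2 * (M * norm h)\<^sup>2 * S"
            unfolding k_def using zJ \<sigma>h[of h] by simp
          also have "\<dots> \<le> 2 * (C * norm h powr (1 + \<alpha>)) + 2 * (M\<^sup>2 * norm h powr (1 + \<alpha>)) * S"
          proof (intro add_mono mult_left_mono mult_right_mono S)
            show "(LINT x|lborel. (\<zeta> x)\<^sup>2 * (norm (J (x + h) - J x))\<^sup>2) \<le> C * norm h powr (1 + \<alpha>)"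
              unfolding J_def by (rule diff[OF 2])
            have "norm h powr 2 \<le> norm h powr (1 + \<alpha>)" using 2 C \<alpha> by (intro powr_mono') auto
            then have "(norm h)\<^sup>2 \<le> norm h powr (1 + \<alpha>)" using 2 by simp
            then show "(M * norm h)\<^sup>2 \<le> M\<^sup>2 * norm h powr (1 + \<alpha>)"
              unfolding power_mult_distrib by (intro mult_left_mono) auto
          qed auto
          also have "\<dots> = (2 * C + 2 * M\<^sup>2 * S) * norm h powr (1 + \<alpha>)" by (simp add: algebra_simps)
          also have "\<dots> \<le> C' * norm h powr (1 + \<alpha>)"
            using S C by (intro mult_right_mono) (auto simp: C'_def)
          finally show ?thesis .
        qed
        ultimately show ?thesis by blast
      next
        case 3
        define k where "k x = 2 * norm (\<sigma> (x + h)) powr p + 2 * norm (\<sigma> x) powr p" for x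
        have "integrable lborel k" unfolding k_def using \<sigma>h(1)[of h] \<sigma>p by auto
        moreover have "(w (x + h) - w x)\<^sup>2 \<le> k x" for x
        proof -
          have "(w (x + h) - w x)\<^sup>2 \<le> 2 * (w (x + h))\<^sup>2 + 2 * (w x)\<^sup>2"
            using norm_diff_square_le[of "w (x + h)" "w x" 0] by simp
          then show ?thesis using wle[of "x + h"] wle[of x] unfolding k_def by linarith
        qed
        moreover have "(LINT x|lborel. k x) \<le> C' * norm h powr (1 + \<alpha>)"
        proof -
          have "(LINT x|lborel. k x) = 4 * S" unfolding k_def using \<sigma>h[of h] \<sigma>p by (simp add: S_def)
          also have "\<dots> = 4 * S / \<delta> powr (1 + \<alpha>) * \<delta> powr (1 + \<alpha>)" using C by simp
          also have "\<dots> \<le> C' * norm h powr (1 + \<alpha>)"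
            using S C 3 \<alpha> by (intro mult_mono powr_mono2) (auto simp: C'_def)
          finally show ?thesis .
        qed
        ultimately show ?thesis by blast
      qed
    qed
    then obtain k where k: "integrable lborel k" "\<And>x. (w (x + h) - w x)\<^sup>2 \<le> k x"
      "(LINT x|lborel. k x) \<le> C' * norm h powr (1 + \<alpha>)" by blast
    have "(\<integral>\<^sup>+x. ennreal ((w (x + h) - w x)\<^sup>2) \<partial>lborel) \<le> (\<integral>\<^sup>+x. ennreal (k x) \<partial>lborel)"
      by (intro nn_integral_mono ennreal_leI k(2))
    also have "\<dots> = ennreal (LINT x|lborel. k x)"
      by (rule nn_integral_eq_integral[OF k(1)]) (use order.trans[OF zero_le_power2 k(2)] in auto)
    also have "\<dots> \<le> ennreal (C' * norm h powr (1 + \<alpha>))" by (rule ennreal_leI[OF k(3)])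
    finally show ?thesis .
  qed
  define n where "n = real DIM('a)"
  have n: "2 \<le> n" using dim by (simp add: n_def)
  have "integrable lborel (\<lambda>x. w x powr (2 * r / p))"
  proof (rule difference_quotient_embedding[OF wm _ w2 compact_imp_bounded[OF K(1)] _ C' _ _ bound])
    show "0 \<le> w x" for x using \<zeta>(2) by (simp add: w_def)
    show "w x = 0" if "x \<notin> K" for x using K(2)[OF that] by (simp add: w_def)
    show "0 < 1 + \<alpha>" "1 + \<alpha> < real DIM('a)" using \<alpha> dim by auto
    show "0 < 2 * r / p" using r p_gt1 by simp
    show "2 * r / p < real (2 * DIM('a)) / (real DIM('a) - (1 + \<alpha>))"
    proof -
      have "r < n * p / (n - (1 + \<alpha>))" using r(2) by (simp add: n_def diff_diff_eq add.commute)
      then have "2 * r / p < 2 * (n * p / (n - (1 + \<alpha>))) / p" using p_gt1 by (intro divide_strict_right_mono) auto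
      also have "\<dots> = 2 * n / (n - (1 + \<alpha>))" using p_gt1 by simp
      finally show ?thesis by (simp add: n_def)
    qed
  qed
  moreover have "w x powr (2 * r / p) = \<zeta> x powr (2 * r / p) * norm (\<sigma> x) powr r" for x
  proof -
    have "p / 2 * (2 * r / p) = r" using p_gt1 by simp
    then show ?thesis by (simp add: w_def J_def powr_mult powr_powr)
  qed
  ultimately show ?thesis by simp
qed

text \<open>
  A compact set is covered by finitely many open sets on each of which some box bump is bounded below by a
  positive constant.
\<close>

theorem minimiser_locally_Lr:
  fixes s :: "'a::euclidean_space \<Rightarrow> 'a" and \<alpha> r :: real
  assumes \<Omega>: "open \<Omega>" "bounded \<Omega>" and \<alpha>: "0 < \<alpha>" "\<alpha> < 1" and dim: "2 \<le> DIM('a)"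
    and f: "f \<in> Lp_space p \<Omega>" "f \<in> Besov_infty_loc \<alpha> p \<Omega>"
    and min: "is_arg_min (congestion_cost p \<Omega>) (admissible p q \<Omega> f) s"
    and r: "0 < r" "r < DIM('a) * p / (DIM('a) - \<alpha> - 1)"
  shows "s \<in> Lp_loc r \<Omega>"
  unfolding Lp_loc_def
proof (clarify)
  fix K assume K: "compact K" "K \<subseteq> \<Omega>"
  note fm = finite_measure_lebesgue_on[OF \<Omega>(2,1)]
  have "admissible p q \<Omega> f s" using min by (simp add: is_arg_min_def)
  then have sLp: "s \<in> Lp_space p \<Omega>" by (simp add: admissible_def)
  note s = Lp_spaceD[OF sLp]
  obtain \<sigma> where \<sigma>: "\<sigma> \<in> borel_measurable borel" "\<And>x. x \<notin> \<Omega> \<Longrightarrow> \<sigma> x = 0" "AE x in lebesgue_on \<Omega>. s x = \<sigma> x"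
    using borel_representative[OF \<Omega>(1) s(1)] by blast
  note \<sigma>m [measurable] = \<sigma>(1)
  have \<sigma>p: "integrable lborel (\<lambda>x. norm (\<sigma> x) powr p)"
  proof -
    have "integrable (lebesgue_on \<Omega>) (\<lambda>x. norm (s x) powr p) \<longleftrightarrow> integrable lborel (\<lambda>x. norm (\<sigma> x) powr p)"
    proof (rule lborel_transfer(2)[OF \<Omega>(1)])
      show "AE x in lebesgue_on \<Omega>. norm (s x) powr p = norm (\<sigma> x) powr p" using \<sigma>(3) by eventually_elim simp
      show "(\<lambda>x. norm (s x) powr p) \<in> borel_measurable (lebesgue_on \<Omega>)" using s by auto
      show "(\<lambda>x. norm (\<sigma> x) powr p) \<in> borel_measurable borel" by measurable
      show "norm (\<sigma> x) powr p = 0" if "x \<notin> \<Omega>" for x using \<sigma>(2)[OF that] by simp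
    qed
    then show ?thesis using s(2) by simp
  qed
  have "\<exists>z. x \<in> box (fst z) (snd z) \<and> cbox (fst z) (snd z) \<subseteq> \<Omega>" if "x \<in> K" for x
  proof -
    have "x \<in> \<Omega>" using K(2) that by (rule subsetD)
    then obtain a b where "cbox a b \<subseteq> \<Omega>" "x \<in> box a b"
      using open_contains_cbox[OF \<Omega>(1)] by metis
    then show ?thesis by (intro exI[of _ "(a, b)"]) simp
  qed
  then obtain z where z: "\<And>x. x \<in> K \<Longrightarrow> x \<in> box (fst (z x)) (snd (z x))"
    "\<And>x. x \<in> K \<Longrightarrow> cbox (fst (z x)) (snd (z x)) \<subseteq> \<Omega>" by metis
  define \<zeta> where "\<zeta> x = box_bump 1 (fst (z x)) (snd (z x))" for x
  have \<zeta>: "\<zeta> x \<in> test_functions \<Omega>" if "x \<in> K" for x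
    unfolding \<zeta>_def by (rule box_bump_test(1)) (use z(2)[OF that] in auto)
  have \<zeta>b: "0 \<le> \<zeta> x y" "\<zeta> x y \<le> 1" for x y unfolding \<zeta>_def by (rule box_bump_bounds)+
  have \<zeta>pos: "0 < \<zeta> x x" if "x \<in> K" for x unfolding \<zeta>_def by (rule box_bump_pos) (use z(1)[OF that] in auto)
  define U where "U x = {y. \<zeta> x x / 2 < \<zeta> x y}" for x
  have Uo: "open (U x)" for x
    unfolding U_def \<zeta>_def by (intro open_Collect_less continuous_on_const smooth_continuous smooth_box_bump)
  have "K \<subseteq> (\<Union>x\<in>K. U x)"
  proof
    fix x assume "x \<in> K"
    then have "x \<in> U x" using \<zeta>pos[of x] by (simp add: U_def)
    then show "x \<in> (\<Union>x\<in>K. U x)" using \<open>x \<in> K\<close> by blast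
  qed
  then obtain T where T: "T \<subseteq> K" "finite T" "K \<subseteq> (\<Union>x\<in>T. U x)"
    using compactE_image[OF K(1), of K U] Uo by blast
  define t where "t = 2 * r / p"
  have t: "0 < t" using r p_gt1 by (simp add: t_def)
  define Y where "Y y = (\<Sum>x\<in>T. (\<zeta> x x / 2) powr (- t) * (\<zeta> x y powr t * norm (\<sigma> y) powr r))" for y
  have Yi: "integrable lborel Y"
    unfolding Y_def t_def
  proof (intro Bochner_Integration.integrable_sum integrable_mult_right)
    fix x assume "x \<in> T"
    then have "x \<in> K" using T by auto
    show "integrable lborel (\<lambda>y. \<zeta> x y powr (2 * r / p) * norm (\<sigma> y) powr r)"
      by (rule weighted_higher_integrability[OF \<Omega> \<alpha> dim f min \<sigma> \<sigma>p \<zeta>[OF \<open>x \<in> K\<close>] \<zeta>b r])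
  qed
  have Yge: "norm (\<sigma> y) powr r \<le> Y y" if y: "y \<in> K" for y
  proof -
    obtain x where x: "x \<in> T" "y \<in> U x" using T(3) y by blast
    have pos: "0 < \<zeta> x x / 2" using \<zeta>pos[of x] x T by auto
    have "1 = (\<zeta> x x / 2) powr (- t) * (\<zeta> x x / 2) powr t" using pos by (simp flip: powr_add)
    also have "\<dots> \<le> (\<zeta> x x / 2) powr (- t) * \<zeta> x y powr t"
      using x(2) pos t by (intro mult_left_mono powr_mono2) (auto simp: U_def)
    finally have "1 * norm (\<sigma> y) powr r \<le> (\<zeta> x x / 2) powr (- t) * \<zeta> x y powr t * norm (\<sigma> y) powr r"
      by (intro mult_right_mono) auto
    also have "\<dots> = (\<zeta> x x / 2) powr (- t) * (\<zeta> x y powr t * norm (\<sigma> y) powr r)" by (simp only: mult.assoc)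
    also have "\<dots> \<le> Y y" unfolding Y_def
      by (rule member_le_sum[OF x(1) _ T(2)]) (auto intro!: mult_nonneg_nonneg)
    finally show ?thesis by simp
  qed
  have K': "K \<inter> space lebesgue \<in> sets lebesgue" using fmeasurableD[OF lmeasurable_compact[OF K(1)]] by auto
  have \<Omega>': "\<Omega> \<inter> space lebesgue \<in> sets lebesgue" using \<Omega> by auto
  have "s \<in> Lp_loc 1 \<Omega>"
    by (rule Lp_loc_1I[OF \<Omega>(1) integrable_of_powr[OF fm s(1) _ s(2)]]) (use p_gt1 in simp)
  then have sK: "s \<in> borel_measurable (lebesgue_on K)" using K by (auto simp: Lp_loc_def Lp_space_def)
  have "integrable (lebesgue_on K) (\<lambda>x. norm (s x) powr r)"
  proof (rule Bochner_Integration.integrable_bound)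
    have "integrable lebesgue Y" using Yi borel_measurable_integrable[OF Yi] by (subst integrable_completion) auto
    then show "integrable (lebesgue_on K) Y"
      unfolding integrable_restrict_space[OF K'] using K' by (intro integrable_mult_indicator) auto
    show "(\<lambda>x. norm (s x) powr r) \<in> borel_measurable (lebesgue_on K)" using sK by measurable
    have "AE x in lebesgue. x \<in> \<Omega> \<longrightarrow> s x = \<sigma> x" using \<sigma>(3) unfolding AE_restrict_space_iff[OF \<Omega>'] .
    then have "AE x in lebesgue. x \<in> K \<longrightarrow> norm (norm (s x) powr r) \<le> norm (Y x)"
    proof eventually_elim
      case (elim x)
      then show ?case using Yge[of x] K(2) by auto
    qed
    then show "AE x in lebesgue_on K. norm (norm (s x) powr r) \<le> norm (Y x)"
      unfolding AE_restrict_space_iff[OF K'] .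
  qed
  then show "s \<in> Lp_space r K" using sK by (simp add: Lp_space_def)
qed

end

theorem corollary4p4:
  fixes \<Omega> :: "(real ^ 'n) set"
    and f :: "real ^ 'n \<Rightarrow> real"
    and \<sigma>\<^sub>0 :: "real ^ 'n \<Rightarrow> real ^ 'n"
    and p q \<alpha> :: real
  assumes "CARD('n) \<ge> 2" and "q \<ge> 2" and "p = q / (q - 1)" and "0 < \<alpha>" and "\<alpha> < 1"
    and "open \<Omega>" and "bounded \<Omega>" and "connected \<Omega>" and "Lipschitz_boundary \<Omega>"
    and "f \<in> Lp_space p \<Omega>" and "f \<in> Besov_infty_loc \<alpha> p \<Omega>"
    and "(LINT x|lebesgue_on \<Omega>. f x) = 0"
    and "is_arg_min (congestion_cost p \<Omega>) (admissible p q \<Omega> f) \<sigma>\<^sub>0"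
  shows "\<forall>r. 1 \<le> r \<and> r < real CARD('n) * p / (real CARD('n) - \<alpha> - 1) \<longrightarrow> \<sigma>\<^sub>0 \<in> Lp_loc r \<Omega>"
proof -
  interpret dual_exponents p q
    using assms(2,3) by unfold_locales
  show ?thesis
  proof (intro allI impI)
    fix r :: real
    assume "1 \<le> r \<and> r < real CARD('n) * p / (real CARD('n) - \<alpha> - 1)"
    then show "\<sigma>\<^sub>0 \<in> Lp_loc r \<Omega>"
      using assms(1) by (intro minimiser_locally_Lr[OF assms(6,7,4,5) _ assms(10,11,13)]) auto
  qed
qed

end
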